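(* Let $X$ be a variety over $k$ and let $G$ be a connected linear algebraic subgroup of $\mathrm{Aut}(X)$. If $G$ has no nontrivial characters and $X$ is the closure of a $G$-orbit, then $\mathrm{ML}(X)=k$.
   Context: $k$ is an algebraically closed field of characteristic zero; variety means algebraic variety over $k$ (not necessarily affine). $k[X]$ is the $k$-algebra of regular functions on $X$, and $\mathrm{Aut}(X)$ is the automorphism group of $X$. A homomorphism from an algebraic group to $\mathrm{Aut}(X)$ is called algebraic if it is defined by an algebraic action of that group on $X$; its image is called an algebraic subgroup of $\mathrm{Aut}(X)$, and if the homomorphism is injective the image is identified with the group. A character of $G$ is an algebraic homomorphism $G\to\mathbf{G}_m$. The Makar-Limanov invariant of $X$ is the $k$-subalgebra $\mathrm{ML}(X):=\bigcap_H k[X]^H$ of $k[X]$, where $H$ runs over the images of all algebraic homomorphisms $\mathbf{G}_a\to\mathrm{Aut}(X)$. *)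

theory Defs
  imports
    "HOL-Analysis.Abstract_Topology"
    "HOL-Analysis.Function_Topology"
    "HOL-Algebra.Bij"
    "HOL-Computational_Algebra.Polynomial"
begin

text \<open>
  Varieties over an algebraically closed field are treated in the classical way (Serre, Borel,
  Springer): a topological space together with a sheaf of \<open>'k\<close>-valued functions that is locally
  isomorphic to an affine algebraic set.  A function on an open set \<open>U\<close> is represented by
  its extensional representative, so that equality of sections is equality of functions.
\<close>

record ('x, 'k) fun_space =
  Top :: "'x topology"
  Reg :: "'x set \<Rightarrow> ('x \<Rightarrow> 'k) set"

abbreviation pts :: "('x, 'k) fun_space \<Rightarrow> 'x set" where
  "pts X \<equiv> topspace (Top X)"

definition space_with_functions :: "('x, 'k::field) fun_space \<Rightarrow> bool" where
  "space_with_functions X \<longleftrightarrow>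
     (\<forall>U. openin (Top X) U \<longrightarrow>
        Reg X U \<subseteq> extensional U \<and>
        (\<forall>c. (\<lambda>x\<in>U. c) \<in> Reg X U) \<and>
        (\<forall>f\<in>Reg X U. \<forall>g\<in>Reg X U.
           (\<lambda>x\<in>U. f x + g x) \<in> Reg X U \<and> (\<lambda>x\<in>U. f x * g x) \<in> Reg X U)) \<and>
     (\<forall>U V f. openin (Top X) U \<and> openin (Top X) V \<and> V \<subseteq> U \<and> f \<in> Reg X U
        \<longrightarrow> restrict f V \<in> Reg X V) \<and>
     (\<forall>\<U> f. (\<forall>U\<in>\<U>. openin (Top X) U \<and> restrict f U \<in> Reg X U) \<and> f \<in> extensional (\<Union>\<U>)
        \<longrightarrow> f \<in> Reg X (\<Union>\<U>))"

definition morphism ::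
  "('x, 'k) fun_space \<Rightarrow> ('y, 'k) fun_space \<Rightarrow> ('x \<Rightarrow> 'y) \<Rightarrow> bool" where
  "morphism X Y \<phi> \<longleftrightarrow>
     continuous_map (Top X) (Top Y) \<phi> \<and>
     (\<forall>V f. openin (Top Y) V \<and> f \<in> Reg Y V
        \<longrightarrow> restrict (f \<circ> \<phi>) {x \<in> pts X. \<phi> x \<in> V} \<in> Reg X {x \<in> pts X. \<phi> x \<in> V})"

definition isomorphic :: "('x, 'k) fun_space \<Rightarrow> ('y, 'k) fun_space \<Rightarrow> bool" where
  "isomorphic X Y \<longleftrightarrow>
     (\<exists>\<phi> \<psi>. morphism X Y \<phi> \<and> morphism Y X \<psi> \<and>
        (\<forall>x\<in>pts X. \<psi> (\<phi> x) = x) \<and> (\<forall>y\<in>pts Y. \<phi> (\<psi> y) = y))"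

definition open_subspace :: "('x, 'k) fun_space \<Rightarrow> 'x set \<Rightarrow> ('x, 'k) fun_space" where
  "open_subspace X U = \<lparr>Top = subtopology (Top X) U, Reg = Reg X\<rparr>"

text \<open>
  The space with functions on a set \<open>V\<close> defined by a ring \<open>P\<close> of (polynomial) functions: the
  topology has the principal open sets as a basis, and the regular functions are those that are
  locally quotients of elements of \<open>P\<close>.
\<close>

definition zariski_space :: "'x set \<Rightarrow> ('x \<Rightarrow> 'k::field) set \<Rightarrow> ('x, 'k) fun_space" where
  "zariski_space V P =
     (let T = topology_generated_by {{x \<in> V. p x \<noteq> 0} | p. p \<in> P} in
      \<lparr>Top = T,
       Reg = (\<lambda>U. {f \<in> extensional U. \<forall>x\<in>U. \<exists>W p q.
          openin T W \<and> x \<in> W \<and> W \<subseteq> U \<and> p \<in> P \<and> q \<in> P \<and>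
          (\<forall>y\<in>W. q y \<noteq> 0 \<and> f y = p y / q y)})\<rparr>)"

inductive_set poly_funs :: "nat \<Rightarrow> ((nat \<Rightarrow> 'k::field) \<Rightarrow> 'k) set" for n :: nat where
  const: "(\<lambda>x. c) \<in> poly_funs n"
| coord: "i < n \<Longrightarrow> (\<lambda>x. x i) \<in> poly_funs n"
| add: "p \<in> poly_funs n \<Longrightarrow> q \<in> poly_funs n \<Longrightarrow> (\<lambda>x. p x + q x) \<in> poly_funs n"
| mult: "p \<in> poly_funs n \<Longrightarrow> q \<in> poly_funs n \<Longrightarrow> (\<lambda>x. p x * q x) \<in> poly_funs n"

definition zero_locus :: "nat \<Rightarrow> ((nat \<Rightarrow> 'k::field) \<Rightarrow> 'k) set \<Rightarrow> (nat \<Rightarrow> 'k) set" where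
  "zero_locus n S = {x \<in> {..<n} \<rightarrow>\<^sub>E UNIV. \<forall>p\<in>S. p x = 0}"

definition affine_variety :: "('x, 'k::field) fun_space \<Rightarrow> bool" where
  "affine_variety X \<longleftrightarrow>
     space_with_functions X \<and>
     (\<exists>n S. S \<subseteq> poly_funs n \<and> isomorphic X (zariski_space (zero_locus n S) (poly_funs n)))"

definition prevariety :: "('x, 'k::field) fun_space \<Rightarrow> bool" where
  "prevariety X \<longleftrightarrow>
     space_with_functions X \<and>
     (\<exists>\<U>. finite \<U> \<and> \<Union>\<U> = pts X \<and>
        (\<forall>U\<in>\<U>. openin (Top X) U \<and> affine_variety (open_subspace X U)))"

text \<open>
  The product of prevarieties.  Its topology is not the product topology: it is generated by
  the sets \<open>{(x, y) \<in> U \<times> V. h (x, y) \<noteq> 0}\<close>, where \<open>h\<close> is a finite sum of products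
  \<open>f x * g y\<close> with \<open>f\<close> and \<open>g\<close> regular on the open sets \<open>U\<close> and \<open>V\<close>; regular
  functions are locally quotients of such functions \<open>h\<close>.  For affine varieties this is
  the affine variety with coordinate ring \<open>k[X] \<otimes> k[Y]\<close>.
\<close>

definition tensor_funs ::
  "('x, 'k::field) fun_space \<Rightarrow> ('y, 'k) fun_space \<Rightarrow> 'x set \<Rightarrow> 'y set \<Rightarrow> ('x \<times> 'y \<Rightarrow> 'k) set" where
  "tensor_funs X Y U V =
     {\<lambda>(x, y). \<Sum>i<n. f i x * g i y | (n::nat) f g. \<forall>i<n. f i \<in> Reg X U \<and> g i \<in> Reg Y V}"

definition prod_space ::
  "('x, 'k::field) fun_space \<Rightarrow> ('y, 'k) fun_space \<Rightarrow> ('x \<times> 'y, 'k) fun_space" where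
  "prod_space X Y =
     (let T = topology_generated_by
        {{z \<in> U \<times> V. h z \<noteq> 0} | U V h.
           openin (Top X) U \<and> openin (Top Y) V \<and> h \<in> tensor_funs X Y U V} in
      \<lparr>Top = T,
       Reg = (\<lambda>W. {f \<in> extensional W. \<forall>z\<in>W. \<exists>W' U V p q.
          openin T W' \<and> z \<in> W' \<and> W' \<subseteq> W \<and>
          openin (Top X) U \<and> openin (Top Y) V \<and> W' \<subseteq> U \<times> V \<and>
          p \<in> tensor_funs X Y U V \<and> q \<in> tensor_funs X Y U V \<and>
          (\<forall>w\<in>W'. q w \<noteq> 0 \<and> f w = p w / q w)})\<rparr>)"

definition variety :: "('x, 'k::field) fun_space \<Rightarrow> bool" where
  "variety X \<longleftrightarrow> prevariety X \<and> closedin (Top (prod_space X X)) (Id_on (pts X))"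

record ('g, 'k) alg_group = "'g monoid" +
  space :: "('g, 'k) fun_space"

definition algebraic_group :: "('g, 'k::field) alg_group \<Rightarrow> bool" where
  "algebraic_group G \<longleftrightarrow>
     group G \<and> pts (space G) = carrier G \<and> variety (space G) \<and>
     morphism (prod_space (space G) (space G)) (space G) (\<lambda>(g, h). g \<otimes>\<^bsub>G\<^esub> h) \<and>
     morphism (space G) (space G) (\<lambda>g. inv\<^bsub>G\<^esub> g)"

definition linear_algebraic_group :: "('g, 'k::field) alg_group \<Rightarrow> bool" where
  "linear_algebraic_group G \<longleftrightarrow> algebraic_group G \<and> affine_variety (space G)"

definition additive_group :: "('k::field, 'k) alg_group" ("\<bbbG>\<^sub>a") where
  "\<bbbG>\<^sub>a = \<lparr>carrier = UNIV, monoid.mult = (+), one = 0, space = zariski_space UNIV (range poly)\<rparr>"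

definition multiplicative_group :: "('k::field, 'k) alg_group" ("\<bbbG>\<^sub>m") where
  "\<bbbG>\<^sub>m = \<lparr>carrier = UNIV - {0}, monoid.mult = (*), one = 1,
          space = zariski_space (UNIV - {0}) (range poly)\<rparr>"

definition characters :: "('g, 'k::field) alg_group \<Rightarrow> ('g \<Rightarrow> 'k) set" where
  "characters G = {\<chi> \<in> hom G \<bbbG>\<^sub>m. morphism (space G) (space \<bbbG>\<^sub>m) \<chi>}"

definition Aut :: "('x, 'k) fun_space \<Rightarrow> ('x \<Rightarrow> 'x) monoid" where
  "Aut X = (BijGroup (pts X))
     \<lparr>carrier := {\<phi> \<in> Bij (pts X). morphism X X \<phi> \<and> morphism X X (inv_into (pts X) \<phi>)}\<rparr>"

definition algebraic_homs ::
  "('g, 'k::field) alg_group \<Rightarrow> ('x, 'k) fun_space \<Rightarrow> ('g \<Rightarrow> 'x \<Rightarrow> 'x) set" where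
  "algebraic_homs G X =
     {\<alpha> \<in> hom G (Aut X). morphism (prod_space (space G) X) X (\<lambda>(g, x). \<alpha> g x)}"

definition invariants :: "('x, 'k) fun_space \<Rightarrow> ('x \<Rightarrow> 'x) set \<Rightarrow> ('x \<Rightarrow> 'k) set" where
  "invariants X H = {f \<in> Reg X (pts X). \<forall>\<sigma>\<in>H. \<forall>x\<in>pts X. f (\<sigma> x) = f x}"

definition makar_limanov :: "('x, 'k::field) fun_space \<Rightarrow> ('x \<Rightarrow> 'k) set" where
  "makar_limanov X = (\<Inter>\<alpha>\<in>algebraic_homs \<bbbG>\<^sub>a X. invariants X (\<alpha> ` carrier \<bbbG>\<^sub>a))"

definition constants :: "('x, 'k) fun_space \<Rightarrow> ('x \<Rightarrow> 'k) set" where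
  "constants X = {\<lambda>x\<in>pts X. c | c. True}"

end

theory Submission
  imports Defs "HOL-Library.Function_Algebras"
begin

text \<open>
  Let \<open>f\<close> lie in \<open>ML(X)\<close> and let \<open>\<phi> g = f (g x)\<close> for a point \<open>x\<close> with dense orbit.  Then \<open>\<phi>\<close> is a
  regular function on \<open>G\<close> that is invariant under left translation by every one-parameter unipotent
  subgroup, so it is killed by every locally nilpotent element \<open>D\<close> of \<open>Lie G\<close>: the exponential of
  \<open>D\<close> is such a subgroup.  The algebra of functions killed by all locally nilpotent elements is
  stable under \<open>Lie G\<close>, which acts on it semisimply (the nilpotent part of an element is again in
  \<open>Lie G\<close>) and hence commutatively (root vectors are locally nilpotent).  So \<open>\<phi>\<close> is a sum of joint
  eigenvectors of \<open>Lie G\<close>.  A joint eigenvector that vanishes at a point lies in all powers of the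
  maximal ideal there, by Euler's identity, so by Krull's theorem it vanishes near that point and, as
  \<open>G\<close> is connected, everywhere.  Therefore a nonzero joint eigenvector is a multiple of a character,
  that is, constant.  Hence \<open>\<phi>\<close> is constant and \<open>f\<close> is constant on a dense orbit.
\<close>

section \<open>Polynomial functions and Hilbert's basis theorem\<close>

text \<open>The hypothesis on \<open>f\<close> concerns unipotent subgroups, the hypothesis on
  characters the whole group; the Lie algebra mediates. Its elements commute with right
  translations, so their flows are left translations, as the invariance of \<open>f\<close> demands.
  The coordinate ring is in general infinite-dimensional, but comultiplication puts all translates
  of a function into the span of finitely many; hence on each single function every element of the
  Lie algebra satisfies a polynomial relation, which is all that generalized eigenspaces require.
  The nilpotent part of a derivation is a derivation because eigenvalues add when functions are
  multiplied. The killed functions are stable under Lie G because a locally nilpotent element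
  vanishes on all left translates of such a function, and this can be differentiated in the
  translation. The Nullstellensatz serves to show that a function which is locally a fraction on an
  affine set is a polynomial. As \<open>X\<close> need not be affine, it is applied to the
  multiplication of G and to the slice \<open>G x {x0}\<close> of \<open>G x X\<close>, on which
  functions pulled back from \<open>X\<close> are constants.\<close>

lemma poly_funs_uminus: "p \<in> poly_funs n \<Longrightarrow> (\<lambda>x. - p x) \<in> poly_funs n"
  using poly_funs.mult[OF poly_funs.const[of "-1"]] by fastforce

lemma poly_funs_diff: "p \<in> poly_funs n \<Longrightarrow> q \<in> poly_funs n \<Longrightarrow> (\<lambda>x. p x - q x) \<in> poly_funs n"
  using poly_funs.add[OF _ poly_funs_uminus] by fastforce

lemma poly_funs_sum:
  "(\<And>i. i \<in> I \<Longrightarrow> p i \<in> poly_funs n) \<Longrightarrow> (\<lambda>x. \<Sum>i\<in>I. p i x) \<in> poly_funs n"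
  by (induction I rule: infinite_finite_induct) (auto intro: poly_funs.intros)

lemma poly_funs_power: "p \<in> poly_funs n \<Longrightarrow> (\<lambda>x. p x ^ k) \<in> poly_funs n"
  by (induction k) (auto intro: poly_funs.intros)

lemma poly_funs_if: "p \<in> poly_funs n \<Longrightarrow> q \<in> poly_funs n \<Longrightarrow> (\<lambda>x. if b then p x else q x) \<in> poly_funs n"
  by (cases b) auto

lemmas poly_funs_intros = poly_funs.intros poly_funs_diff poly_funs_uminus poly_funs_sum poly_funs_power

lemma poly_funs_subst:
  "p \<in> poly_funs n \<Longrightarrow> (\<And>i. i < n \<Longrightarrow> (\<lambda>x. \<sigma> x i) \<in> poly_funs m) \<Longrightarrow> (\<lambda>x. p (\<sigma> x)) \<in> poly_funs m"
  by (induction rule: poly_funs.induct) (auto intro: poly_funs.intros)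

lemma poly_funs_mono: "p \<in> poly_funs n \<Longrightarrow> n \<le> m \<Longrightarrow> p \<in> poly_funs m"
  by (induction rule: poly_funs.induct) (auto intro: poly_funs.intros)

lemma poly_funs_cong:
  "p \<in> poly_funs n \<Longrightarrow> (\<And>i. i < n \<Longrightarrow> x i = y i) \<Longrightarrow> p x = p y"
  by (induction rule: poly_funs.induct) auto

text \<open>The coefficients are not assumed to vanish beyond \<open>m\<close> and \<open>k\<close>,
  so the Cauchy product has to cut off both factors in its index set.\<close>

lemma sum_mult_sum_powers:
  fixes c d :: "nat \<Rightarrow> 'a::comm_semiring_1"
  shows "(\<Sum>i\<le>m. c i * t ^ i) * (\<Sum>i\<le>k. d i * t ^ i) =
    (\<Sum>l\<le>m+k. (\<Sum>i\<in>{i. i \<le> m \<and> i \<le> l \<and> l - i \<le> k}. c i * d (l - i)) * t ^ l)"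
proof -
  have "(\<Sum>i\<le>m. c i * t ^ i) * (\<Sum>i\<le>k. d i * t ^ i) = (\<Sum>(i,j)\<in>{..m}\<times>{..k}. c i * d j * t ^ (i + j))"
    by (simp add: sum_product sum.cartesian_product power_add ac_simps)
  also have "\<dots> = (\<Sum>(l,i)\<in>Sigma {..m+k} (\<lambda>l. {i. i \<le> m \<and> i \<le> l \<and> l - i \<le> k}). c i * d (l - i) * t ^ l)"
    by (rule sum.reindex_bij_witness[of _ "\<lambda>(l,i). (i, l - i)" "\<lambda>(i,j). (i + j, i)"]) auto
  also have "\<dots> = (\<Sum>l\<le>m+k. \<Sum>i\<in>{i. i \<le> m \<and> i \<le> l \<and> l - i \<le> k}. c i * d (l - i) * t ^ l)"
    by (subst sum.Sigma) auto
  finally show ?thesis by (simp add: sum_distrib_right)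
qed

text \<open>Elements of \<open>poly_funs\<close> are functions without a normal form, so the
  expansion in the last variable is recovered by induction on their construction. Over a finite
  field it is not unique.\<close>

lemma poly_funs_SucE:
  assumes "p \<in> poly_funs (Suc n)"
  obtains d c where "\<And>i. c i \<in> poly_funs n" "\<And>x. p x = (\<Sum>i\<le>d. c i x * x n ^ i)"
proof -
  have "\<exists>d c. (\<forall>i. c i \<in> poly_funs n) \<and> (\<forall>x. p x = (\<Sum>i\<le>d. c i x * x n ^ i))"
    using assms
  proof (induction rule: poly_funs.induct)
    case (const a)
    show ?case by (rule exI[of _ 0], rule exI[of _ "\<lambda>_ _. a"]) (auto intro: poly_funs.intros)
  next
    case (coord i)
    show ?case
    proof (cases "i = n")
      case True
      show ?thesis
        by (rule exI[of _ 1], rule exI[of _ "\<lambda>i _. of_bool (i = 1)"]) (auto intro: poly_funs.intros simp: True)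
    next
      case False
      with coord have "i < n" by simp
      then show ?thesis
        by (intro exI[of _ 0] exI[of _ "\<lambda>_ x. x i"]) (auto intro: poly_funs.intros)
    qed
  next
    case (add p q)
    from add.IH(1) obtain d c where c: "\<And>i. c i \<in> poly_funs n" "\<And>x. p x = (\<Sum>i\<le>d. c i x * x n ^ i)"
      by (elim exE conjE) blast
    from add.IH(2) obtain d' c' where c': "\<And>i. c' i \<in> poly_funs n" "\<And>x. q x = (\<Sum>i\<le>d'. c' i x * x n ^ i)"
      by (elim exE conjE) blast
    define e where "e i x = (if i \<le> d then c i x else 0) + (if i \<le> d' then c' i x else 0)" for i x
    have "p x + q x = (\<Sum>i\<le>max d d'. e i x * x n ^ i)" for x
    proof -
      have "p x = (\<Sum>i\<le>max d d'. (if i \<le> d then c i x else 0) * x n ^ i)"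
        unfolding c by (rule sum.mono_neutral_cong_left) auto
      moreover have "q x = (\<Sum>i\<le>max d d'. (if i \<le> d' then c' i x else 0) * x n ^ i)"
        unfolding c' by (rule sum.mono_neutral_cong_left) auto
      ultimately show ?thesis by (simp add: e_def distrib_right sum.distrib)
    qed
    moreover have "e i \<in> poly_funs n" for i
      unfolding e_def using c(1)[of i] c'(1)[of i]
      by (cases "i \<le> d"; cases "i \<le> d'") (simp_all add: poly_funs.intros)
    ultimately show ?case by blast
  next
    case (mult p q)
    from mult.IH(1) obtain d c where c: "\<And>i. c i \<in> poly_funs n" "\<And>x. p x = (\<Sum>i\<le>d. c i x * x n ^ i)"
      by (elim exE conjE) blast
    from mult.IH(2) obtain d' c' where c': "\<And>i. c' i \<in> poly_funs n" "\<And>x. q x = (\<Sum>i\<le>d'. c' i x * x n ^ i)"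
      by (elim exE conjE) blast
    show ?case
      by (rule exI[of _ "d + d'"], rule exI[of _ "\<lambda>l x. \<Sum>i\<in>{i. i \<le> d \<and> i \<le> l \<and> l - i \<le> d'}. c i x * c' (l - i) x"])
        (intro conjI allI poly_funs_intros c(1) c'(1), simp only: c(2) c'(2) sum_mult_sum_powers)
  qed
  then show ?thesis using that by metis
qed

section \<open>Ideals of polynomial functions\<close>

definition pf_ideal :: "nat \<Rightarrow> ((nat \<Rightarrow> 'k::field) \<Rightarrow> 'k) set \<Rightarrow> bool" where
  "pf_ideal n I \<longleftrightarrow> I \<subseteq> poly_funs n \<and> (\<lambda>x. 0) \<in> I \<and> (\<forall>p\<in>I. \<forall>q\<in>I. (\<lambda>x. p x + q x) \<in> I) \<and>
     (\<forall>p\<in>poly_funs n. \<forall>q\<in>I. (\<lambda>x. p x * q x) \<in> I)"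

lemma pf_idealD:
  assumes "pf_ideal n I"
  shows "p \<in> I \<Longrightarrow> p \<in> poly_funs n" "(\<lambda>x. 0) \<in> I"
    "p \<in> I \<Longrightarrow> q \<in> I \<Longrightarrow> (\<lambda>x. p x + q x) \<in> I"
    "p \<in> poly_funs n \<Longrightarrow> q \<in> I \<Longrightarrow> (\<lambda>x. p x * q x) \<in> I"
  using assms unfolding pf_ideal_def by auto

lemma pf_ideal_sum:
  assumes "pf_ideal n I" "\<And>i. i \<in> J \<Longrightarrow> p i \<in> I"
  shows "(\<lambda>x. \<Sum>i\<in>J. p i x) \<in> I"
  using assms(2) by (induction J rule: infinite_finite_induct) (auto intro: pf_idealD[OF assms(1)])

lemma pf_ideal_diff:
  assumes "pf_ideal n I" "p \<in> I" "q \<in> I"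
  shows "(\<lambda>x. p x - q x) \<in> I"
  using pf_idealD(3)[OF assms(1,2) pf_idealD(4)[OF assms(1) poly_funs.const[of "-1"] assms(3)]]
  by simp

text \<open>Otherwise the ideal of the sequence is not finitely generated, and one can keep choosing
  elements of minimal degree in the last variable outside the ideal of the previous choices. By
  induction on \<open>n\<close> their leading coefficients satisfy a relation of the same kind, and
  it lowers the degree of one choice.\<close>

theorem hilbert_basis_sequence:
  fixes P :: "nat \<Rightarrow> (nat \<Rightarrow> 'k::field) \<Rightarrow> 'k"
  assumes "\<And>i. P i \<in> poly_funs n"
  shows "\<exists>M Q. (\<forall>i. Q i \<in> poly_funs n) \<and> (\<forall>x. P M x = (\<Sum>i<M. Q i x * P i x))"
  using assms
proof (induction n arbitrary: P)
  case 0
  have const: "\<exists>c. p = (\<lambda>_. c)" if "p \<in> poly_funs 0" for p :: "(nat \<Rightarrow> 'k) \<Rightarrow> 'k"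
    using that by (induction rule: poly_funs.induct) auto
  obtain a where a: "P 0 = (\<lambda>_. a)" using const 0 by blast
  obtain b where b: "P 1 = (\<lambda>_. b)" using const 0 by blast
  \<comment> \<open>A zero constant is the empty combination, so \<open>M = 0\<close> works;
    otherwise \<open>P 1\<close> is a multiple of \<open>P 0\<close>.\<close>
  show ?case
  proof (cases "a = 0")
    case True
    then show ?thesis using a by (intro exI[of _ 0] exI[of _ "\<lambda>_ _. 0"]) (auto intro: poly_funs.intros)
  next
    case False
    then show ?thesis using a b by (intro exI[of _ 1] exI[of _ "\<lambda>_ _. b / a"]) (auto intro: poly_funs.intros)
  qed
next
  case (Suc n)
  define I where "I = {p. \<exists>M Q. (\<forall>i. Q i \<in> poly_funs (Suc n)) \<and> (\<forall>x. p x = (\<Sum>i<(M::nat). Q i x * P i x))}"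
  have I_add: "(\<lambda>x. p x + q x) \<in> I" if "p \<in> I" "q \<in> I" for p q
  proof -
    obtain M Q M' Q' where Q: "\<And>i. Q i \<in> poly_funs (Suc n)" "\<And>x. p x = (\<Sum>i<(M::nat). Q i x * P i x)"
      and Q': "\<And>i. Q' i \<in> poly_funs (Suc n)" "\<And>x. q x = (\<Sum>i<(M'::nat). Q' i x * P i x)"
      using \<open>p \<in> I\<close> \<open>q \<in> I\<close> unfolding I_def by blast
    define e where "e i x = (if i < M then Q i x else 0) + (if i < M' then Q' i x else 0)" for i x
    have "p x + q x = (\<Sum>i<max M M'. e i x * P i x)" for x
    proof -
      have "p x = (\<Sum>i<max M M'. (if i < M then Q i x else 0) * P i x)"
        unfolding Q by (rule sum.mono_neutral_cong_left) auto
      moreover have "q x = (\<Sum>i<max M M'. (if i < M' then Q' i x else 0) * P i x)"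
        unfolding Q' by (rule sum.mono_neutral_cong_left) auto
      ultimately show ?thesis by (simp add: e_def distrib_right sum.distrib)
    qed
    moreover have "e i \<in> poly_funs (Suc n)" for i
      unfolding e_def using Q(1)[of i] Q'(1)[of i]
      by (cases "i < M"; cases "i < M'") (simp_all add: poly_funs.intros)
    ultimately show ?thesis unfolding I_def by blast
  qed
  have I_mult: "(\<lambda>x. p x * q x) \<in> I" if p: "p \<in> poly_funs (Suc n)" and q: "q \<in> I" for p q
  proof -
    obtain M Q where Q: "\<And>i. Q i \<in> poly_funs (Suc n)" "\<And>x. q x = (\<Sum>i<(M::nat). Q i x * P i x)"
      using q unfolding I_def by blast
    have "p x * q x = (\<Sum>i<M. (p x * Q i x) * P i x)" for x
      by (simp add: Q sum_distrib_left mult.assoc)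
    with Q(1) p show ?thesis unfolding I_def
      by (intro CollectI exI[of _ M] exI[of _ "\<lambda>i x. p x * Q i x"] conjI allI poly_funs.mult) auto
  qed
  have I_P: "P i \<in> I" for i
  proof -
    have "P i x = (\<Sum>j<Suc i. of_bool (j = i) * P j x)" for x by simp
    moreover have "(\<lambda>x. of_bool (j = i)) \<in> poly_funs (Suc n)" for j by (rule poly_funs.const)
    ultimately show ?thesis unfolding I_def by (auto intro!: exI[of _ "Suc i"] exI[of _ "\<lambda>j _. of_bool (j = i)"])
  qed
  have I_sub: "I \<subseteq> poly_funs (Suc n)"
  proof
    fix p assume "p \<in> I"
    then obtain M Q where Q: "\<And>i. Q i \<in> poly_funs (Suc n)" "\<And>x. p x = (\<Sum>i<(M::nat). Q i x * P i x)"
      unfolding I_def by blast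
    then have "p = (\<lambda>x. \<Sum>i<M. Q i x * P i x)" by auto
    with Q(1) Suc.prems show "p \<in> poly_funs (Suc n)" by (auto intro!: poly_funs_intros)
  qed
  have I_0: "(\<lambda>x. 0) \<in> I"
    unfolding I_def by (intro CollectI exI[of _ 0] exI[of _ "\<lambda>_ _. 0"]) (simp add: poly_funs.const)
  have I: "pf_ideal (Suc n) I"
    unfolding pf_ideal_def using I_sub I_add I_mult I_0 by blast
  define gen where "gen F M = {p. \<exists>Q. (\<forall>i. Q i \<in> poly_funs (Suc n)) \<and> (\<forall>x. p x = (\<Sum>i<(M::nat). Q i x * F i x))}"
    for F :: "nat \<Rightarrow> (nat \<Rightarrow> 'k) \<Rightarrow> 'k" and M
  \<comment> \<open>The expansion is carried along as data, because over a finite field the function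
    does not determine its degree and coefficients.\<close>
  define rep where "rep p d c \<longleftrightarrow> (\<forall>i. c i \<in> poly_funs n) \<and> (\<forall>x. p x = (\<Sum>i\<le>d. c i x * x n ^ i))"
    for p and d :: nat and c :: "nat \<Rightarrow> (nat \<Rightarrow> 'k) \<Rightarrow> 'k"
  have "\<exists>M. P M \<in> gen P M"
  proof (rule ccontr)
    assume neg: "\<nexists>M. P M \<in> gen P M"
    have gen_sub: "gen F M \<subseteq> gen P M'" if "\<And>i. i < M \<Longrightarrow> F i \<in> gen P M'" for F M M'
    proof
      fix p assume "p \<in> gen F M"
      then obtain Q where Q: "\<And>i. Q i \<in> poly_funs (Suc n)" "\<And>x. p x = (\<Sum>i<M. Q i x * F i x)"
        unfolding gen_def by blast
      from that have "\<forall>i. \<exists>S. i < M \<longrightarrow> (\<forall>j. S j \<in> poly_funs (Suc n)) \<and> (\<forall>x. F i x = (\<Sum>j<M'. S j x * P j x))"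
        unfolding gen_def by blast
      then obtain S where S: "\<And>i j. i < M \<Longrightarrow> S i j \<in> poly_funs (Suc n)"
        "\<And>i x. i < M \<Longrightarrow> F i x = (\<Sum>j<M'. S i j x * P j x)" by metis
      have "p x = (\<Sum>j<M'. (\<Sum>i<M. Q i x * S i j x) * P j x)" for x
      proof -
        have "p x = (\<Sum>i<M. \<Sum>j<M'. Q i x * S i j x * P j x)"
          unfolding Q by (rule sum.cong) (simp_all add: S sum_distrib_left mult.assoc)
        also have "\<dots> = (\<Sum>j<M'. \<Sum>i<M. Q i x * S i j x * P j x)" by (rule sum.swap)
        finally show ?thesis by (simp add: sum_distrib_right)
      qed
      moreover have "(\<lambda>x. \<Sum>i<M. Q i x * S i j x) \<in> poly_funs (Suc n)" for j
        using Q S by (auto intro!: poly_funs_intros)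
      ultimately show "p \<in> gen P M'" unfolding gen_def
        by (intro CollectI exI[of _ "\<lambda>j x. \<Sum>i<M. Q i x * S i j x"]) auto
    qed
    have gen_mono: "gen P M \<subseteq> gen P M'" if "M \<le> M'" for M M'
    proof (rule gen_sub)
      fix i assume "i < M"
      then have *: "P i x = (\<Sum>j<M'. of_bool (j = i) * P j x)" for x using that by simp
      show "P i \<in> gen P M'" unfolding gen_def
        by (intro CollectI exI[of _ "\<lambda>j _. of_bool (j = i)"] conjI allI poly_funs.const *)
    qed
    have I_gen: "\<exists>M. p \<in> gen P M" if "p \<in> I" for p
      using that unfolding I_def gen_def by blast
    \<comment> \<open>Finitely many elements of \<open>I\<close> involve only finitely many of the
      \<open>P i\<close>, so they lie in one \<open>gen P N\<close>, which misses
      \<open>P N\<close>. The sum of the individual bounds serves as \<open>N\<close>.\<close>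
    have nonfg: "\<exists>p\<in>I. p \<notin> gen F M" if F: "\<And>i. i < M \<Longrightarrow> F i \<in> I" for F M
    proof -
      have "\<forall>i. \<exists>N. i < M \<longrightarrow> F i \<in> gen P N" using F I_gen by blast
      then obtain N where N: "\<And>i. i < M \<Longrightarrow> F i \<in> gen P (N i)" by metis
      have "F i \<in> gen P (\<Sum>i<M. N i)" if "i < M" for i
        using N[OF that] gen_mono[of "N i" "\<Sum>i<M. N i"] that
        by (meson finite_lessThan lessThan_iff member_le_sum subsetD zero_le)
      then have "gen F M \<subseteq> gen P (\<Sum>i<M. N i)" by (rule gen_sub)
      then show ?thesis using neg I_P by blast
    qed
    define good where "good F M fdc \<longleftrightarrow> (case fdc of (f, d, c) \<Rightarrow> f \<in> I \<and> f \<notin> gen F M \<and> rep f d c \<and>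
       (\<forall>f' d' c'. f' \<in> I \<and> f' \<notin> gen F M \<and> rep f' d' c' \<longrightarrow> d \<le> d'))" for F M fdc
    have ex_good: "\<exists>fdc. good F M fdc" if FI: "\<And>i. i < M \<Longrightarrow> F i \<in> I" for F M
    proof -
      obtain f0 where f0: "f0 \<in> I" "f0 \<notin> gen F M" using nonfg[of M F, OF FI] by blast
      obtain d0 c0 where "\<And>i. c0 i \<in> poly_funs n" "\<And>x. f0 x = (\<Sum>i\<le>d0. c0 i x * x n ^ i)"
        by (rule poly_funs_SucE[OF subsetD[OF I_sub f0(1)]]) (rule that)
      then have "rep f0 d0 c0" unfolding rep_def by blast
      with f0 have ex: "\<exists>d f c. f \<in> I \<and> f \<notin> gen F M \<and> rep f d c" by blast
      define d where "d = (LEAST d. \<exists>f c. f \<in> I \<and> f \<notin> gen F M \<and> rep f d c)"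
      obtain f c where "f \<in> I" "f \<notin> gen F M" "rep f d c"
        using LeastI_ex[OF ex] unfolding d_def by blast
      moreover have "d \<le> d'" if "f' \<in> I" "f' \<notin> gen F M" "rep f' d' c'" for f' d' c'
        unfolding d_def by (rule Least_le) (use that in blast)
      ultimately have "good F M (f, d, c)" unfolding good_def by auto
      then show ?thesis ..
    qed
    \<comment> \<open>Each choice depends on all earlier ones, hence the well-founded recursion;
      \<open>good F M\<close> looks at \<open>F\<close> only below \<open>M\<close>, so the cut in
      \<open>wfrec\<close> is harmless.\<close>
    obtain G where G: "\<And>M. good (\<lambda>i. fst (G i)) M (G M)"
    proof -
      have cong: "good F M = good F' M" if "\<And>i. i < M \<Longrightarrow> F i = F' i" for F F' M
        using that unfolding good_def gen_def by (intro ext) simp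
      define G where "G = wfrec less_than (\<lambda>h M. SOME fdc. good (\<lambda>i. fst (h i)) M fdc)"
      have G: "G M = (SOME fdc. good (\<lambda>i. fst (G i)) M fdc)" for M
      proof -
        have "G M = (SOME fdc. good (\<lambda>i. fst (cut G less_than M i)) M fdc)"
          unfolding G_def by (subst wfrec) auto
        also have "good (\<lambda>i. fst (cut G less_than M i)) M = good (\<lambda>i. fst (G i)) M"
          by (rule cong) (simp add: cut_apply)
        finally show ?thesis .
      qed
      have "good (\<lambda>i. fst (G i)) M (G M)" for M
      proof (induction M rule: less_induct)
        case (less M)
        have "fst (G i) \<in> I" if "i < M" for i
          using less[OF that] unfolding good_def by (auto split: prod.splits)
        from someI_ex[OF ex_good, OF this] show ?case by (simp add: G[of M])
      qed
      then show ?thesis using that by blast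
    qed
    define F where "F i = fst (G i)" for i
    define d where "d i = fst (snd (G i))" for i
    define c where "c i = snd (snd (G i))" for i
    have good: "good F M (F M, d M, c M)" for M
      using G[of M] unfolding F_def[abs_def] d_def c_def by simp
    have FI: "F M \<in> I" and Fgen: "F M \<notin> gen F M" and rep: "rep (F M) (d M) (c M)"
      and least: "\<And>f' d' c'. f' \<in> I \<Longrightarrow> f' \<notin> gen F M \<Longrightarrow> rep f' d' c' \<Longrightarrow> d M \<le> d'" for M
      using good[of M] unfolding good_def by auto
    have gen_F_mono: "gen F M \<subseteq> gen F M'" if "M \<le> M'" for M M'
    proof
      fix p assume "p \<in> gen F M"
      then obtain Q where Q: "\<And>i. Q i \<in> poly_funs (Suc n)" "\<And>x. p x = (\<Sum>i<M. Q i x * F i x)"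
        unfolding gen_def by blast
      have "p x = (\<Sum>i<M'. (if i < M then Q i x else 0) * F i x)" for x
        unfolding Q by (rule sum.mono_neutral_cong_left) (use that in auto)
      moreover have "(\<lambda>x. if i < M then Q i x else 0) \<in> poly_funs (Suc n)" for i
        using Q(1)[of i] by (cases "i < M") (auto intro: poly_funs.const)
      ultimately show "p \<in> gen F M'" unfolding gen_def
        by (intro CollectI exI[of _ "\<lambda>i x. if i < M then Q i x else 0"]) auto
    qed
    have d_mono: "d i \<le> d j" if "i \<le> j" for i j
      using least[OF FI _ rep, of j i] Fgen[of j] gen_F_mono[OF that] by blast
    have cP: "c i j \<in> poly_funs n" for i j using rep unfolding rep_def by blast
    have Fx: "F i x = (\<Sum>j\<le>d i. c i j x * x n ^ j)" for i x using rep unfolding rep_def by blast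
    obtain M Q where Q: "\<And>i. Q i \<in> poly_funs n"
      and QM: "\<And>x. c M (d M) x = (\<Sum>i<M. Q i x * c i (d i) x)"
      using Suc.IH[of "\<lambda>i. c i (d i)"] cP by blast
    \<comment> \<open>The relation between leading coefficients cancels the leading term of
      \<open>F M\<close>; the shifts \<open>d M - d i\<close> are true differences by
      \<open>d_mono\<close>.\<close>
    define f where "f x = F M x - (\<Sum>i<M. (Q i x * x n ^ (d M - d i)) * F i x)" for x
    have Q': "(\<lambda>x. Q i x * x n ^ (d M - d i)) \<in> poly_funs (Suc n)" for i
      by (auto intro!: poly_funs_intros poly_funs_mono[OF Q])
    have fI: "f \<in> I"
      unfolding f_def using FI Q' by (intro pf_ideal_diff[OF I] pf_ideal_sum[OF I] pf_idealD(4)[OF I])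
    have fgen: "f \<notin> gen F M"
    proof
      assume "f \<in> gen F M"
      then obtain S where S: "\<And>i. S i \<in> poly_funs (Suc n)" "\<And>x. f x = (\<Sum>i<M. S i x * F i x)"
        unfolding gen_def by blast
      have "F M x = (\<Sum>i<M. (S i x + Q i x * x n ^ (d M - d i)) * F i x)" for x
        using S(2)[of x] by (simp add: f_def distrib_right sum.distrib algebra_simps)
      moreover have "(\<lambda>x. S i x + Q i x * x n ^ (d M - d i)) \<in> poly_funs (Suc n)" for i
        using S(1) Q' by (rule poly_funs.add)
      ultimately have "F M \<in> gen F M"
        unfolding gen_def by (intro CollectI exI[of _ "\<lambda>i x. S i x + Q i x * x n ^ (d M - d i)"]) auto
      then show False using Fgen by blast
    qed
    have shift: "x n ^ (d M - d i) * F i x = (\<Sum>j\<le>d M. (if d M - d i \<le> j then c i (j - (d M - d i)) x else 0) * x n ^ j)"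
      if "i \<le> M" for i x
    proof -
      have "x n ^ (d M - d i) * F i x = (\<Sum>j\<le>d i. c i j x * x n ^ (j + (d M - d i)))"
        by (simp add: Fx sum_distrib_left power_add ac_simps)
      also have "\<dots> = (\<Sum>j\<in>{d M - d i..d M}. c i (j - (d M - d i)) x * x n ^ j)"
        by (rule sum.reindex_bij_witness[of _ "\<lambda>j. j - (d M - d i)" "\<lambda>j. j + (d M - d i)"])
          (use d_mono[OF that] in auto)
      also have "\<dots> = (\<Sum>j\<le>d M. (if d M - d i \<le> j then c i (j - (d M - d i)) x else 0) * x n ^ j)"
        by (rule sum.mono_neutral_cong_left) auto
      finally show ?thesis .
    qed
    define e where "e j x = c M j x - (\<Sum>i<M. Q i x * (if d M - d i \<le> j then c i (j - (d M - d i)) x else 0))" for j x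
    have fe: "f x = (\<Sum>j\<le>d M. e j x * x n ^ j)" for x
    proof -
      have "f x = (\<Sum>j\<le>d M. c M j x * x n ^ j) -
        (\<Sum>i<M. \<Sum>j\<le>d M. Q i x * (if d M - d i \<le> j then c i (j - (d M - d i)) x else 0) * x n ^ j)"
        unfolding f_def Fx[of M]
        by (intro arg_cong2[where f="(-)"] sum.cong refl) (simp add: mult.assoc shift sum_distrib_left)
      also have "\<dots> = (\<Sum>j\<le>d M. e j x * x n ^ j)"
        by (subst sum.swap) (simp add: e_def sum_subtractf left_diff_distrib sum_distrib_right)
      finally show ?thesis .
    qed
    have eP: "e j \<in> poly_funs n" for j
      unfolding e_def by (intro poly_funs_intros poly_funs_if cP Q)
    have top: "e (d M) x = 0" for x
      unfolding e_def by (simp add: QM d_mono)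
    \<comment> \<open>\<open>f\<close> lies outside \<open>gen F M\<close> and has an expansion of
      degree below \<open>d M\<close>, against minimality; in degree 0 it is zero and lies in every
      \<open>gen F M\<close>.\<close>
    show False
    proof (cases "d M")
      case 0
      then have "f x = 0" for x using fe top by simp
      then have "f \<in> gen F M" unfolding gen_def
        by (intro CollectI exI[of _ "\<lambda>_ _. 0"]) (auto intro: poly_funs.const)
      then show False using fgen by blast
    next
      case (Suc m)
      then have "rep f m e" unfolding rep_def using eP fe top by simp
      from least[OF fI fgen this] Suc show False by simp
    qed
  qed
  then show ?case unfolding gen_def by blast
qed

section \<open>The weak Nullstellensatz\<close>

lemma sum_powers_eq_0D:
  fixes c :: "nat \<Rightarrow> 'k::field_char_0"
  assumes "\<And>t. (\<Sum>j\<le>e. c j * t ^ j) = 0" "j \<le> e"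
  shows "c j = 0"
proof -
  define p where "p = (\<Sum>j\<le>e. monom (c j) j)"
  have "poly p t = 0" for t by (simp add: p_def poly_sum poly_monom assms(1))
  then have "p = 0" using poly_all_0_iff_0 by blast
  moreover have "coeff p j = c j" using assms(2) by (simp add: p_def coeff_sum)
  ultimately show ?thesis by simp
qed

section \<open>Homogeneous forms and restriction to lines\<close>

lemma poly_funs_line:
  fixes p :: "(nat \<Rightarrow> 'k::field) \<Rightarrow> 'k"
  assumes "p \<in> poly_funs n"
  shows "\<exists>q. \<forall>t. p (\<lambda>i. w i + t * v i) = poly q t"
  using assms
proof (induction rule: poly_funs.induct)
  case (const c)
  show ?case by (rule exI[of _ "[:c:]"]) simp
next
  case (coord i)
  show ?case by (rule exI[of _ "[:w i, v i:]"]) simp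
next
  case (add p q)
  then show ?case by (metis poly_add)
next
  case (mult p q)
  then show ?case by (metis poly_mult)
qed

text \<open>Homogeneous polynomial functions of degree \<open>d\<close>; zero is allowed in every
  degree so that sums of forms can be padded.\<close>

inductive form :: "nat \<Rightarrow> nat \<Rightarrow> ((nat \<Rightarrow> 'k::field) \<Rightarrow> 'k) \<Rightarrow> bool" for n where
  zero: "form n d (\<lambda>x. 0)"
| const: "form n 0 (\<lambda>x. c)"
| coord: "i < n \<Longrightarrow> form n 1 (\<lambda>x. x i)"
| add: "form n d p \<Longrightarrow> form n d q \<Longrightarrow> form n d (\<lambda>x. p x + q x)"
| mult: "form n d p \<Longrightarrow> form n e q \<Longrightarrow> form n (d + e) (\<lambda>x. p x * q x)"

lemma form_sum: "(\<And>i. i \<in> I \<Longrightarrow> form n d (p i)) \<Longrightarrow> form n d (\<lambda>x. \<Sum>i\<in>I. p i x)"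
  by (induction I rule: infinite_finite_induct) (auto intro: form.intros)

lemma poly_funs_forms:
  fixes p :: "(nat \<Rightarrow> 'k::field) \<Rightarrow> 'k"
  assumes "p \<in> poly_funs n"
  shows "\<exists>d F. (\<forall>i. form n i (F i)) \<and> (\<forall>x. p x = (\<Sum>i\<le>d. F i x))"
  using assms
proof (induction rule: poly_funs.induct)
  case (const a)
  show ?case
    by (rule exI[of _ 0], rule exI[of _ "\<lambda>i. if i = 0 then (\<lambda>x. a) else (\<lambda>x. 0)"]) (auto intro: form.intros)
next
  case (coord i)
  define F where "F j = (if j = 1 then (\<lambda>x. x i) else (\<lambda>x. 0 :: 'k))" for j :: nat
  have "form n j (F j)" for j
    using form.coord[OF coord] form.zero by (cases "j = 1") (auto simp: F_def)
  moreover have "x i = (\<Sum>j\<le>1. F j x)" for x by (simp add: F_def)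
  ultimately show ?case by blast
next
  case (add p q)
  from add.IH(1) obtain d c where c: "\<And>i. form n i (c i)" "\<And>x. p x = (\<Sum>i\<le>d. c i x)"
    by (elim exE conjE) blast
  from add.IH(2) obtain d' c' where c': "\<And>i. form n i (c' i)" "\<And>x. q x = (\<Sum>i\<le>d'. c' i x)"
    by (elim exE conjE) blast
  define e where "e i x = (if i \<le> d then c i x else 0) + (if i \<le> d' then c' i x else 0)" for i x
  have "p x + q x = (\<Sum>i\<le>max d d'. e i x)" for x
  proof -
    have "p x = (\<Sum>i\<le>max d d'. (if i \<le> d then c i x else 0))"
      unfolding c by (rule sum.mono_neutral_cong_left) auto
    moreover have "q x = (\<Sum>i\<le>max d d'. (if i \<le> d' then c' i x else 0))"
      unfolding c' by (rule sum.mono_neutral_cong_left) auto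
    ultimately show ?thesis by (simp add: e_def sum.distrib)
  qed
  moreover have "form n i (e i)" for i
    unfolding e_def[abs_def] using c(1)[of i] c'(1)[of i]
    by (cases "i \<le> d"; cases "i \<le> d'") (simp_all add: form.zero form.add)
  ultimately show ?case by blast
next
  case (mult p q)
  from mult.IH(1) obtain d c where c: "\<And>i. form n i (c i)" "\<And>x. p x = (\<Sum>i\<le>d. c i x)"
    by (elim exE conjE) blast
  from mult.IH(2) obtain d' c' where c': "\<And>i. form n i (c' i)" "\<And>x. q x = (\<Sum>i\<le>d'. c' i x)"
    by (elim exE conjE) blast
  define e where "e l x = (\<Sum>i\<in>{i. i \<le> d \<and> i \<le> l \<and> l - i \<le> d'}. c i x * c' (l - i) x)" for l x
  have "p x * q x = (\<Sum>l\<le>d + d'. e l x)" for x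
    using sum_mult_sum_powers[of "\<lambda>i. c i x" 1 d "\<lambda>i. c' i x" d'] by (simp add: c(2) c'(2) e_def)
  moreover have "form n l (e l)" for l
    unfolding e_def[abs_def]
  proof (rule form_sum)
    fix i assume "i \<in> {i. i \<le> d \<and> i \<le> l \<and> l - i \<le> d'}"
    then have "i + (l - i) = l" by simp
    then show "form n l (\<lambda>x. c i x * c' (l - i) x)"
      using form.mult[OF c(1)[of i] c'(1)[of "l - i"]] by simp
  qed
  ultimately show ?case by blast
qed

text \<open>Only the direction contributes to the coefficient of \<open>t ^ d\<close>: it is
  \<open>F v\<close> for every base point. A direction in which the top form does not vanish
  therefore makes a polynomial monic up to a constant.\<close>

lemma form_line:
  fixes F :: "(nat \<Rightarrow> 'k::field) \<Rightarrow> 'k"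
  assumes "form n d F"
  shows "\<exists>c. (\<forall>j. c j \<in> poly_funs n) \<and> (\<forall>w t. F (\<lambda>i. w i + t * v i) = (\<Sum>j\<le>d. c j w * t ^ j)) \<and>
    (\<forall>w. c d w = F v)"
  using assms
proof (induction rule: form.induct)
  case (zero d)
  show ?case by (rule exI[of _ "\<lambda>_ _. 0"]) (auto intro: poly_funs.const)
next
  case (const a)
  show ?case by (rule exI[of _ "\<lambda>_ _. a"]) (auto intro: poly_funs.const)
next
  case (coord i)
  have "(if j = 0 then (\<lambda>w. w i) else (\<lambda>w. v i)) \<in> poly_funs n" for j :: nat
    using coord by (auto intro: poly_funs.intros)
  then show ?case
    by (intro exI[of _ "\<lambda>j. if j = 0 then (\<lambda>w. w i) else (\<lambda>w. v i)"]) (auto simp: mult.commute)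
next
  case (add d p q)
  from add.IH(1) obtain c where c: "\<And>j. c j \<in> poly_funs n"
    "\<And>w t. p (\<lambda>i. w i + t * v i) = (\<Sum>j\<le>d. c j w * t ^ j)" "\<And>w. c d w = p v"
    by (elim exE conjE) blast
  from add.IH(2) obtain c' where c': "\<And>j. c' j \<in> poly_funs n"
    "\<And>w t. q (\<lambda>i. w i + t * v i) = (\<Sum>j\<le>d. c' j w * t ^ j)" "\<And>w. c' d w = q v"
    by (elim exE conjE) blast
  show ?case
    by (rule exI[of _ "\<lambda>j w. c j w + c' j w"])
      (auto intro: poly_funs.intros simp: c c' distrib_right sum.distrib)
next
  case (mult d p e q)
  from mult.IH(1) obtain c where c: "\<And>j. c j \<in> poly_funs n"
    "\<And>w t. p (\<lambda>i. w i + t * v i) = (\<Sum>j\<le>d. c j w * t ^ j)" "\<And>w. c d w = p v"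
    by (elim exE conjE) blast
  from mult.IH(2) obtain c' where c': "\<And>j. c' j \<in> poly_funs n"
    "\<And>w t. q (\<lambda>i. w i + t * v i) = (\<Sum>j\<le>e. c' j w * t ^ j)" "\<And>w. c' e w = q v"
    by (elim exE conjE) blast
  define b where "b l x = (\<Sum>i\<in>{i. i \<le> d \<and> i \<le> l \<and> l - i \<le> e}. c i x * c' (l - i) x)" for l x
  have 1: "b l \<in> poly_funs n" for l
    unfolding b_def[abs_def] by (intro poly_funs_intros c c')
  have 2: "p (\<lambda>i. w i + t * v i) * q (\<lambda>i. w i + t * v i) = (\<Sum>j\<le>d+e. b j w * t ^ j)" for w t
    unfolding c(2) c'(2) sum_mult_sum_powers b_def ..
  have "{i. i \<le> d \<and> i \<le> d + e \<and> d + e - i \<le> e} = {d}" by auto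
  then have 3: "b (d + e) w = p v * q v" for w
    by (simp add: b_def c(3) c'(3))
  show ?case using 1 2 3 by blast
qed

text \<open>The direction \<open>v\<close> has to avoid the zeros of the top form and also the
  hyperplane \<open>v n = 0\<close>, because it is to replace the last coordinate axis.\<close>

lemma poly_funs_monic_line:
  fixes f :: "(nat \<Rightarrow> 'k::field_char_0) \<Rightarrow> 'k"
  assumes f: "f \<in> poly_funs (Suc n)" "f x0 \<noteq> 0"
  obtains v d c a where "v n \<noteq> 0" "a \<noteq> 0" "\<And>j. c j \<in> poly_funs (Suc n)"
    "\<And>w t. f (\<lambda>i. w i + t * v i) = a * t ^ d + (\<Sum>j<d. c j w * t ^ j)"
proof -
  define P where "P d \<longleftrightarrow> (\<exists>F. (\<forall>i. form (Suc n) i (F i)) \<and> (\<forall>x. f x = (\<Sum>i\<le>d. F i x)))" for d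
  have "\<exists>d. P d" using poly_funs_forms[OF f(1)] unfolding P_def .
  \<comment> \<open>Minimality of \<open>d\<close> makes the top form nonzero somewhere, since
    otherwise it could be dropped.\<close>
  define d where "d = (LEAST d. P d)"
  have "P d" unfolding d_def using \<open>\<exists>d. P d\<close> by (rule LeastI_ex)
  then obtain F where F: "\<And>i. form (Suc n) i (F i)" "\<And>x. f x = (\<Sum>i\<le>d. F i x)"
    unfolding P_def by blast
  have "\<exists>u. F d u \<noteq> 0"
  proof (rule ccontr)
    assume "\<nexists>u. F d u \<noteq> 0"
    then have z: "F d u = 0" for u by simp
    show False
    proof (cases d)
      case 0
      then show False using f(2) F(2)[of x0] z by simp
    next
      case (Suc m)
      then have "P m" unfolding P_def using F z by auto
      then show False using Least_le[of P m] Suc d_def by simp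
    qed
  qed
  then obtain u where u: "F d u \<noteq> 0" by blast
  obtain c0 where c0: "\<And>j. c0 j \<in> poly_funs (Suc n)"
    "\<And>w t. F d (\<lambda>i. w i + t * (\<lambda>i. of_bool (i = n)) i) = (\<Sum>j\<le>d. c0 j w * t ^ j)"
    using form_line[OF F(1)[of d], of "\<lambda>i. of_bool (i = n)"] by (elim exE conjE) blast
  define q where "q = (\<Sum>j\<le>d. monom (c0 j u) j)"
  have q: "poly q s = F d (\<lambda>i. u i + s * of_bool (i = n))" for s
    using c0(2)[of u s] by (simp add: q_def poly_sum poly_monom)
  have "q \<noteq> 0" using q[of 0] u by auto
  \<comment> \<open>Moving \<open>u\<close> along the last axis keeps the top form nonzero for all
    but finitely many \<open>s\<close>; the value \<open>- u n\<close> is excluded to keep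
    \<open>v n\<close> nonzero.\<close>
  then have "finite ({s. poly q s = 0} \<union> {- u n})" using poly_roots_finite by auto
  then obtain s where s: "s \<notin> {s. poly q s = 0} \<union> {- u n}"
    using infinite_UNIV_char_0 by (metis ex_new_if_finite)
  define v where "v i = u i + s * of_bool (i = n)" for i
  have v: "F d v \<noteq> 0" "v n \<noteq> 0"
    using s q[of s] unfolding v_def[abs_def] by (auto simp: eq_neg_iff_add_eq_0 add.commute)
  have "\<forall>i. \<exists>c. (\<forall>j. c j \<in> poly_funs (Suc n)) \<and>
      (\<forall>w t. F i (\<lambda>k. w k + t * v k) = (\<Sum>j\<le>i. c j w * t ^ j)) \<and> (\<forall>w. c i w = F i v)"
    using form_line[OF F(1), of _ v] by blast
  from choice[OF this] obtain c where c: "\<And>i j. c i j \<in> poly_funs (Suc n)"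
    "\<And>i w t. F i (\<lambda>k. w k + t * v k) = (\<Sum>j\<le>i. c i j w * t ^ j)" "\<And>i w. c i i w = F i v"
    by blast
  define e where "e j w = (\<Sum>i\<in>{j..d}. c i j w)" for j w
  have "f (\<lambda>k. w k + t * v k) = F d v * t ^ d + (\<Sum>j<d. e j w * t ^ j)" for w t
  proof -
    have "f (\<lambda>k. w k + t * v k) = (\<Sum>i\<le>d. \<Sum>j\<le>i. c i j w * t ^ j)"
      unfolding F(2) c(2) ..
    also have "\<dots> = (\<Sum>j\<le>d. \<Sum>i\<in>{j..d}. c i j w * t ^ j)"
      by (subst (1 2) sum.Sigma)
        (auto intro!: sum.reindex_bij_witness[of _ "\<lambda>(i,j). (j,i)" "\<lambda>(i,j). (j,i)"])
    also have "\<dots> = (\<Sum>j\<le>d. e j w * t ^ j)"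
      by (simp add: e_def sum_distrib_right)
    also have "\<dots> = e d w * t ^ d + (\<Sum>j<d. e j w * t ^ j)"
      by (simp add: lessThan_Suc_atMost[symmetric])
    also have "e d w = F d v" by (simp add: e_def c(3))
    finally show ?thesis .
  qed
  moreover have "e j \<in> poly_funs (Suc n)" for j
    unfolding e_def[abs_def] by (intro poly_funs_intros c)
  ultimately show thesis using that v by blast
qed

text \<open>Modulo \<open>N\<close> the matrix \<open>s - e\<close> annihilates the vector
  \<open>b\<close>, and it is invertible at \<open>a\<close> because \<open>e\<close> vanishes
  there. Elimination takes the place of the determinant: each step removes the last unknown with the
  pivot \<open>s - e d d\<close>.\<close>

lemma nakayama_elimination:
  fixes b :: "nat \<Rightarrow> (nat \<Rightarrow> 'k::field) \<Rightarrow> 'k"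
  assumes N: "\<And>p q. p \<in> N \<Longrightarrow> q \<in> N \<Longrightarrow> (\<lambda>x. p x + q x) \<in> N"
      "\<And>p q. p \<in> poly_funs n \<Longrightarrow> q \<in> N \<Longrightarrow> (\<lambda>x. p x * q x) \<in> N"
    and s: "s \<in> poly_funs n" "s a \<noteq> 0"
    and e: "\<And>i j. i < d \<Longrightarrow> j < d \<Longrightarrow> e i j \<in> poly_funs n" "\<And>i j. i < d \<Longrightarrow> j < d \<Longrightarrow> e i j a = 0"
    and b: "\<And>i. i < d \<Longrightarrow> (\<lambda>x. s x * b i x - (\<Sum>j<d. e i j x * b j x)) \<in> N"
  shows "\<exists>s'\<in>poly_funs n. s' a \<noteq> 0 \<and> (\<forall>i<d. (\<lambda>x. s' x * b i x) \<in> N)"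
  using s e b
proof (induction d arbitrary: s e)
  case 0
  then show ?case by auto
next
  case (Suc d)
  define s2 where "s2 x = s x - e d d x" for x
  have s2: "s2 \<in> poly_funs n" "s2 a \<noteq> 0"
    using Suc.prems(1-4) by (auto simp: s2_def[abs_def] intro: poly_funs_intros)
  have "(\<lambda>x. (s2 x * s x) * b i x - (\<Sum>j<d. (s2 x * e i j x + e i d x * e d j x) * b j x)) \<in> N" if "i < d" for i
  proof -
    \<comment> \<open>Row \<open>i\<close> times the pivot \<open>s2\<close> plus row
      \<open>d\<close> times \<open>e i d\<close>: the coefficient of \<open>b d\<close> becomes
      \<open>- s2 * e i d + e i d * s2\<close>.\<close>
    have "(\<lambda>x. s2 x * (s x * b i x - (\<Sum>j<Suc d. e i j x * b j x)) +
       e i d x * (s x * b d x - (\<Sum>j<Suc d. e d j x * b j x))) \<in> N"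
      using that s2(1) Suc.prems(3,5) by (intro N) auto
    also have "(\<lambda>x. s2 x * (s x * b i x - (\<Sum>j<Suc d. e i j x * b j x)) +
       e i d x * (s x * b d x - (\<Sum>j<Suc d. e d j x * b j x))) =
       (\<lambda>x. (s2 x * s x) * b i x - (\<Sum>j<d. (s2 x * e i j x + e i d x * e d j x) * b j x))"
      by (rule ext) (simp add: s2_def algebra_simps sum_distrib_left sum.distrib sum_subtractf)
    finally show ?thesis .
  qed
  moreover have "(\<lambda>x. s2 x * s x) \<in> poly_funs n" using s2 Suc.prems by (auto intro: poly_funs_intros)
  moreover have "(\<lambda>x. s2 x * e i j x + e i d x * e d j x) \<in> poly_funs n" if "i < d" "j < d" for i j
    using that s2 Suc.prems(3) by (intro poly_funs_intros) auto
  ultimately obtain s' where s': "s' \<in> poly_funs n" "s' a \<noteq> 0" "\<And>i. i < d \<Longrightarrow> (\<lambda>x. s' x * b i x) \<in> N"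
    using Suc.IH[of "\<lambda>x. s2 x * s x" "\<lambda>i j x. s2 x * e i j x + e i d x * e d j x"] s2(2) Suc.prems(2,4)
    by auto
  have sumN: "(\<lambda>x. \<Sum>j<k. e d j x * (s' x * b j x)) \<in> N" if "k \<le> d" for k
    using that
  proof (induction k)
    case 0
    have "(\<lambda>x. 0 * (s x * b d x - (\<Sum>j<Suc d. e d j x * b j x))) \<in> N"
      by (rule N(2)[OF poly_funs.const]) (use Suc.prems(5)[of d] in simp)
    then show ?case by simp
  next
    case (Suc k)
    have "(\<lambda>x. e d k x * (s' x * b k x)) \<in> N"
      using Suc.prems \<open>\<And>i j. \<lbrakk>i < Suc d; j < Suc d\<rbrakk> \<Longrightarrow> e i j \<in> poly_funs n\<close> by (intro N s') auto
    with Suc show ?case using N(1) by simp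
  qed
  have "(\<lambda>x. s' x * (s x * b d x - (\<Sum>j<Suc d. e d j x * b j x)) + (\<Sum>j<d. e d j x * (s' x * b j x))) \<in> N"
    using Suc.prems(5)[of d] sumN[of d] by (intro N s') auto
  also have "(\<lambda>x. s' x * (s x * b d x - (\<Sum>j<Suc d. e d j x * b j x)) + (\<Sum>j<d. e d j x * (s' x * b j x)))
     = (\<lambda>x. s2 x * s' x * b d x)"
    by (rule ext) (simp add: s2_def algebra_simps sum_distrib_left)
  finally have d: "(\<lambda>x. s2 x * s' x * b d x) \<in> N" .
  have "(\<lambda>x. s2 x * (s' x * b i x)) \<in> N" if "i < d" for i
    by (rule N(2)[OF s2(1) s'(3)[OF that]])
  with d have "\<forall>i<Suc d. (\<lambda>x. (s2 x * s' x) * b i x) \<in> N"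
    by (auto simp: less_Suc_eq mult.assoc)
  then show ?case
    using s2 s' by (intro bexI[of _ "\<lambda>x. s2 x * s' x"]) (auto intro: poly_funs_intros)
qed

text \<open>Induction on \<open>n\<close>: after a linear change of coordinates \<open>I\<close> contains an element that is monic
  in the last variable, and then Nakayama's lemma lifts a zero of \<open>I \<inter> k[x\<^sub>0, \<dots>, x\<^bsub>n-1\<^esub>]\<close> to a zero of \<open>I\<close>.\<close>

theorem weak_nullstellensatz:
  fixes I :: "((nat \<Rightarrow> 'k::{alg_closed_field, field_char_0}) \<Rightarrow> 'k) set"
  assumes "pf_ideal n I" "(\<lambda>x. 1) \<notin> I"
  shows "\<exists>x. \<forall>p\<in>I. p x = 0"
  using assms
proof (induction n arbitrary: I)
  case 0
  have "p x = 0" if pI: "p \<in> I" for p x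
  proof (rule ccontr)
    assume px: "p x \<noteq> 0"
    have const: "\<exists>c. p = (\<lambda>_. c)" if "p \<in> poly_funs 0" for p :: "(nat \<Rightarrow> 'k) \<Rightarrow> 'k"
      using that by (induction rule: poly_funs.induct) auto
    obtain c where c: "p = (\<lambda>_. c)" using const pf_idealD(1)[OF 0(1) pI] by blast
    have "(\<lambda>x. inverse c * p x) \<in> I" by (rule pf_idealD(4)[OF 0(1) poly_funs.const pI])
    then show False using 0(2) c px by simp
  qed
  then show ?case by blast
next
  case (Suc n I\<^sub>0)
  show ?case
  proof (cases "\<exists>f\<in>I\<^sub>0. \<exists>x. f x \<noteq> 0")
    case False
    then show ?thesis by blast
  next
    case True
    then obtain f x0 where f: "f \<in> I\<^sub>0" "f x0 \<noteq> 0" by blast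
    obtain v d c a where v: "v n \<noteq> 0" "a \<noteq> 0" "\<And>j. c j \<in> poly_funs (Suc n)"
      "\<And>w t. f (\<lambda>i. w i + t * v i) = a * t ^ d + (\<Sum>j<d. c j w * t ^ j)"
      by (rule poly_funs_monic_line[OF pf_idealD(1)[OF Suc.prems(1) f(1)] f(2)]) (rule that)
    \<comment> \<open>\<open>\<sigma>\<close> makes \<open>v\<close> the last axis; in the new
      coordinates \<open>f\<close> is \<open>a\<close> times a monic polynomial in the last
      variable.\<close>
    define \<sigma> where "\<sigma> x = (\<lambda>i. (if i = n then 0 else x i) + x n * v i)" for x :: "nat \<Rightarrow> 'k"
    define \<tau> where "\<tau> y = (\<lambda>i. if i = n then y n / v n else y i - y n / v n * v i)" for y :: "nat \<Rightarrow> 'k"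
    have \<sigma>\<tau>: "\<sigma> (\<tau> y) = y" for y unfolding \<sigma>_def \<tau>_def using v(1) by auto
    have \<tau>\<sigma>: "\<tau> (\<sigma> y) = y" for y unfolding \<sigma>_def \<tau>_def using v(1) by auto
    have \<sigma>P: "(\<lambda>x. p (\<sigma> x)) \<in> poly_funs (Suc n)" if "p \<in> poly_funs (Suc n)" for p
    proof (rule poly_funs_subst[OF that])
      fix i assume "i < Suc n"
      then show "(\<lambda>x. \<sigma> x i) \<in> poly_funs (Suc n)"
        unfolding \<sigma>_def by (cases "i = n") (auto intro!: poly_funs.add poly_funs.mult intro: poly_funs.coord poly_funs.const)
    qed
    have \<tau>_coord: "(\<lambda>x. \<tau> x i) \<in> poly_funs (Suc n)" if "i < Suc n" for i
    proof -
      have "(\<lambda>x. (if i = n then inverse (v n) * x n else x i - inverse (v n) * x n * v i)) \<in> poly_funs (Suc n)"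
        using that by (intro poly_funs_if poly_funs_intros) auto
      also have "(\<lambda>x. (if i = n then inverse (v n) * x n else x i - inverse (v n) * x n * v i)) = (\<lambda>x. \<tau> x i)"
        by (auto simp: \<tau>_def field_simps)
      finally show ?thesis .
    qed
    have \<tau>P: "(\<lambda>x. p (\<tau> x)) \<in> poly_funs (Suc n)" if "p \<in> poly_funs (Suc n)" for p
      by (rule poly_funs_subst[OF that \<tau>_coord])
    define I where "I = {p \<in> poly_funs (Suc n). (\<lambda>x. p (\<tau> x)) \<in> I\<^sub>0}"
    have I: "pf_ideal (Suc n) I"
      unfolding pf_ideal_def I_def using pf_idealD[OF Suc.prems(1)] \<tau>P by (auto intro: poly_funs_intros)
    have I1: "(\<lambda>x. 1) \<notin> I" unfolding I_def using Suc.prems(2) by simp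
    define c' where "c' j x = c j (\<lambda>i. if i = n then 0 else x i)" for j x
    have c': "c' j \<in> poly_funs n" for j
      unfolding c'_def[abs_def]
    proof (rule poly_funs_subst[OF v(3)])
      fix i assume "i < Suc n"
      then show "(\<lambda>x. if i = n then 0 else x i) \<in> poly_funs n"
        by (cases "i = n") (auto intro: poly_funs.intros)
    qed
    define g where "g x = a * x n ^ d + (\<Sum>j<d. c' j x * x n ^ j)" for x
    have g: "g \<in> I"
    proof -
      have "g = (\<lambda>x. f (\<sigma> x))" unfolding \<sigma>_def v(4) g_def c'_def by auto
      moreover have "(\<lambda>x. f (\<sigma> x)) \<in> I"
        unfolding I_def using \<sigma>P pf_idealD(1)[OF Suc.prems(1) f(1)] f(1) by (simp add: \<sigma>\<tau>)
      ultimately show ?thesis by simp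
    qed
    have "\<exists>x. \<forall>p\<in>I. p x = 0"
    proof -
      have "pf_ideal n (I \<inter> poly_funs n)"
        unfolding pf_ideal_def
        by (intro conjI ballI IntI)
          (auto intro!: pf_idealD(2,3)[OF I] pf_idealD(4)[OF I poly_funs_mono[of _ n "Suc n"]] intro: poly_funs_intros)
      from Suc.IH[OF this] I1 obtain \<alpha> where \<alpha>: "\<And>p. p \<in> I \<Longrightarrow> p \<in> poly_funs n \<Longrightarrow> p \<alpha> = 0" by blast
      have upd: "p (\<alpha>(n := t)) = p \<alpha>" if "p \<in> poly_funs n" for p t
        by (rule poly_funs_cong[OF that]) auto
      show ?thesis
      proof (rule ccontr)
        assume neg: "\<not> ?thesis"
        \<comment> \<open>\<open>K\<close> is the restriction of \<open>I\<close> to the line over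
          \<open>\<alpha>\<close>, an ideal of k[t]. A root of its generator gives a zero of
          \<open>I\<close>, so if there is none the generator is a constant.\<close>
        define K where "K = {q. \<exists>h\<in>I. \<forall>t. h (\<alpha>(n := t)) = poly q t}"
        have K_ex: "\<exists>q. q \<in> K \<and> (\<forall>t. h (\<alpha>(n := t)) = poly q t)" if hI: "h \<in> I" for h
        proof -
          obtain q where q: "\<And>t. h (\<lambda>i. (\<alpha>(n := 0)) i + t * of_bool (i = n)) = poly q t"
            using poly_funs_line[OF pf_idealD(1)[OF I hI], where w="\<alpha>(n := 0)" and v="\<lambda>i. of_bool (i = n)"] by blast
          have "(\<lambda>i. (\<alpha>(n := 0)) i + t * of_bool (i = n)) = \<alpha>(n := t)" for t by auto
          with q have "\<forall>t. h (\<alpha>(n := t)) = poly q t" by simp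
          then show ?thesis using hI unfolding K_def by blast
        qed
        have K_add: "p + q \<in> K" if "p \<in> K" "q \<in> K" for p q
        proof -
          obtain h h' where h: "h \<in> I" "\<And>t. h (\<alpha>(n := t)) = poly p t"
            and h': "h' \<in> I" "\<And>t. h' (\<alpha>(n := t)) = poly q t"
            using \<open>p \<in> K\<close> \<open>q \<in> K\<close> unfolding K_def by blast
          show ?thesis unfolding K_def
            using pf_idealD(3)[OF I h(1) h'(1)] h(2) h'(2) by (intro CollectI bexI[of _ "\<lambda>x. h x + h' x"]) auto
        qed
        have K_mult: "r * q \<in> K" if "q \<in> K" for r q
        proof -
          obtain h where h: "h \<in> I" "\<And>t. h (\<alpha>(n := t)) = poly q t" using \<open>q \<in> K\<close> unfolding K_def by blast
          have "(\<lambda>x. (\<Sum>i\<le>degree r. coeff r i * x n ^ i) * h x) \<in> I"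
            by (intro pf_idealD(4)[OF I] h poly_funs_intros) simp
          then show ?thesis unfolding K_def
            by (intro CollectI bexI[of _ "\<lambda>x. (\<Sum>i\<le>degree r. coeff r i * x n ^ i) * h x"])
              (auto simp: h(2) poly_altdef[of r])
        qed
        obtain g' where g': "g' \<in> K" "\<And>t. g (\<alpha>(n := t)) = poly g' t" using K_ex[OF g] by blast
        have "g' \<noteq> 0"
        proof
          assume "g' = 0"
          then have "(\<Sum>j\<le>d. (if j = d then a else c' j \<alpha>) * t ^ j) = 0" for t
            using g'(2)[of t] by (simp add: g_def upd[OF c'] lessThan_Suc_atMost[symmetric] add.commute)
          from sum_powers_eq_0D[where c="\<lambda>j. if j = d then a else c' j \<alpha>" and e=d and j=d, OF this]
          show False using v(2) by simp
        qed
        define m where "m = (LEAST m. \<exists>q\<in>K. q \<noteq> 0 \<and> degree q = m)"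
        have "\<exists>m. \<exists>q\<in>K. q \<noteq> 0 \<and> degree q = m" using g' \<open>g' \<noteq> 0\<close> by blast
        from LeastI_ex[OF this] obtain q where q: "q \<in> K" "q \<noteq> 0" "degree q = m" unfolding m_def by blast
        have q_dvd: "q dvd r" if "r \<in> K" for r
        proof -
          have "r + (- (r div q)) * q \<in> K" using that q(1) by (intro K_add K_mult)
          then have "r mod q \<in> K" by (simp add: minus_div_mult_eq_mod)
          have "r mod q = 0"
          proof (rule ccontr)
            assume nz: "r mod q \<noteq> 0"
            then have "m \<le> degree (r mod q)"
              unfolding m_def using \<open>r mod q \<in> K\<close> by (intro Least_le) blast
            then show False using degree_mod_less[OF q(2), of r] q(3) nz by simp
          qed
          then show ?thesis by (simp add: mod_eq_0_iff_dvd)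
        qed
        have "degree q = 0"
        proof (rule ccontr)
          assume "degree q \<noteq> 0"
          then obtain \<beta> where \<beta>: "poly q \<beta> = 0" using alg_closed_imp_poly_has_root[of q] by blast
          have "h (\<alpha>(n := \<beta>)) = 0" if "h \<in> I" for h
            using K_ex[OF that] q_dvd \<beta> by (metis dvdE mult_zero_left poly_mult)
          then show False using neg by blast
        qed
        then obtain b where b: "q = [:b:]" "b \<noteq> 0" using q(2) by (metis degree_eq_zeroE pCons_0_0)
        have "[:inverse b:] * q \<in> K" by (rule K_mult[OF q(1)])
        then obtain h where h: "h \<in> I" "\<And>t. h (\<alpha>(n := t)) = 1" using b unfolding K_def by auto
        obtain e k where k: "\<And>i. k i \<in> poly_funs n" "\<And>x. h x = (\<Sum>i\<le>e. k i x * x n ^ i)"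
          by (rule poly_funs_SucE[OF pf_idealD(1)[OF I h(1)]]) (rule that)
        \<comment> \<open>\<open>h\<close> restricts to 1 on the line, so the coefficients of
          \<open>1 - h\<close> in the last variable vanish at \<open>\<alpha>\<close>; modulo
          \<open>I\<close> this expansion represents 1.\<close>
        define k' where "k' i x = (if i = 0 then 1 - k i x else - k i x)" for i x
        have k'P: "k' i \<in> poly_funs n" for i
          unfolding k'_def[abs_def] using k(1) by (cases "i = 0") (auto intro: poly_funs_intros)
        have k'_sum: "(\<Sum>i\<le>e. k' i x * x n ^ i) = 1 - h x" for x
        proof -
          have "(\<Sum>i\<le>e. k' i x * x n ^ i) = (\<Sum>i\<le>e. of_bool (i = 0) - k i x * x n ^ i)"
            by (rule sum.cong) (auto simp: k'_def)
          also have "\<dots> = (\<Sum>i\<le>e. of_bool (i = 0)) - h x" by (simp add: k(2) sum_subtractf)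
          also have "(\<Sum>i\<le>e. of_bool (i = 0)) = (1::'k)" by (simp add: of_bool_def)
          finally show ?thesis .
        qed
        have k'0: "k' i \<alpha> = 0" if "i \<le> e" for i
        proof (rule sum_powers_eq_0D[OF _ that])
          show "(\<Sum>j\<le>e. k' j \<alpha> * t ^ j) = 0" for t
            using k'_sum[of "\<alpha>(n := t)"] h(2)[of t] by (simp add: upd[OF k'P])
        qed
        have "d \<noteq> 0"
        proof
          assume "d = 0"
          then have "(\<lambda>x. inverse a * g x) \<in> I" by (intro pf_idealD(4)[OF I] g poly_funs.const)
          then show False using I1 v(2) \<open>d = 0\<close> by (simp add: g_def)
        qed
        \<comment> \<open>Division by the monic \<open>g\<close>: modulo \<open>I\<close> every
          power of the last variable reduces to powers below \<open>d\<close>.\<close>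
        have red: "\<exists>C. (\<forall>j. C j \<in> poly_funs n) \<and> (\<lambda>x. x n ^ m - (\<Sum>j<d. C j x * x n ^ j)) \<in> I" for m
        proof (induction m)
          case 0
          have "(\<Sum>j<d. of_bool (j = 0) * x n ^ j) = (1::'k)" for x :: "nat \<Rightarrow> 'k"
          proof -
            have "(\<Sum>j<d. of_bool (j = 0) * x n ^ j) = (\<Sum>j\<in>{0::nat}. 1)"
              by (rule sum.mono_neutral_cong_right) (use \<open>d \<noteq> 0\<close> in auto)
            then show ?thesis by simp
          qed
          then show ?case
            by (intro exI[of _ "\<lambda>j _. of_bool (j = 0)"]) (simp add: poly_funs.const pf_idealD(2)[OF I])
        next
          case (Suc m)
          then obtain C where C: "\<And>j. C j \<in> poly_funs n" "(\<lambda>x. x n ^ m - (\<Sum>j<d. C j x * x n ^ j)) \<in> I" by blast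
          obtain d' where d': "d = Suc d'" using \<open>d \<noteq> 0\<close> not0_implies_Suc by blast
          \<comment> \<open>Multiplication by \<open>x n\<close> lifts the top term, with
            coefficient \<open>C d'\<close>, to degree \<open>d\<close>, where \<open>g\<close>
            replaces it by lower terms.\<close>
          define C' where "C' j x = (if j = 0 then 0 else C (j - 1) x) - inverse a * C d' x * c' j x" for j x
          have "C' j \<in> poly_funs n" for j
            unfolding C'_def[abs_def] using C(1) c' by (cases "j = 0") (auto intro!: poly_funs_intros)
          moreover have "(\<lambda>x. x n * (x n ^ m - (\<Sum>j<d. C j x * x n ^ j)) + (inverse a * C d' x) * g x) \<in> I"
            using C g by (intro pf_idealD(3)[OF I] pf_idealD(4)[OF I] poly_funs_intros poly_funs_mono[of _ n "Suc n"]) auto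
          moreover have "x n * (x n ^ m - (\<Sum>j<d. C j x * x n ^ j)) + (inverse a * C d' x) * g x
             = x n ^ Suc m - (\<Sum>j<d. C' j x * x n ^ j)" for x
          proof -
            have "(\<Sum>j<d. (if j = 0 then 0 else C (j - 1) x) * x n ^ j) = (\<Sum>j<d'. C j x * x n ^ Suc j)"
              unfolding d' by (subst sum.lessThan_Suc_shift) simp
            then have "(\<Sum>j<d. C' j x * x n ^ j) =
               (\<Sum>j<d'. C j x * x n ^ Suc j) - inverse a * C d' x * (\<Sum>j<d. c' j x * x n ^ j)"
              by (simp add: C'_def left_diff_distrib sum_subtractf sum_distrib_left mult.assoc)
            note C' = this
            have xn: "x n * (\<Sum>j<d. C j x * x n ^ j) = (\<Sum>j<d'. C j x * x n ^ Suc j) + C d' x * x n ^ d"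
              by (simp add: d' sum_distrib_left algebra_simps)
            have gx: "inverse a * C d' x * g x =
                C d' x * x n ^ d + inverse a * C d' x * (\<Sum>j<d. c' j x * x n ^ j)"
              unfolding g_def distrib_left using v(2) by simp
            show ?thesis unfolding right_diff_distrib xn C' gx by simp
          qed
          ultimately show ?case by auto
        qed
        then have "\<forall>m. \<exists>C. (\<forall>j. C j \<in> poly_funs n) \<and> (\<lambda>x. x n ^ m - (\<Sum>j<d. C j x * x n ^ j)) \<in> I"
          by (rule allI)
        from choice[OF this] obtain C where C: "\<And>m j. C m j \<in> poly_funs n"
          "\<And>m. (\<lambda>x. x n ^ m - (\<Sum>j<d. C m j x * x n ^ j)) \<in> I" by blast
        \<comment> \<open>Multiplying the representation of 1 by \<open>x n ^ i\<close> and reducing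
          all powers gives relations whose coefficients vanish at \<open>\<alpha>\<close>, as the
          elimination lemma requires.\<close>
        define E where "E i j x = (\<Sum>l\<le>e. k' l x * C (l + i) j x)" for i j x
        have E_red: "(\<lambda>x. 1 * x n ^ i - (\<Sum>j<d. E i j x * x n ^ j)) \<in> I" for i
        proof -
          have "(\<lambda>x. x n ^ i * h x + (\<Sum>l\<le>e. k' l x * (x n ^ (l + i) - (\<Sum>j<d. C (l + i) j x * x n ^ j)))) \<in> I"
            using C h(1) k'P
            by (intro pf_idealD(3)[OF I] pf_ideal_sum[OF I] pf_idealD(4)[OF I] poly_funs_intros poly_funs_mono[of _ n "Suc n"]) auto
          moreover have "x n ^ i * h x + (\<Sum>l\<le>e. k' l x * (x n ^ (l + i) - (\<Sum>j<d. C (l + i) j x * x n ^ j)))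
             = 1 * x n ^ i - (\<Sum>j<d. E i j x * x n ^ j)" for x
          proof -
            have "(\<Sum>l\<le>e. k' l x * x n ^ (l + i)) = (\<Sum>l\<le>e. k' l x * x n ^ l) * x n ^ i"
              by (simp add: sum_distrib_right power_add mult.assoc)
            also have "\<dots> = x n ^ i - x n ^ i * h x" unfolding k'_sum by (simp add: algebra_simps)
            finally have 1: "(\<Sum>l\<le>e. k' l x * x n ^ (l + i)) = x n ^ i - x n ^ i * h x" .
            have "(\<Sum>l\<le>e. k' l x * (\<Sum>j<d. C (l + i) j x * x n ^ j)) = (\<Sum>j<d. E i j x * x n ^ j)"
              unfolding E_def sum_distrib_left sum_distrib_right
              by (subst sum.swap) (simp add: mult.assoc)
            with 1 show ?thesis by (simp add: right_diff_distrib sum_subtractf)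
          qed
          ultimately show ?thesis by simp
        qed
        have I_mult: "(\<lambda>x. p x * q x) \<in> I" if "p \<in> poly_funs n" "q \<in> I" for p q
          by (rule pf_idealD(4)[OF I poly_funs_mono[OF that(1)] that(2)]) simp
        have "E i j \<in> poly_funs n" for i j
          unfolding E_def[abs_def] using k'P C by (intro poly_funs_intros)
        moreover have "E i j \<alpha> = 0" for i j
          unfolding E_def using k'0 by simp
        ultimately have "\<exists>s'\<in>poly_funs n. s' \<alpha> \<noteq> 0 \<and> (\<forall>i<d. (\<lambda>x. s' x * x n ^ i) \<in> I)"
          using poly_funs.const[of 1 n] E_red
          by (intro nakayama_elimination[where s="\<lambda>_. 1" and e=E, OF pf_idealD(3)[OF I] I_mult]) auto
        \<comment> \<open>For \<open>i = 0\<close> the power is 1, so \<open>s'\<close> itself lies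
          in the contracted ideal although it does not vanish at \<open>\<alpha>\<close>.\<close>
        then obtain s' where "s' \<in> poly_funs n" "s' \<alpha> \<noteq> 0" "(\<lambda>x. s' x * x n ^ 0) \<in> I"
          using \<open>d \<noteq> 0\<close> by blast
        then show False using \<alpha>[of s'] by simp
      qed
    qed
    then obtain x where x: "\<And>p. p \<in> I \<Longrightarrow> p x = 0" by blast
    have "p (\<sigma> x) = 0" if "p \<in> I\<^sub>0" for p
      using x[of "\<lambda>x. p (\<sigma> x)"] that \<sigma>P pf_idealD(1)[OF Suc.prems(1) that] unfolding I_def by (simp add: \<sigma>\<tau>)
    then show ?thesis by blast
  qed
qed

section \<open>Local fractions and Krull's intersection theorem\<close>

text \<open>The denominators \<open>q\<close> for which \<open>q * f\<close> is polynomial on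
  \<open>Y\<close> form an ideal. Local denominators exclude common zeros on the image of
  \<open>e\<close>, equations of the image exclude all others, so 1 is a denominator. The
  parametrization \<open>e\<close> lets the lemma serve both the square of a group and an orbit
  slice.\<close>

theorem local_fraction_polynomial:
  fixes f :: "'y \<Rightarrow> 'k::{alg_closed_field, field_char_0}" and e :: "'y \<Rightarrow> nat \<Rightarrow> 'k"
  assumes loc: "\<And>y. y \<in> Y \<Longrightarrow> \<exists>s\<in>poly_funs N. \<exists>p\<in>poly_funs N.
      s (e y) \<noteq> 0 \<and> (\<forall>y'\<in>Y. s (e y') \<noteq> 0 \<longrightarrow> s (e y') * f y' = p (e y'))"
    and closed: "\<And>z. (\<And>y. y \<in> Y \<Longrightarrow> \<exists>i<N. z i \<noteq> e y i) \<Longrightarrow>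
      \<exists>s\<in>poly_funs N. s z \<noteq> 0 \<and> (\<forall>y\<in>Y. s (e y) = 0)"
  shows "\<exists>p\<in>poly_funs N. \<forall>y\<in>Y. f y = p (e y)"
proof -
  define I where "I = {q \<in> poly_funs N. \<exists>p\<in>poly_funs N. \<forall>y\<in>Y. q (e y) * f y = p (e y)}"
  have "pf_ideal N I"
    unfolding pf_ideal_def
  proof (intro conjI ballI)
    show "I \<subseteq> poly_funs N" unfolding I_def by blast
    show "(\<lambda>x. 0) \<in> I" unfolding I_def by (auto intro!: poly_funs.const bexI[of _ "\<lambda>x. 0"])
    fix q r assume "r \<in> I"
    then obtain p' where r: "r \<in> poly_funs N" "p' \<in> poly_funs N" "\<And>y. y \<in> Y \<Longrightarrow> r (e y) * f y = p' (e y)"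
      unfolding I_def by blast
    show "(\<lambda>x. q x + r x) \<in> I" if "q \<in> I"
    proof -
      obtain p where p: "q \<in> poly_funs N" "p \<in> poly_funs N" "\<And>y. y \<in> Y \<Longrightarrow> q (e y) * f y = p (e y)"
        using \<open>q \<in> I\<close> unfolding I_def by blast
      show ?thesis unfolding I_def
        using r p by (auto intro!: poly_funs.add bexI[of _ "\<lambda>x. p x + p' x"] simp: distrib_right)
    qed
    show "(\<lambda>x. q x * r x) \<in> I" if "q \<in> poly_funs N"
      unfolding I_def using r that
      by (auto intro!: poly_funs.mult bexI[of _ "\<lambda>x. q x * p' x"] simp: mult.assoc)
  qed
  moreover have "\<nexists>z. \<forall>q\<in>I. q z = 0"
  proof
    assume "\<exists>z. \<forall>q\<in>I. q z = 0"
    then obtain z where z: "\<And>q. q \<in> I \<Longrightarrow> q z = 0" by blast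
    show False
    proof (cases "\<exists>y\<in>Y. \<forall>i<N. z i = e y i")
      case True
      then obtain y where y: "y \<in> Y" "\<And>i. i < N \<Longrightarrow> z i = e y i" by blast
      obtain s p where s: "s \<in> poly_funs N" "p \<in> poly_funs N" "s (e y) \<noteq> 0"
        "\<And>y'. y' \<in> Y \<Longrightarrow> s (e y') \<noteq> 0 \<Longrightarrow> s (e y') * f y' = p (e y')"
        using loc[OF y(1)] by blast
      \<comment> \<open>The relation is known only where \<open>s\<close> does not vanish; a second
        factor \<open>s\<close> makes it hold on all of \<open>Y\<close>.\<close>
      have "s (e y') * s (e y') * f y' = s (e y') * p (e y')" if "y' \<in> Y" for y'
        using s(4)[OF that] by (cases "s (e y') = 0") auto
      then have "(\<lambda>x. s x * s x) \<in> I"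
        unfolding I_def using s by (auto intro!: poly_funs.mult bexI[of _ "\<lambda>x. s x * p x"])
      from z[OF this] have "s z = 0" by simp
      moreover have "s z = s (e y)" by (rule poly_funs_cong[OF s(1) y(2)])
      ultimately show False using s(3) by simp
    next
      case False
      then obtain s where "s \<in> poly_funs N" "s z \<noteq> 0" "\<forall>y\<in>Y. s (e y) = 0" using closed[of z] by blast
      then have "s \<in> I" unfolding I_def by (auto intro!: poly_funs.const bexI[of _ "\<lambda>x. 0"])
      then show False using z \<open>s z \<noteq> 0\<close> by blast
    qed
  qed
  ultimately have "(\<lambda>x. 1) \<in> I" using weak_nullstellensatz by blast
  then show ?thesis unfolding I_def by simp
qed

definition join :: "nat \<Rightarrow> (nat \<Rightarrow> 'k) \<Rightarrow> (nat \<Rightarrow> 'k) \<Rightarrow> nat \<Rightarrow> 'k" where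
  "join n x y = (\<lambda>i. if i < n then x i else y (i - n))"

text \<open>As in the Rees algebra, substituting \<open>t * (x - a)\<close> for the second group of
  variables puts the coefficient of \<open>t ^ l\<close> into the \<open>l\<close>-th power of the
  ideal of \<open>a\<close>; what is recorded is that it vanishes at \<open>a\<close> for positive
  \<open>l\<close>.\<close>

lemma poly_funs_rees:
  fixes Q :: "(nat \<Rightarrow> 'k::field) \<Rightarrow> 'k"
  assumes "Q \<in> poly_funs (n + n)"
  shows "\<exists>d c. (\<forall>l. c l \<in> poly_funs n) \<and> (\<forall>l>0. c l a = 0) \<and>
    (\<forall>x t. Q (join n x (\<lambda>i. t * (x i - a i))) = (\<Sum>l\<le>d. c l x * t ^ l))"
  using assms
proof (induction rule: poly_funs.induct)
  case (const b)
  show ?case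
    by (rule exI[of _ 0], rule exI[of _ "\<lambda>l. if l = 0 then (\<lambda>_. b) else (\<lambda>_. 0)"]) (auto intro: poly_funs.const)
next
  case (coord i)
  show ?case
  proof (cases "i < n")
    case True
    then show ?thesis
      by (intro exI[of _ 0] exI[of _ "\<lambda>l. if l = 0 then (\<lambda>x. x i) else (\<lambda>_. 0)"])
        (auto simp: join_def intro: poly_funs.intros)
  next
    case False
    then have "(\<lambda>x. x (i - n) - a (i - n)) \<in> poly_funs n" using coord by (intro poly_funs_intros) auto
    with False show ?thesis
      by (intro exI[of _ 1] exI[of _ "\<lambda>l. if l = 1 then (\<lambda>x. x (i - n) - a (i - n)) else (\<lambda>_. 0)"])
        (auto simp: join_def intro: poly_funs.const)
  qed
next
  case (add p q)
  from add.IH(1) obtain d c where c: "\<And>i. c i \<in> poly_funs n" "\<And>l. l > 0 \<Longrightarrow> c l a = 0"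
    "\<And>x t. p (join n x (\<lambda>i. t * (x i - a i))) = (\<Sum>l\<le>d. c l x * t ^ l)"
    by (elim exE conjE) blast
  from add.IH(2) obtain d' c' where c': "\<And>i. c' i \<in> poly_funs n" "\<And>l. l > 0 \<Longrightarrow> c' l a = 0"
    "\<And>x t. q (join n x (\<lambda>i. t * (x i - a i))) = (\<Sum>l\<le>d'. c' l x * t ^ l)"
    by (elim exE conjE) blast
  define e where "e i x = (if i \<le> d then c i x else 0) + (if i \<le> d' then c' i x else 0)" for i x
  have "p (join n x (\<lambda>i. t * (x i - a i))) + q (join n x (\<lambda>i. t * (x i - a i))) = (\<Sum>i\<le>max d d'. e i x * t ^ i)" for x t
  proof -
    have "p (join n x (\<lambda>i. t * (x i - a i))) = (\<Sum>i\<le>max d d'. (if i \<le> d then c i x else 0) * t ^ i)"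
      unfolding c by (rule sum.mono_neutral_cong_left) auto
    moreover have "q (join n x (\<lambda>i. t * (x i - a i))) = (\<Sum>i\<le>max d d'. (if i \<le> d' then c' i x else 0) * t ^ i)"
      unfolding c' by (rule sum.mono_neutral_cong_left) auto
    ultimately show ?thesis by (simp add: e_def distrib_right sum.distrib)
  qed
  moreover have "e i \<in> poly_funs n" for i
    unfolding e_def[abs_def] by (intro poly_funs_intros poly_funs_if c c')
  moreover have "e l a = 0" if "l > 0" for l using that c(2) c'(2) by (simp add: e_def)
  ultimately show ?case by blast
next
  case (mult p q)
  from mult.IH(1) obtain d c where c: "\<And>i. c i \<in> poly_funs n" "\<And>l. l > 0 \<Longrightarrow> c l a = 0"
    "\<And>x t. p (join n x (\<lambda>i. t * (x i - a i))) = (\<Sum>l\<le>d. c l x * t ^ l)"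
    by (elim exE conjE) blast
  from mult.IH(2) obtain d' c' where c': "\<And>i. c' i \<in> poly_funs n" "\<And>l. l > 0 \<Longrightarrow> c' l a = 0"
    "\<And>x t. q (join n x (\<lambda>i. t * (x i - a i))) = (\<Sum>l\<le>d'. c' l x * t ^ l)"
    by (elim exE conjE) blast
  define e where "e l x = (\<Sum>i\<in>{i. i \<le> d \<and> i \<le> l \<and> l - i \<le> d'}. c i x * c' (l - i) x)" for l x
  have "e l \<in> poly_funs n" for l unfolding e_def[abs_def] by (intro poly_funs_intros c c')
  moreover have "e l a = 0" if "l > 0" for l
    unfolding e_def
  proof (rule sum.neutral, rule ballI)
    fix i show "c i a * c' (l - i) a = 0" using c(2)[of i] c'(2)[of "l - i"] that by (cases "i > 0") auto
  qed
  moreover have "p (join n x (\<lambda>i. t * (x i - a i))) * q (join n x (\<lambda>i. t * (x i - a i))) = (\<Sum>i\<le>d + d'. e i x * t ^ i)" for x t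
    unfolding c(3) c'(3) sum_mult_sum_powers e_def ..
  ultimately show ?case by blast
qed

text \<open>By Hilbert's basis theorem some \<open>P\<^sub>M\<close> is a combination of \<open>P\<^sub>0, \<dots>, P\<^bsub>M-1\<^esub>\<close>; evaluating at
  \<open>(x, t (x - a))\<close> and comparing coefficients of \<open>t\<^sup>M\<close> gives \<open>\<eta> = h \<eta>\<close> with \<open>h a = 0\<close>.\<close>

theorem krull_intersection:
  fixes \<eta> :: "'y \<Rightarrow> 'k::field_char_0" and e :: "'y \<Rightarrow> nat \<Rightarrow> 'k" and a :: "nat \<Rightarrow> 'k"
  assumes "\<And>j. \<exists>P\<in>poly_funs (n + n). (\<forall>x y t. P (join n x (\<lambda>i. t * y i)) = t ^ j * P (join n x y)) \<and>
      (\<forall>g\<in>Y. \<eta> g = P (join n (e g) (\<lambda>i. e g i - a i)))"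
  shows "\<exists>c\<in>poly_funs n. c a \<noteq> 0 \<and> (\<forall>g\<in>Y. c (e g) \<noteq> 0 \<longrightarrow> \<eta> g = 0)"
proof -
  obtain P where P: "\<And>j. P j \<in> poly_funs (n + n)"
    "\<And>j x y t. P j (join n x (\<lambda>i. t * y i)) = t ^ j * P j (join n x y)"
    "\<And>j g. g \<in> Y \<Longrightarrow> \<eta> g = P j (join n (e g) (\<lambda>i. e g i - a i))"
  proof -
    have "\<forall>j. \<exists>P. P \<in> poly_funs (n + n) \<and> (\<forall>x y t. P (join n x (\<lambda>i. t * y i)) = t ^ j * P (join n x y)) \<and>
      (\<forall>g\<in>Y. \<eta> g = P (join n (e g) (\<lambda>i. e g i - a i)))" using assms by blast
    from choice[OF this] obtain P where P: "\<forall>j. P j \<in> poly_funs (n + n) \<and>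
      (\<forall>x y t. P j (join n x (\<lambda>i. t * y i)) = t ^ j * P j (join n x y)) \<and>
      (\<forall>g\<in>Y. \<eta> g = P j (join n (e g) (\<lambda>i. e g i - a i)))" ..
    have "P j \<in> poly_funs (n + n)" "P j (join n x (\<lambda>i. t * y i)) = t ^ j * P j (join n x y)" for j x y t
      using P by blast+
    moreover have "\<eta> g = P j (join n (e g) (\<lambda>i. e g i - a i))" if "g \<in> Y" for j g
      using P that by blast
    ultimately show thesis by (rule that)
  qed
  obtain M Q where Q: "\<And>i. Q i \<in> poly_funs (n + n)" "\<And>x. P M x = (\<Sum>i<M. Q i x * P i x)"
    using hilbert_basis_sequence[of P, OF P(1)] by blast
  have "\<forall>i. \<exists>d c. (\<forall>l. c l \<in> poly_funs n) \<and> (\<forall>l>0. c l a = 0) \<and>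
    (\<forall>x t. Q i (join n x (\<lambda>i. t * (x i - a i))) = (\<Sum>l\<le>d. c l x * t ^ l))"
    using poly_funs_rees[OF Q(1)] by blast
  from choice[OF this] obtain d where "\<forall>i. \<exists>c. (\<forall>l. c l \<in> poly_funs n) \<and> (\<forall>l>0. c l a = 0) \<and>
    (\<forall>x t. Q i (join n x (\<lambda>i. t * (x i - a i))) = (\<Sum>l\<le>d i. c l x * t ^ l))" by blast
  from choice[OF this] obtain c where c': "\<forall>i. (\<forall>l. c i l \<in> poly_funs n) \<and> (\<forall>l>0. c i l a = 0) \<and>
    (\<forall>x t. Q i (join n x (\<lambda>i. t * (x i - a i))) = (\<Sum>l\<le>d i. c i l x * t ^ l))" ..
  have c: "c i l \<in> poly_funs n" "l > 0 \<Longrightarrow> c i l a = 0"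
    "Q i (join n x (\<lambda>i. t * (x i - a i))) = (\<Sum>l\<le>d i. c i l x * t ^ l)" for i l x t
    using c' by blast+
  \<comment> \<open>The sum is the coefficient of \<open>t ^ M\<close> in the combination after
    division by \<open>\<eta> g\<close>. At \<open>a\<close> it vanishes, because only positive
    indices \<open>M - i\<close> occur.\<close>
  define h where "h x = 1 - (\<Sum>i<M. if M - i \<le> d i then c i (M - i) x else 0)" for x
  have "h \<in> poly_funs n"
    unfolding h_def[abs_def] by (intro poly_funs_intros poly_funs_if c)
  moreover have "h a = 1"
    unfolding h_def using c(2) by (auto intro!: sum.neutral)
  moreover have "h (e g) = 0" if g: "g \<in> Y" "\<eta> g \<noteq> 0" for g
  proof -
    let ?x = "e g"
    define q where "q = (\<Sum>i<M. \<Sum>l\<le>d i. monom (c i l ?x) (l + i)) - monom 1 M"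
    have "poly q t = 0" for t
    proof -
      have "t ^ M * \<eta> g = P M (join n ?x (\<lambda>i. t * (?x i - a i)))"
        by (simp only: P(2) P(3)[OF g(1), symmetric])
      also have "\<dots> = (\<Sum>i<M. (\<Sum>l\<le>d i. c i l ?x * t ^ l) * (t ^ i * \<eta> g))"
        unfolding Q(2) c(3) by (simp only: P(2) P(3)[OF g(1), symmetric])
      also have "\<dots> = (\<Sum>i<M. \<Sum>l\<le>d i. c i l ?x * t ^ (l + i)) * \<eta> g"
        by (simp add: sum_distrib_right power_add mult.assoc)
      finally have "t ^ M = (\<Sum>i<M. \<Sum>l\<le>d i. c i l ?x * t ^ (l + i))" using g(2) by simp
      then show ?thesis by (simp add: q_def poly_sum poly_monom)
    qed
    then have "q = 0" using poly_all_0_iff_0 by blast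
    then have "0 = coeff q M" by simp
    also have "\<dots> = (\<Sum>i<M. \<Sum>l\<le>d i. if l + i = M then c i l ?x else 0) - 1"
      by (simp add: q_def coeff_sum)
    also have "(\<Sum>i<M. \<Sum>l\<le>d i. if l + i = M then c i l ?x else 0)
      = (\<Sum>i<M. if M - i \<le> d i then c i (M - i) ?x else 0)"
    proof (rule sum.cong[OF refl])
      fix i assume "i \<in> {..<M}"
      then have "(l + i = M) = (l = M - i)" for l by auto
      then show "(\<Sum>l\<le>d i. if l + i = M then c i l ?x else 0) = (if M - i \<le> d i then c i (M - i) ?x else 0)"
        by simp
    qed
    finally show ?thesis by (simp add: h_def)
  qed
  ultimately show ?thesis by (intro bexI[of _ h]) auto
qed

section \<open>Generalized eigenvectors of locally finite operators\<close>

text \<open>Gaussian elimination by induction on \<open>d\<close>: a vector with nonzero last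
  coordinate clears that coordinate of all the others.\<close>

lemma linear_relation_exists:
  fixes v :: "nat \<Rightarrow> nat \<Rightarrow> 'k::field"
  shows "\<exists>c. (\<exists>i\<le>d. c i \<noteq> 0) \<and> (\<forall>j<d. (\<Sum>i\<le>d. c i * v i j) = 0)"
proof (induction d arbitrary: v)
  case 0
  show ?case by (rule exI[of _ "\<lambda>_. 1"]) simp
next
  case (Suc d)
  show ?case
  proof (cases "\<exists>p\<le>Suc d. v p d \<noteq> 0")
    case False
    obtain c where c: "\<exists>i\<le>d. c i \<noteq> 0" "\<forall>j<d. (\<Sum>i\<le>d. c i * v i j) = 0"
      using Suc.IH[of v] by blast
    have "(\<Sum>i\<le>Suc d. (if i \<le> d then c i else 0) * v i j) = (\<Sum>i\<le>d. c i * v i j)" for j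
      by (rule sum.mono_neutral_cong_right) auto
    with c False show ?thesis
      by (intro exI[of _ "\<lambda>i. if i \<le> d then c i else 0"]) (auto simp: less_Suc_eq)
  next
    case True
    then obtain p where p: "p \<le> Suc d" "v p d \<noteq> 0" by blast
    \<comment> \<open>\<open>\<sigma>\<close> enumerates the indices other than the pivot
      \<open>p\<close>.\<close>
    define \<sigma> where "\<sigma> i = (if i < p then i else Suc i)" for i
    have bij: "bij_betw \<sigma> {..d} ({..Suc d} - {p})"
      by (rule bij_betw_byWitness[where f'="\<lambda>i. if i < p then i else i - 1"]) (use p in \<open>auto simp: \<sigma>_def\<close>)
    obtain c where c: "\<exists>i\<le>d. c i \<noteq> 0"
      "\<forall>j<d. (\<Sum>i\<le>d. c i * (v (\<sigma> i) j - v (\<sigma> i) d / v p d * v p j)) = 0"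
      using Suc.IH[of "\<lambda>i j. v (\<sigma> i) j - v (\<sigma> i) d / v p d * v p j"] by blast
    define e where "e i = (if i = p then - (\<Sum>i\<le>d. c i * v (\<sigma> i) d / v p d) else c (inv_into {..d} \<sigma> i))" for i
    have e\<sigma>: "e (\<sigma> i) = c i" if "i \<le> d" for i
      using bij_betw_inv_into_left[OF bij, of i] that by (simp add: e_def) (auto simp: \<sigma>_def)
    have "(\<Sum>i\<le>Suc d. e i * v i j) = e p * v p j + (\<Sum>i\<le>d. c i * v (\<sigma> i) j)" for j
    proof -
      have "(\<Sum>i\<le>Suc d. e i * v i j) = e p * v p j + (\<Sum>i\<in>{..Suc d} - {p}. e i * v i j)"
        by (rule sum.remove) (use p in auto)
      also have "(\<Sum>i\<in>{..Suc d} - {p}. e i * v i j) = (\<Sum>i\<le>d. e (\<sigma> i) * v (\<sigma> i) j)"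
        by (rule sum.reindex_bij_betw[OF bij, symmetric])
      finally show ?thesis by (simp add: e\<sigma>)
    qed
    moreover have "e p * v p j + (\<Sum>i\<le>d. c i * v (\<sigma> i) j)
      = (\<Sum>i\<le>d. c i * (v (\<sigma> i) j - v (\<sigma> i) d / v p d * v p j))" for j
      by (simp add: e_def sum_distrib_right right_diff_distrib sum_subtractf mult.assoc)
    ultimately have "(\<Sum>i\<le>Suc d. e i * v i j) = 0" if "j < Suc d" for j
      using c(2) that p by (cases "j = d") auto
    moreover obtain i where "i \<le> d" "c i \<noteq> 0" using c(1) by blast
    then have "e (\<sigma> i) \<noteq> 0" "\<sigma> i \<le> Suc d" using e\<sigma> by (auto simp: \<sigma>_def)
    ultimately show ?thesis by blast
  qed
qed

text \<open>In the binomial formula every term of the power \<open>m + n\<close> has at least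
  \<open>m\<close> derivatives on the first factor or at least \<open>n\<close> on the second;
  induction on \<open>m + n\<close> replaces the formula. \<open>B\<close> will be the product of
  functions and also the application of an operator to a function.\<close>

lemma leibniz_nilpotent:
  fixes B :: "'u \<Rightarrow> 'v \<Rightarrow> 'w::ab_group_add" and z\<^sub>1 :: 'u and z\<^sub>2 :: 'v
  assumes leib: "\<And>u v. u \<in> U \<Longrightarrow> v \<in> V \<Longrightarrow> T\<^sub>3 (B u v) = B (T\<^sub>1 u) v + B u (T\<^sub>2 v)"
    and stab: "\<And>u. u \<in> U \<Longrightarrow> T\<^sub>1 u \<in> U" "\<And>v. v \<in> V \<Longrightarrow> T\<^sub>2 v \<in> V" "\<And>w. w \<in> W \<Longrightarrow> T\<^sub>3 w \<in> W"
    and BW: "\<And>u v. u \<in> U \<Longrightarrow> v \<in> V \<Longrightarrow> B u v \<in> W"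
    and zero: "\<And>v. v \<in> V \<Longrightarrow> B z\<^sub>1 v = 0" "\<And>u. u \<in> U \<Longrightarrow> B u z\<^sub>2 = 0"
    and add: "\<And>w w'. w \<in> W \<Longrightarrow> w' \<in> W \<Longrightarrow> T\<^sub>3 (w + w') = T\<^sub>3 w + T\<^sub>3 w'" "T\<^sub>3 0 = 0"
    and nil: "u \<in> U" "v \<in> V" "(T\<^sub>1 ^^ m) u = z\<^sub>1" "(T\<^sub>2 ^^ n) v = z\<^sub>2"
  shows "(T\<^sub>3 ^^ (m + n)) (B u v) = 0"
proof -
  have pow_stab: "(T\<^sub>3 ^^ k) w \<in> W" if "w \<in> W" for w k
    using that by (induction k) (auto intro: stab)
  have pow_add: "(T\<^sub>3 ^^ k) (w + w') = (T\<^sub>3 ^^ k) w + (T\<^sub>3 ^^ k) w'" if "w \<in> W" "w' \<in> W" for w w' k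
    using that by (induction k) (auto simp: add pow_stab)
  have pow_0: "(T\<^sub>3 ^^ k) 0 = 0" for k by (induction k) (auto simp: add)
  show ?thesis using nil
  proof (induction "m + n" arbitrary: m n u v)
    case 0
    then show ?case using zero by simp
  next
    case (Suc N)
    consider "m = 0" | "n = 0" | m' n' where "m = Suc m'" "n = Suc n'"
      by (metis not0_implies_Suc)
    then show ?case
    proof cases
      case 1
      then show ?thesis using Suc.prems zero(1) pow_0 by simp
    next
      case 2
      then show ?thesis using Suc.prems zero(2) pow_0 by simp
    next
      case 3
      have "(T\<^sub>3 ^^ (m + n)) (B u v) = (T\<^sub>3 ^^ N) (T\<^sub>3 (B u v))"
        using Suc.hyps(2) by (metis funpow_Suc_right comp_apply)
      also have "\<dots> = (T\<^sub>3 ^^ N) (B (T\<^sub>1 u) v) + (T\<^sub>3 ^^ N) (B u (T\<^sub>2 v))"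
        using Suc.prems by (simp add: leib pow_add BW stab)
      also have "(T\<^sub>3 ^^ N) (B (T\<^sub>1 u) v) = 0"
        using Suc.hyps(1)[of m' n "T\<^sub>1 u" v] Suc.hyps(2) Suc.prems 3 stab
        by (simp add: funpow_swap1)
      also have "(T\<^sub>3 ^^ N) (B u (T\<^sub>2 v)) = 0"
        using Suc.hyps(1)[of m n' u "T\<^sub>2 v"] Suc.hyps(2) Suc.prems 3 stab
        by (simp add: funpow_swap1)
      finally show ?thesis by simp
    qed
  qed
qed

section \<open>Generalized eigenspaces of operators on a subspace\<close>

locale linear_ops = vector_space scale
  for scale :: "'a::field \<Rightarrow> 'b::ab_group_add \<Rightarrow> 'b" (infixr \<open>*s\<close> 75)
begin

text \<open>The operators in question are total functions that are linear only on a subspace, such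
  as the coordinate ring or the Lie algebra.\<close>

definition lin_on :: "'b set \<Rightarrow> ('b \<Rightarrow> 'b) \<Rightarrow> bool" where
  "lin_on S T \<longleftrightarrow> subspace S \<and> (\<forall>v\<in>S. T v \<in> S) \<and> (\<forall>u\<in>S. \<forall>v\<in>S. T (u + v) = T u + T v) \<and>
     (\<forall>c. \<forall>v\<in>S. T (c *s v) = c *s T v)"

abbreviation shifted :: "('b \<Rightarrow> 'b) \<Rightarrow> 'a \<Rightarrow> 'b \<Rightarrow> 'b" where
  "shifted T a \<equiv> (\<lambda>v. T v - a *s v)"

definition gen_eigenspace :: "'b set \<Rightarrow> ('b \<Rightarrow> 'b) \<Rightarrow> 'a \<Rightarrow> 'b set" where
  "gen_eigenspace S T a = {v \<in> S. \<exists>m. (shifted T a ^^ m) v = 0}"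

lemma lin_onD:
  assumes "lin_on S T"
  shows "subspace S" "v \<in> S \<Longrightarrow> T v \<in> S" "u \<in> S \<Longrightarrow> v \<in> S \<Longrightarrow> T (u + v) = T u + T v"
    "v \<in> S \<Longrightarrow> T (c *s v) = c *s T v" "T 0 = 0"
    "u \<in> S \<Longrightarrow> v \<in> S \<Longrightarrow> T (u - v) = T u - T v"
proof -
  show 1: "subspace S" "v \<in> S \<Longrightarrow> T v \<in> S" "u \<in> S \<Longrightarrow> v \<in> S \<Longrightarrow> T (u + v) = T u + T v"
    "v \<in> S \<Longrightarrow> T (c *s v) = c *s T v" for u v c
    using assms unfolding lin_on_def by auto
  show "T 0 = 0" using 1(4)[of 0 0] subspace_0[OF 1(1)] by simp
  show "T (u - v) = T u - T v" if "u \<in> S" "v \<in> S"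
    using 1(3)[of "u - v" v] that subspace_diff[OF 1(1)] by (simp add: eq_diff_eq)
qed

lemma lin_on_shifted: "lin_on S T \<Longrightarrow> lin_on S (shifted T a)"
  unfolding lin_on_def
  by (auto simp: subspace_diff subspace_scale scale_right_distrib scale_right_diff_distrib mult.commute)

lemma lin_on_funpow: "lin_on S T \<Longrightarrow> lin_on S (T ^^ k)"
  by (induction k) (auto simp: lin_on_def)

lemma lin_on_sum:
  assumes "lin_on S T" "\<And>i. i \<in> I \<Longrightarrow> w i \<in> S"
  shows "T (\<Sum>i\<in>I. w i) = (\<Sum>i\<in>I. T (w i))"
  using assms(2)
proof (induction I rule: infinite_finite_induct)
  case (insert x F)
  then show ?case
    by (simp add: lin_onD[OF assms(1)] subspace_sum[OF lin_onD(1)[OF assms(1)]])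
qed (simp_all add: lin_onD[OF assms(1)])

lemma shifted_commute:
  assumes "lin_on S T" "v \<in> S"
  shows "shifted T a (shifted T b v) = shifted T b (shifted T a v)"
  using assms(2) lin_onD[OF assms(1)]
  by (simp add: subspace_scale scale_right_diff_distrib mult.commute)

lemma shifted_funpow_commute:
  assumes "lin_on S T" "v \<in> S"
  shows "(shifted T a ^^ m) ((shifted T b ^^ n) v) = (shifted T b ^^ n) ((shifted T a ^^ m) v)"
proof -
  have S: "(shifted T c ^^ j) w \<in> S" if "w \<in> S" for c j w
    using lin_onD(2)[OF lin_on_funpow[OF lin_on_shifted[OF assms(1)]] that] .
  have 1: "shifted T a ((shifted T b ^^ n) w) = (shifted T b ^^ n) (shifted T a w)" if "w \<in> S" for w n
    using that
  proof (induction n)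
    case (Suc n)
    have "shifted T a ((shifted T b ^^ Suc n) w) = shifted T b (shifted T a ((shifted T b ^^ n) w))"
      using shifted_commute[OF assms(1) S[OF Suc.prems, where c=b and j=n], where a=a and b=b] by simp
    with Suc show ?case by simp
  qed simp
  show ?thesis
  proof (induction m)
    case (Suc m)
    then show ?case using 1[OF S[OF assms(2), where c=a and j=m], of n] by simp
  qed simp
qed

lemma subspace_gen_eigenspace:
  assumes "lin_on S T"
  shows "subspace (gen_eigenspace S T a)"
proof (rule subspaceI)
  note pow = lin_onD[OF lin_on_funpow[OF lin_on_shifted[OF assms]]]
  note S = lin_onD[OF assms]
  show "0 \<in> gen_eigenspace S T a"
    unfolding gen_eigenspace_def using subspace_0[OF S(1)] by (auto intro: exI[of _ 0])
  fix x y c assume x: "x \<in> gen_eigenspace S T a"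
  then obtain m where m: "x \<in> S" "(shifted T a ^^ m) x = 0" unfolding gen_eigenspace_def by blast
  then show "c *s x \<in> gen_eigenspace S T a"
    unfolding gen_eigenspace_def using subspace_scale[OF S(1)] by (auto simp: pow intro: exI[of _ m])
  assume y: "y \<in> gen_eigenspace S T a"
  then obtain n where n: "y \<in> S" "(shifted T a ^^ n) y = 0" unfolding gen_eigenspace_def by blast
  have "(shifted T a ^^ (n + m)) x = 0" "(shifted T a ^^ (m + n)) y = 0"
    using m n by (simp_all add: funpow_add pow)
  then have "(shifted T a ^^ (m + n)) (x + y) = 0"
    using m(1) n(1) by (simp add: pow add.commute)
  then show "x + y \<in> gen_eigenspace S T a"
    unfolding gen_eigenspace_def using subspace_add[OF S(1)] m(1) n(1) by blast
qed

lemma gen_eigenspace_shifted: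
  assumes "lin_on S T" "v \<in> gen_eigenspace S T a"
  shows "shifted T b v \<in> gen_eigenspace S T a"
proof -
  obtain m where m: "v \<in> S" "(shifted T a ^^ m) v = 0" using assms(2) unfolding gen_eigenspace_def by blast
  have "(shifted T a ^^ m) (shifted T b v) = shifted T b ((shifted T a ^^ m) v)"
    using shifted_funpow_commute[OF assms(1) m(1), where a=a and m=m and b=b and n=1] by simp
  with m show ?thesis
    unfolding gen_eigenspace_def using lin_onD[OF lin_on_shifted[OF assms(1)]] lin_onD(5)[OF assms(1)] by auto
qed

lemma gen_eigenspace_funpow:
  assumes "lin_on S T" "v \<in> gen_eigenspace S T a"
  shows "(shifted T b ^^ k) v \<in> gen_eigenspace S T a"
  using assms(2) by (induction k) (auto intro: gen_eigenspace_shifted[OF assms(1)])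

text \<open>On an eigenvector for \<open>b\<close> the power \<open>j\<close> of
  \<open>T - a\<close> is multiplication by \<open>(b - a) ^ j\<close>, which is never zero.\<close>

lemma gen_eigenspace_inj:
  assumes "lin_on S T" "v \<in> gen_eigenspace S T a" "a \<noteq> b" "(shifted T b ^^ k) v = 0"
  shows "v = 0"
  using assms(2,4)
proof (induction k arbitrary: v)
  case (Suc k)
  have "(shifted T b ^^ k) (shifted T b v) = 0"
    using Suc.prems(2) by (simp only: funpow_Suc_right comp_apply)
  with Suc.IH gen_eigenspace_shifted[OF assms(1) Suc.prems(1)] have "shifted T b v = 0" by blast
  then have v: "T v = b *s v" by simp
  obtain m where m: "v \<in> S" "(shifted T a ^^ m) v = 0"
    using Suc.prems unfolding gen_eigenspace_def by blast
  have "(shifted T a ^^ j) v = (b - a) ^ j *s v" for j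
  proof (induction j)
    case (Suc j)
    then show ?case
      using lin_onD(4)[OF assms(1) m(1), of "(b - a) ^ j"] v
      by (simp add: scale_left_diff_distrib left_diff_distrib mult.commute)
  qed simp
  with m(2) assms(3) show ?case by simp
qed simp

text \<open>On this space \<open>T - b\<close> is the invertible scalar \<open>a - b\<close> plus
  the nilpotent operator \<open>T - a\<close>; the inverse series is unrolled by induction on the
  order of nilpotency.\<close>

lemma gen_eigenspace_surj:
  assumes "lin_on S T" "v \<in> gen_eigenspace S T a" "a \<noteq> b"
  shows "\<exists>w\<in>gen_eigenspace S T a. shifted T b w = v"
proof -
  note sub = subspace_gen_eigenspace[OF assms(1)]
  obtain m where m: "(shifted T a ^^ m) v = 0"
    using assms(2) unfolding gen_eigenspace_def by blast
  show ?thesis using assms(2) m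
  proof (induction m arbitrary: v)
    case 0
    then show ?case using subspace_0[OF sub] lin_onD(5)[OF assms(1)] by (intro bexI[of _ 0]) auto
  next
    case (Suc m)
    have v': "shifted T a v \<in> gen_eigenspace S T a" "(shifted T a ^^ m) (shifted T a v) = 0"
      using Suc.prems(2) gen_eigenspace_shifted[OF assms(1) Suc.prems(1), of a]
      by (simp_all only: funpow_Suc_right comp_apply)
    from Suc.IH[OF this] obtain s where s: "s \<in> gen_eigenspace S T a" "shifted T b s = shifted T a v" by blast
    have inS: "v \<in> S" "s \<in> S" using Suc.prems s unfolding gen_eigenspace_def by auto
    \<comment> \<open>Since \<open>T - b\<close> sends \<open>s\<close> to the image of
      \<open>v\<close> under \<open>T - a\<close>, it sends \<open>v - s\<close> to
      \<open>(a - b) *s v\<close>.\<close>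
    define w where "w = inverse (a - b) *s (v - s)"
    have "shifted T b w = inverse (a - b) *s shifted T b (v - s)"
      unfolding w_def by (rule lin_onD(4)[OF lin_on_shifted[OF assms(1)]])
        (use inS lin_onD(1)[OF assms(1)] in \<open>auto intro: subspace_diff\<close>)
    also have "shifted T b (v - s) = shifted T b v - shifted T b s"
      by (rule lin_onD(6)[OF lin_on_shifted[OF assms(1)]]) (use inS in auto)
    also have "shifted T b v - shifted T b s = (a - b) *s v"
      unfolding s(2) by (simp add: scale_left_diff_distrib)
    finally have "shifted T b w = v" using assms(3) by simp
    moreover have "w \<in> gen_eigenspace S T a"
      unfolding w_def using s(1) Suc.prems(1) by (intro subspace_scale[OF sub] subspace_diff[OF sub])
    ultimately show ?case by blast
  qed
qed

text \<open>A power of \<open>T - b\<close> removes the component for \<open>b\<close> and is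
  injective on the others.\<close>

lemma gen_eigenspace_independent:
  assumes "lin_on S T" "finite A" "\<And>a. a \<in> A \<Longrightarrow> w a \<in> gen_eigenspace S T a" "(\<Sum>a\<in>A. w a) = 0"
  shows "\<forall>a\<in>A. w a = 0"
  using assms(2-)
proof (induction A arbitrary: w)
  case (insert b A)
  have S: "w a \<in> S" if "a \<in> insert b A" for a
    using insert.prems(1)[OF that] unfolding gen_eigenspace_def by blast
  obtain m where m: "(shifted T b ^^ m) (w b) = 0"
    using insert.prems(1)[of b] unfolding gen_eigenspace_def by auto
  have "0 = (shifted T b ^^ m) (\<Sum>a\<in>insert b A. w a)"
    using insert.prems(2) lin_onD(5)[OF lin_on_funpow[OF lin_on_shifted[OF assms(1)]]] by simp
  also have "\<dots> = (\<Sum>a\<in>insert b A. (shifted T b ^^ m) (w a))"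
    by (rule lin_on_sum[OF lin_on_funpow[OF lin_on_shifted[OF assms(1)]]]) (rule S)
  finally have "(\<Sum>a\<in>A. (shifted T b ^^ m) (w a)) = 0"
    using insert.hyps m by simp
  then have "\<forall>a\<in>A. (shifted T b ^^ m) (w a) = 0"
    using insert.prems(1) gen_eigenspace_funpow[OF assms(1)] by (intro insert.IH) auto
  then have "\<forall>a\<in>A. w a = 0"
    using gen_eigenspace_inj[OF assms(1)] insert.prems(1) insert.hyps(2) by (metis insertI2)
  moreover from this have "w b = 0" using insert by simp
  ultimately show ?case by simp
qed simp

definition poly_op :: "('b \<Rightarrow> 'b) \<Rightarrow> 'a poly \<Rightarrow> 'b \<Rightarrow> 'b" where
  "poly_op T p v = (\<Sum>i\<le>degree p. coeff p i *s (T ^^ i) v)"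

lemma poly_op_eq: "degree p \<le> d \<Longrightarrow> poly_op T p v = (\<Sum>i\<le>d. coeff p i *s (T ^^ i) v)"
  unfolding poly_op_def by (rule sum.mono_neutral_left) (auto simp: coeff_eq_0)

lemma poly_op_mult_linear:
  assumes "lin_on S T" "v \<in> S"
  shows "poly_op T ([:-a, 1:] * q) v = poly_op T q (shifted T a v)"
proof -
  note pow = lin_onD[OF lin_on_funpow[OF assms(1)]]
  have Tv: "T v \<in> S" "a *s v \<in> S" using lin_onD[OF assms(1)] assms(2) by (auto intro: subspace_scale)
  have deg: "degree ([:-a, 1:] * q) \<le> Suc (degree q)"
    by (rule order.trans[OF degree_mult_le]) simp
  have "poly_op T ([:-a, 1:] * q) v = (\<Sum>i\<le>Suc (degree q). coeff ([:-a, 1:] * q) i *s (T ^^ i) v)"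
    by (rule poly_op_eq[OF deg])
  also have "\<dots> = (\<Sum>i\<le>Suc (degree q). (case i of 0 \<Rightarrow> 0 | Suc j \<Rightarrow> coeff q j) *s (T ^^ i) v)
      - (\<Sum>i\<le>Suc (degree q). (a * coeff q i) *s (T ^^ i) v)"
    by (simp add: coeff_pCons sum_subtractf[symmetric] scale_left_diff_distrib[symmetric] split: nat.split
        del: sum.atMost_Suc)
  also have "(\<Sum>i\<le>Suc (degree q). (case i of 0 \<Rightarrow> 0 | Suc j \<Rightarrow> coeff q j) *s (T ^^ i) v)
    = (\<Sum>i\<le>degree q. coeff q i *s (T ^^ i) (T v))"
    by (subst sum.atMost_Suc_shift) (simp add: funpow_swap1)
  also have "(\<Sum>i\<le>Suc (degree q). (a * coeff q i) *s (T ^^ i) v) = (\<Sum>i\<le>degree q. coeff q i *s (T ^^ i) (a *s v))"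
    using assms(2) by (simp add: coeff_eq_0 pow(4) mult.commute)
  finally show ?thesis
    unfolding poly_op_def using pow(6)[OF Tv] by (simp add: sum_subtractf[symmetric] scale_right_diff_distrib)
qed

end

text \<open>An annihilating polynomial of the single vector \<open>v\<close> takes the place of
  finite dimension. Split off a root \<open>b\<close>, decompose the image of \<open>v\<close> under
  \<open>T - b\<close>, and invert \<open>T - b\<close> on the components other than the one for
  \<open>b\<close>.\<close>

theorem (in linear_ops) gen_eigenspace_decomposition:
  fixes p :: "'a poly"
  assumes "\<And>q :: 'a poly. degree q > 0 \<Longrightarrow> \<exists>x. poly q x = 0"
    and "lin_on S T" "v \<in> S" "p \<noteq> 0" "poly_op T p v = 0"
  shows "\<exists>A w. finite A \<and> (\<forall>a\<in>A. w a \<in> gen_eigenspace S T a) \<and> v = (\<Sum>a\<in>A. w a)"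
  using assms(3-)
proof (induction "degree p" arbitrary: p v)
  case 0
  then obtain c where "p = [:c:]" "c \<noteq> 0" by (metis degree_eq_zeroE pCons_0_0)
  with 0 have "v = 0" by (simp add: poly_op_def)
  then show ?case by (intro exI[of _ "{}"]) simp
next
  case (Suc d)
  obtain b where "poly p b = 0" using assms(1)[of p] Suc.hyps(2) by auto
  then obtain q where q: "p = [:-b, 1:] * q" by (metis dvdE poly_eq_0_iff_dvd)
  have "q \<noteq> 0" using Suc.prems q by auto
  then have "degree p = degree q + 1" unfolding q by (subst degree_mult_eq) auto
  then have d: "d = degree q" using Suc.hyps(2) by simp
  define v' where "v' = shifted T b v"
  have v': "v' \<in> S" "poly_op T q v' = 0"
    unfolding v'_def using lin_onD(2)[OF lin_on_shifted[OF assms(2)] Suc.prems(1)]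
      poly_op_mult_linear[OF assms(2) Suc.prems(1), of b q] Suc.prems(3) q by auto
  obtain A w where A: "finite A" "\<And>a. a \<in> A \<Longrightarrow> w a \<in> gen_eigenspace S T a" "v' = (\<Sum>a\<in>A. w a)"
    using Suc.hyps(1)[OF d v'(1) \<open>q \<noteq> 0\<close> v'(2)] by blast
  have "\<forall>a. \<exists>s. a \<in> A - {b} \<longrightarrow> s \<in> gen_eigenspace S T a \<and> shifted T b s = w a"
    using gen_eigenspace_surj[OF assms(2) A(2)] by blast
  then obtain s where s: "\<And>a. a \<in> A - {b} \<Longrightarrow> s a \<in> gen_eigenspace S T a"
    "\<And>a. a \<in> A - {b} \<Longrightarrow> shifted T b (s a) = w a" by metis
  have sS: "s a \<in> S" if "a \<in> A - {b}" for a using s(1)[OF that] unfolding gen_eigenspace_def by blast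
  \<comment> \<open>What remains of \<open>v\<close> is mapped by \<open>T - b\<close> to the
    component for \<open>b\<close>, so it lies in the generalized eigenspace of
    \<open>b\<close>.\<close>
  define r where "r = v - (\<Sum>a\<in>A - {b}. s a)"
  have rS: "r \<in> S" unfolding r_def using sS lin_onD(1)[OF assms(2)] Suc.prems(1)
    by (intro subspace_diff subspace_sum) auto
  have "shifted T b r = v' - shifted T b (\<Sum>a\<in>A - {b}. s a)"
    unfolding r_def v'_def
    by (rule lin_onD(6)[OF lin_on_shifted[OF assms(2)]])
      (use sS lin_onD(1)[OF assms(2)] Suc.prems(1) in \<open>auto intro: subspace_sum\<close>)
  also have "shifted T b (\<Sum>a\<in>A - {b}. s a) = (\<Sum>a\<in>A - {b}. shifted T b (s a))"
    by (rule lin_on_sum[OF lin_on_shifted[OF assms(2)]]) (rule sS)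
  also have "\<dots> = (\<Sum>a\<in>A - {b}. w a)" by (rule sum.cong) (auto simp: s)
  also have "v' - \<dots> = (if b \<in> A then w b else 0)"
    using A(1,3) by (auto simp: sum.remove)
  finally have Tr: "shifted T b r = (if b \<in> A then w b else 0)" .
  have "\<exists>m. (shifted T b ^^ m) (shifted T b r) = 0"
    unfolding Tr using A(2)[of b] unfolding gen_eigenspace_def by (auto intro: exI[of _ 0])
  then obtain m where "(shifted T b ^^ m) (shifted T b r) = 0" ..
  then have "(shifted T b ^^ Suc m) r = 0" by (simp only: funpow_Suc_right comp_apply)
  with rS have r: "r \<in> gen_eigenspace S T b" unfolding gen_eigenspace_def by blast
  have "v = (\<Sum>a\<in>insert b (A - {b}). (if a = b then r else s a))"
    using A(1) by (subst sum.insert) (auto simp: r_def)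
  then show ?case
    using A(1) r s(1) by (intro exI[of _ "insert b (A - {b})"] exI[of _ "\<lambda>a. if a = b then r else s a"]) auto
qed

lemma (in linear_ops) gen_eigenspace_independent_family:
  assumes T: "lin_on S T" and I: "finite I" "inj_on f I"
    and w: "\<And>i. i \<in> I \<Longrightarrow> w i \<in> gen_eigenspace S T (f i)" "(\<Sum>i\<in>I. w i) = 0" and i: "i \<in> I"
  shows "w i = 0"
proof -
  have "(\<Sum>a\<in>f ` I. w (inv_into I f a)) = (\<Sum>i\<in>I. w i)"
    using I by (simp add: sum.reindex)
  then have "\<forall>a\<in>f ` I. w (inv_into I f a) = 0"
    using T I w by (intro gen_eigenspace_independent) auto
  then show ?thesis using I i by auto
qed

lemma (in linear_ops) relation_imp_poly_op:
  assumes "\<exists>i\<le>d. c i \<noteq> 0" "(\<Sum>i\<le>d. c i *s (T ^^ i) v) = 0"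
  shows "\<exists>p. p \<noteq> 0 \<and> poly_op T p v = 0"
proof -
  define p where "p = (\<Sum>i\<le>d. monom (c i) i)"
  have coeff: "coeff p i = (if i \<le> d then c i else 0)" for i
    by (simp add: p_def coeff_sum)
  have "degree p \<le> d" by (rule degree_le) (simp add: coeff)
  then have "poly_op T p v = (\<Sum>i\<le>d. coeff p i *s (T ^^ i) v)" by (rule poly_op_eq)
  also have "\<dots> = 0" using assms(2) by (simp add: coeff)
  finally have "poly_op T p v = 0" .
  moreover have "p \<noteq> 0" using assms(1) coeff by (metis coeff_0)
  ultimately show ?thesis by blast
qed

section \<open>The Lie algebra of an affine group\<close>

text \<open>Scalar multiplication of functions and of operators between function spaces. The
  interpretations \<open>F\<close> and \<open>O\<close> make the eigenspace theory available both
  for derivations of the coordinate ring and for brackets on the Lie algebra.\<close>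

definition fscale :: "'k::field \<Rightarrow> ('a \<Rightarrow> 'k) \<Rightarrow> 'a \<Rightarrow> 'k" where
  "fscale c f = (\<lambda>x. c * f x)"

definition oscale :: "'k::field \<Rightarrow> ('c \<Rightarrow> 'a \<Rightarrow> 'k) \<Rightarrow> 'c \<Rightarrow> 'a \<Rightarrow> 'k" where
  "oscale c D = (\<lambda>r x. c * D r x)"

interpretation F: linear_ops "fscale :: 'k::field \<Rightarrow> ('a \<Rightarrow> 'k) \<Rightarrow> 'a \<Rightarrow> 'k"
  by standard (auto simp: fscale_def fun_eq_iff algebra_simps)

interpretation O: linear_ops "oscale :: 'k::field \<Rightarrow> ('c \<Rightarrow> 'a \<Rightarrow> 'k) \<Rightarrow> 'c \<Rightarrow> 'a \<Rightarrow> 'k"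
  by standard (auto simp: oscale_def fun_eq_iff algebra_simps)

lemma fscale_apply: "fscale c f x = c * f x" by (simp add: fscale_def)

lemma oscale_apply: "oscale c D r x = c * D r x" by (simp add: oscale_def)

lemmas fun_simps = fscale_apply oscale_apply plus_fun_apply times_fun_apply zero_fun_apply minus_apply
text \<open>Identities are to be simplified in the ring of functions; evaluation at points happens
  only where it is asked for.\<close>

declare plus_fun_apply [simp del] times_fun_apply [simp del] zero_fun_apply [simp del] minus_apply [simp del]

lemma op_simps:
  fixes D D' :: "'c \<Rightarrow> 'a \<Rightarrow> 'k::field"
  shows "(D + D') r = D r + D' r" "(D - D') r = D r - D' r" "(0 :: 'c \<Rightarrow> 'a \<Rightarrow> 'k) r = 0"
  by (simp_all add: fun_simps)

lemma oscale_fscale: "oscale c D r = fscale c (D r)" by (simp add: fun_eq_iff fun_simps)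

lemma sum_fun_apply: "(\<Sum>i\<in>I. f i) x = (\<Sum>i\<in>I. f i x)"
  by (induction I rule: infinite_finite_induct) (auto simp: fun_simps)

text \<open>The \<open>j\<close>-th power of the maximal ideal of \<open>e\<close> in
  \<open>R\<close>: sums of products of \<open>j\<close> functions vanishing at \<open>e\<close>
  with one arbitrary element of \<open>R\<close>.\<close>

inductive mpow :: "('g \<Rightarrow> 'k::field) set \<Rightarrow> 'g \<Rightarrow> nat \<Rightarrow> ('g \<Rightarrow> 'k) \<Rightarrow> bool" for R e where
  base: "r \<in> R \<Longrightarrow> mpow R e 0 r"
| step: "a \<in> R \<Longrightarrow> a e = 0 \<Longrightarrow> mpow R e j r \<Longrightarrow> mpow R e (Suc j) (a * r)"
| add: "mpow R e j r \<Longrightarrow> mpow R e j s \<Longrightarrow> mpow R e j (r + s)"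

text \<open>What the algebraic argument uses of an affine group: a ring of functions, extended by
  zero, with comultiplication; generators of the maximal ideal at the identity; points as algebra
  homomorphisms; Krull's theorem at the identity; connectedness in terms of principal open sets;
  triviality of characters. Topology and varieties enter only where these properties are
  verified.\<close>

locale affine_group_algebra = group G for G (structure) +
  fixes R :: "('a \<Rightarrow> 'k::{alg_closed_field, field_char_0}) set" and gen :: "nat \<Rightarrow> 'a \<Rightarrow> 'k" and n :: nat
  assumes R_outside: "r \<in> R \<Longrightarrow> g \<notin> carrier G \<Longrightarrow> r g = 0"
    and R_const: "(\<lambda>g. if g \<in> carrier G then c else 0) \<in> R"
    and R_add: "r \<in> R \<Longrightarrow> s \<in> R \<Longrightarrow> r + s \<in> R"
    and R_mult: "r \<in> R \<Longrightarrow> s \<in> R \<Longrightarrow> r * s \<in> R"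
    and R_comult: "r \<in> R \<Longrightarrow> \<exists>(m::nat) a b. (\<forall>i<m. a i \<in> R \<and> b i \<in> R) \<and>
      (\<forall>g\<in>carrier G. \<forall>h\<in>carrier G. r (g \<otimes> h) = (\<Sum>i<m. a i g * b i h))"
    and gen_R: "i < n \<Longrightarrow> gen i \<in> R" "i < n \<Longrightarrow> gen i \<one> = 0"
    and R_gen: "r \<in> R \<Longrightarrow> \<exists>q. (\<forall>i<n. q i \<in> R) \<and>
      (\<forall>g\<in>carrier G. r g = r \<one> + (\<Sum>i<n. q i g * gen i g))"
    and R_points: "(\<And>c. \<theta> (\<lambda>g. if g \<in> carrier G then c else 0) = c) \<Longrightarrow>
      (\<And>r s. r \<in> R \<Longrightarrow> s \<in> R \<Longrightarrow> \<theta> (r + s) = \<theta> r + \<theta> s) \<Longrightarrow>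
      (\<And>r s. r \<in> R \<Longrightarrow> s \<in> R \<Longrightarrow> \<theta> (r * s) = \<theta> r * \<theta> s) \<Longrightarrow> \<exists>g\<in>carrier G. \<forall>r\<in>R. r g = \<theta> r"
    and R_separates: "g \<in> carrier G \<Longrightarrow> h \<in> carrier G \<Longrightarrow> (\<And>r. r \<in> R \<Longrightarrow> r g = r h) \<Longrightarrow> g = h"
    and R_krull: "(\<And>j. mpow R \<one> j \<eta>) \<Longrightarrow>
      \<exists>c\<in>R. c \<one> \<noteq> 0 \<and> (\<forall>g\<in>carrier G. c g \<noteq> 0 \<longrightarrow> \<eta> g = 0)"
    and R_connected: "Z \<subseteq> carrier G \<Longrightarrow>
      (\<And>g. g \<in> Z \<Longrightarrow> \<exists>c\<in>R. c g \<noteq> 0 \<and> (\<forall>h\<in>carrier G. c h \<noteq> 0 \<longrightarrow> h \<in> Z)) \<Longrightarrow>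
      (\<And>g. g \<in> carrier G - Z \<Longrightarrow> \<exists>c\<in>R. c g \<noteq> 0 \<and> (\<forall>h\<in>carrier G. c h \<noteq> 0 \<longrightarrow> h \<notin> Z)) \<Longrightarrow>
      Z = {} \<or> Z = carrier G"
    and R_characters: "\<psi> \<in> R \<Longrightarrow> \<psi> \<one> = 1 \<Longrightarrow>
      (\<And>g h. g \<in> carrier G \<Longrightarrow> h \<in> carrier G \<Longrightarrow> \<psi> (g \<otimes> h) = \<psi> g * \<psi> h) \<Longrightarrow> g \<in> carrier G \<Longrightarrow> \<psi> g = 1"
begin

section \<open>Constants and translations\<close>

definition cst :: "'k \<Rightarrow> 'a \<Rightarrow> 'k" where
  "cst c = (\<lambda>g. if g \<in> carrier G then c else 0)"

definition rho :: "'a \<Rightarrow> ('a \<Rightarrow> 'k) \<Rightarrow> 'a \<Rightarrow> 'k" where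
  "rho h r = (\<lambda>g. if g \<in> carrier G then r (g \<otimes> h) else 0)"

definition lam :: "'a \<Rightarrow> ('a \<Rightarrow> 'k) \<Rightarrow> 'a \<Rightarrow> 'k" where
  "lam h r = (\<lambda>g. if g \<in> carrier G then r (h \<otimes> g) else 0)"

lemma cst_R [simp]: "cst c \<in> R" unfolding cst_def by (rule R_const)

lemma R_eqI: "r \<in> R \<Longrightarrow> s \<in> R \<Longrightarrow> (\<And>g. g \<in> carrier G \<Longrightarrow> r g = s g) \<Longrightarrow> r = s"
  using R_outside by (metis ext)

lemma fscale_eq_cst: "r \<in> R \<Longrightarrow> fscale c r = cst c * r"
  by (auto simp: fun_eq_iff fun_simps cst_def R_outside)

lemma R_scale: "r \<in> R \<Longrightarrow> fscale c r \<in> R"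
  by (simp add: fscale_eq_cst R_mult)

lemma R_zero: "0 \<in> R"
  using cst_R[of 0] by (simp add: cst_def zero_fun_def)

lemma R_subspace: "F.subspace R"
  by (rule F.subspaceI) (auto intro: R_zero R_add R_scale)

lemma R_diff: "r \<in> R \<Longrightarrow> s \<in> R \<Longrightarrow> r - s \<in> R"
  using F.subspace_diff[OF R_subspace] .

lemma R_sum: "(\<And>i. i \<in> I \<Longrightarrow> f i \<in> R) \<Longrightarrow> (\<Sum>i\<in>I. f i) \<in> R"
  using F.subspace_sum[OF R_subspace] .

lemma cst_mult_1: "r \<in> R \<Longrightarrow> r * cst 1 = r"
  by (auto simp: fun_eq_iff fun_simps cst_def R_outside)

lemma cst_eq_0 [simp]: "cst 0 = 0" by (simp add: cst_def zero_fun_def)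

lemma fscale_cst: "fscale c (cst d) = cst (c * d)"
  by (auto simp: fun_eq_iff fun_simps cst_def)

lemma cst_add: "cst c + cst d = cst (c + d)"
  by (auto simp: fun_eq_iff fun_simps cst_def)

lemma cst_apply: "g \<in> carrier G \<Longrightarrow> cst c g = c" by (simp add: cst_def)

text \<open>All translates of \<open>r\<close> lie in the span of finitely many functions, with
  coefficients that are regular in \<open>g\<close>. The local finiteness of the Lie algebra rests
  on this.\<close>

lemma comult_expansion:
  assumes "r \<in> R"
  obtains m :: nat and a b where "\<And>i. i < m \<Longrightarrow> a i \<in> R" "\<And>i. i < m \<Longrightarrow> b i \<in> R"
    "\<And>g. g \<in> carrier G \<Longrightarrow> rho g r = (\<Sum>i<m. fscale (b i g) (a i))"
    "\<And>g. g \<in> carrier G \<Longrightarrow> lam g r = (\<Sum>i<m. fscale (a i g) (b i))"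
proof -
  obtain m :: nat and a b where ab: "\<forall>i<m. a i \<in> R \<and> b i \<in> R"
    "\<forall>g\<in>carrier G. \<forall>h\<in>carrier G. r (g \<otimes> h) = (\<Sum>i<m. a i g * b i h)"
    using R_comult[OF assms] by blast
  show thesis
  proof (rule that[of m a b])
    fix g assume g: "g \<in> carrier G"
    show "rho g r = (\<Sum>i<m. fscale (b i g) (a i))"
      using ab g by (auto simp: fun_eq_iff fun_simps rho_def sum_fun_apply R_outside mult.commute intro!: sum.cong)
    show "lam g r = (\<Sum>i<m. fscale (a i g) (b i))"
      using ab g by (auto simp: fun_eq_iff fun_simps lam_def sum_fun_apply fun_simps R_outside)
  qed (use ab in auto)
qed

lemma rho_R: "r \<in> R \<Longrightarrow> g \<in> carrier G \<Longrightarrow> rho g r \<in> R"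
  by (rule comult_expansion[of r]) (auto intro!: R_sum R_scale)

lemma lam_R: "r \<in> R \<Longrightarrow> g \<in> carrier G \<Longrightarrow> lam g r \<in> R"
  by (rule comult_expansion[of r]) (auto intro!: R_sum R_scale)

lemma rho_simps:
  "rho h (r + s) = rho h r + rho h s" "rho h (r - s) = rho h r - rho h s"
  "rho h (r * s) = rho h r * rho h s" "rho h (fscale c r) = fscale c (rho h r)"
  "h \<in> carrier G \<Longrightarrow> rho h (cst c) = cst c" "rho h 0 = 0"
  "g \<in> carrier G \<Longrightarrow> h \<in> carrier G \<Longrightarrow> rho g (rho h r) = rho (g \<otimes> h) r"
  "r \<in> R \<Longrightarrow> rho \<one> r = r"
  by (auto simp: rho_def cst_def fun_eq_iff fun_simps m_assoc R_outside)

lemma lam_simps: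
  "lam h (r + s) = lam h r + lam h s" "lam h (r - s) = lam h r - lam h s"
  "lam h (r * s) = lam h r * lam h s" "lam h (fscale c r) = fscale c (lam h r)"
  "h \<in> carrier G \<Longrightarrow> lam h (cst c) = cst c" "lam h 0 = 0"
  "g \<in> carrier G \<Longrightarrow> h \<in> carrier G \<Longrightarrow> lam g (lam h r) = lam (h \<otimes> g) r"
  "r \<in> R \<Longrightarrow> lam \<one> r = r"
  "g \<in> carrier G \<Longrightarrow> h \<in> carrier G \<Longrightarrow> lam g (rho h r) = rho h (lam g r)"
  by (auto simp: lam_def rho_def cst_def fun_eq_iff fun_simps m_assoc R_outside)

lemma rho_apply: "g \<in> carrier G \<Longrightarrow> rho h r g = r (g \<otimes> h)" by (simp add: rho_def)

text \<open>The Lie algebra, realised as the derivations commuting with right translations; elements are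
  extended by zero outside \<open>R\<close>.\<close>

definition Lie :: "(('a \<Rightarrow> 'k) \<Rightarrow> 'a \<Rightarrow> 'k) set" where
  "Lie = {D. (\<forall>r. r \<notin> R \<longrightarrow> D r = 0) \<and> (\<forall>r\<in>R. D r \<in> R) \<and> (\<forall>r\<in>R. \<forall>s\<in>R. D (r + s) = D r + D s) \<and>
     (\<forall>r\<in>R. \<forall>s\<in>R. D (r * s) = D r * s + r * D s) \<and> (\<forall>c. D (cst c) = 0) \<and>
     (\<forall>h\<in>carrier G. \<forall>r\<in>R. D (rho h r) = rho h (D r))}"

lemma LieD:
  assumes "D \<in> Lie"
  shows "r \<notin> R \<Longrightarrow> D r = 0" "r \<in> R \<Longrightarrow> D r \<in> R" "r \<in> R \<Longrightarrow> s \<in> R \<Longrightarrow> D (r + s) = D r + D s"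
    "r \<in> R \<Longrightarrow> s \<in> R \<Longrightarrow> D (r * s) = D r * s + r * D s" "D (cst c) = 0"
    "h \<in> carrier G \<Longrightarrow> r \<in> R \<Longrightarrow> D (rho h r) = rho h (D r)"
    "r \<in> R \<Longrightarrow> D (fscale c r) = fscale c (D r)"
proof -
  show 1: "r \<notin> R \<Longrightarrow> D r = 0" "r \<in> R \<Longrightarrow> D r \<in> R" "r \<in> R \<Longrightarrow> s \<in> R \<Longrightarrow> D (r + s) = D r + D s"
    "r \<in> R \<Longrightarrow> s \<in> R \<Longrightarrow> D (r * s) = D r * s + r * D s" "D (cst c) = 0"
    "h \<in> carrier G \<Longrightarrow> r \<in> R \<Longrightarrow> D (rho h r) = rho h (D r)" for r s c h
    using assms unfolding Lie_def by auto
  show "D (fscale c r) = fscale c (D r)" if "r \<in> R"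
    using that by (simp add: fscale_eq_cst 1(2,4,5))
qed

lemma Lie_lin: "D \<in> Lie \<Longrightarrow> F.lin_on R D"
  unfolding F.lin_on_def using LieD R_subspace by auto

lemma Lie_sum: "D \<in> Lie \<Longrightarrow> (\<And>i. i \<in> I \<Longrightarrow> f i \<in> R) \<Longrightarrow> D (\<Sum>i\<in>I. f i) = (\<Sum>i\<in>I. D (f i))"
  by (rule F.lin_on_sum[OF Lie_lin])

lemma Lie_zero: "D \<in> Lie \<Longrightarrow> D 0 = 0"
  using LieD(5)[of D 0] by simp

lemma Lie_subspace: "O.subspace Lie"
proof (rule O.subspaceI)
  show "0 \<in> Lie" unfolding Lie_def by (auto simp: op_simps R_zero rho_simps)
  fix D E assume D: "D \<in> Lie"
  show "oscale c D \<in> Lie" for c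
    unfolding Lie_def oscale_fscale using LieD[OF D]
    by (auto simp: rho_simps R_scale R_zero fun_eq_iff fun_simps algebra_simps)
  assume E: "E \<in> Lie"
  show "D + E \<in> Lie"
    unfolding Lie_def using LieD[OF D] LieD[OF E] by (auto simp: op_simps rho_simps R_add algebra_simps)
qed

lemma Lie_funpow:
  assumes "D \<in> Lie"
  shows "r \<in> R \<Longrightarrow> (D ^^ j) r \<in> R" "r \<in> R \<Longrightarrow> s \<in> R \<Longrightarrow> (D ^^ j) (r + s) = (D ^^ j) r + (D ^^ j) s"
    "h \<in> carrier G \<Longrightarrow> r \<in> R \<Longrightarrow> (D ^^ j) (rho h r) = rho h ((D ^^ j) r)"
    "r \<in> R \<Longrightarrow> (D ^^ j) (fscale c r) = fscale c ((D ^^ j) r)"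
    "(\<And>i. i \<in> I \<Longrightarrow> f i \<in> R) \<Longrightarrow> (D ^^ j) (\<Sum>i\<in>I. f i) = (\<Sum>i\<in>I. (D ^^ j) (f i))"
proof -
  note lin = F.lin_on_funpow[OF Lie_lin[OF assms], of j]
  show R: "(D ^^ j) r \<in> R" if "r \<in> R" for j r
    using that by (induction j) (auto intro: LieD(2)[OF assms])
  show "(D ^^ j) (r + s) = (D ^^ j) r + (D ^^ j) s" if "r \<in> R" "s \<in> R"
    using F.lin_onD(3)[OF lin that] .
  show "(D ^^ j) (fscale c r) = fscale c ((D ^^ j) r)" if "r \<in> R"
    using F.lin_onD(4)[OF lin that] .
  show "(D ^^ j) (rho h r) = rho h ((D ^^ j) r)" if "h \<in> carrier G" "r \<in> R"
    using that by (induction j) (auto simp: R LieD(6)[OF assms])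
  show "(D ^^ j) (\<Sum>i\<in>I. f i) = (\<Sum>i\<in>I. (D ^^ j) (f i))" if "\<And>i. i \<in> I \<Longrightarrow> f i \<in> R"
    using F.lin_on_sum[OF lin that] .
qed

text \<open>Commuting with right translations moves the point of evaluation to the identity, so an
  element of \<open>Lie\<close> is determined by a tangent vector there.\<close>

lemma Lie_at_one:
  assumes "D \<in> Lie" "r \<in> R" "g \<in> carrier G"
  shows "(D ^^ j) r g = (D ^^ j) (rho g r) \<one>"
  using assms by (simp add: Lie_funpow(3) rho_apply)

lemma Lie_at_one': "D \<in> Lie \<Longrightarrow> r \<in> R \<Longrightarrow> g \<in> carrier G \<Longrightarrow> D r g = D (rho g r) \<one>"
  using Lie_at_one[of D r g 1] by simp

text \<open>By the expansion of translates, \<open>(D ^^ i) r\<close> is determined by the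
  \<open>m\<close> numbers \<open>((D ^^ i) (a j)) \<one>\<close>, so the first \<open>m + 1\<close>
  iterates are dependent.\<close>

lemma Lie_locally_finite:
  assumes D: "D \<in> Lie" and r: "r \<in> R"
  shows "\<exists>d c. (\<exists>i\<le>d. c i \<noteq> 0) \<and> (\<Sum>i\<le>d. fscale (c i) ((D ^^ i) r)) = 0"
proof -
  obtain m :: nat and a b where ab: "\<And>i. i < m \<Longrightarrow> a i \<in> R" "\<And>i. i < m \<Longrightarrow> b i \<in> R"
    "\<And>g. g \<in> carrier G \<Longrightarrow> rho g r = (\<Sum>i<m. fscale (b i g) (a i))"
    by (rule comult_expansion[OF r]) (rule that)
  obtain c where c: "\<exists>i\<le>m. c i \<noteq> 0" "\<forall>j<m. (\<Sum>i\<le>m. c i * ((D ^^ i) (a j)) \<one>) = 0"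
    using linear_relation_exists[of m "\<lambda>i j. ((D ^^ i) (a j)) \<one>"] by blast
  have "(\<Sum>i\<le>m. fscale (c i) ((D ^^ i) r)) = 0"
  proof (rule R_eqI)
    fix g assume g: "g \<in> carrier G"
    have "(D ^^ i) r g = (\<Sum>j<m. b j g * (D ^^ i) (a j) \<one>)" for i
      unfolding Lie_at_one[OF D r g] ab(3)[OF g]
      using ab by (subst Lie_funpow(5)[OF D]) (auto simp: sum_fun_apply fun_simps Lie_funpow(4)[OF D] R_scale intro!: sum.cong)
    then have "(\<Sum>i\<le>m. fscale (c i) ((D ^^ i) r)) g = (\<Sum>i\<le>m. \<Sum>j<m. b j g * (c i * (D ^^ i) (a j) \<one>))"
      by (simp add: sum_fun_apply fun_simps sum_distrib_left mult.left_commute)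
    also have "\<dots> = (\<Sum>j<m. b j g * (\<Sum>i\<le>m. c i * (D ^^ i) (a j) \<one>))"
      by (subst sum.swap) (simp add: sum_distrib_left)
    also have "\<dots> = 0" using c(2) by simp
    finally show "(\<Sum>i\<le>m. fscale (c i) ((D ^^ i) r)) g = 0 g" by (simp add: fun_simps)
  qed (auto intro!: R_sum R_scale R_zero Lie_funpow(1)[OF D] r)
  with c(1) show ?thesis by blast
qed

lemma F_decomposition:
  assumes D: "D \<in> Lie" and S: "F.lin_on S D" "S \<subseteq> R" and v: "v \<in> S"
  shows "\<exists>A w. finite A \<and> (\<forall>a\<in>A. w a \<in> F.gen_eigenspace S D a) \<and> v = (\<Sum>a\<in>A. w a)"
proof -
  have "v \<in> R" using S(2) v by blast
  from Lie_locally_finite[OF D this] obtain d c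
    where "\<exists>i\<le>d. c i \<noteq> 0" "(\<Sum>i\<le>d. fscale (c i) ((D ^^ i) v)) = 0" by blast
  from F.relation_imp_poly_op[OF this] obtain p where "p \<noteq> 0" "F.poly_op D p v = 0" by blast
  from F.gen_eigenspace_decomposition[OF alg_closed_imp_poly_has_root S(1) v this]
  show ?thesis .
qed

section \<open>Nilpotent parts in the additive Jordan decomposition\<close>

abbreviation E :: "(('a \<Rightarrow> 'k) \<Rightarrow> 'a \<Rightarrow> 'k) \<Rightarrow> 'k \<Rightarrow> ('a \<Rightarrow> 'k) set" where
  "E D a \<equiv> F.gen_eigenspace R D a"

definition locally_nilpotent :: "(('a \<Rightarrow> 'k) \<Rightarrow> 'a \<Rightarrow> 'k) \<Rightarrow> bool" where
  "locally_nilpotent D \<longleftrightarrow> (\<forall>r\<in>R. \<exists>N. (D ^^ N) r = 0)"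

lemma E_R: "w \<in> E D a \<Longrightarrow> w \<in> R" unfolding F.gen_eigenspace_def by blast

lemma nilpotent_subspace:
  assumes "D \<in> Lie"
  shows "F.subspace {r \<in> R. \<exists>N. (D ^^ N) r = 0}"
  using F.subspace_gen_eigenspace[OF Lie_lin[OF assms], of 0] unfolding F.gen_eigenspace_def by simp

text \<open>The generalized eigenspaces of any one \<open>T\<close> span \<open>R\<close>, so
  nilpotency can be tested on them.\<close>

lemma locally_nilpotentI:
  assumes D: "D \<in> Lie" and T: "T \<in> Lie" and "\<And>a w. w \<in> E T a \<Longrightarrow> \<exists>N. (D ^^ N) w = 0"
  shows "locally_nilpotent D"
  unfolding locally_nilpotent_def
proof
  fix r assume "r \<in> R"
  then obtain A w where A: "\<forall>a\<in>A. w a \<in> E T a" "r = (\<Sum>a\<in>A. w a)"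
    using F_decomposition[OF T Lie_lin[OF T]] by blast
  have "r \<in> {r \<in> R. \<exists>N. (D ^^ N) r = 0}"
    unfolding A(2) using A(1) assms(3) E_R by (intro F.subspace_sum[OF nilpotent_subspace[OF D]]) blast
  then show "\<exists>N. (D ^^ N) r = 0" by blast
qed

text \<open>The graph of the nilpotent part in the additive Jordan decomposition of \<open>D\<close>.\<close>

inductive nil_graph :: "(('a \<Rightarrow> 'k) \<Rightarrow> 'a \<Rightarrow> 'k) \<Rightarrow> ('a \<Rightarrow> 'k) \<Rightarrow> ('a \<Rightarrow> 'k) \<Rightarrow> bool" for D where
  base: "w \<in> E D a \<Longrightarrow> nil_graph D w (D w - fscale a w)"
| add: "nil_graph D r s \<Longrightarrow> nil_graph D r' s' \<Longrightarrow> nil_graph D (r + r') (s + s')"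

lemma nil_graph_R:
  assumes "D \<in> Lie" "nil_graph D r s"
  shows "r \<in> R \<and> s \<in> R"
  using assms(2) by induction (auto simp: E_R LieD[OF assms(1)] R_diff R_scale R_add)

lemma nil_graph_scale:
  assumes D: "D \<in> Lie" and "nil_graph D r s"
  shows "nil_graph D (fscale c r) (fscale c s)"
  using assms(2)
proof induction
  case (base w a)
  have "fscale c w \<in> E D a" by (rule F.subspace_scale[OF F.subspace_gen_eigenspace[OF Lie_lin[OF D]] base])
  from nil_graph.base[OF this] show ?case
    by (simp add: LieD(7)[OF D E_R[OF base]] F.scale_right_diff_distrib mult.commute)
qed (auto simp: F.scale_right_distrib intro: nil_graph.add)

text \<open>Terms with the same eigenvalue are collected. The components are total functions of the
  eigenvalue, zero outside \<open>A\<close>, so that two decompositions can be added over the union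
  of their index sets.\<close>

lemma nil_graph_sum_form:
  assumes D: "D \<in> Lie" and "nil_graph D r s"
  shows "\<exists>A w. finite A \<and> (\<forall>a. w a \<in> E D a) \<and> (\<forall>a. a \<notin> A \<longrightarrow> w a = 0) \<and>
    r = (\<Sum>a\<in>A. w a) \<and> s = (\<Sum>a\<in>A. D (w a) - fscale a (w a))"
  using assms(2)
proof induction
  case (base w a)
  have "0 \<in> E D b" for b by (rule F.subspace_0[OF F.subspace_gen_eigenspace[OF Lie_lin[OF D]]])
  with base show ?case
    by (intro exI[of _ "{a}"] exI[of _ "\<lambda>b. if b = a then w else 0"]) auto
next
  case (add r s r' s')
  from add.IH(1) obtain A w where A: "finite A" "\<And>a. w a \<in> E D a" "\<And>a. a \<notin> A \<Longrightarrow> w a = 0"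
    "r = (\<Sum>a\<in>A. w a)" "s = (\<Sum>a\<in>A. D (w a) - fscale a (w a))" by (elim exE conjE) blast
  from add.IH(2) obtain A' w' where A': "finite A'" "\<And>a. w' a \<in> E D a" "\<And>a. a \<notin> A' \<Longrightarrow> w' a = 0"
    "r' = (\<Sum>a\<in>A'. w' a)" "s' = (\<Sum>a\<in>A'. D (w' a) - fscale a (w' a))" by (elim exE conjE) blast
  have ext: "(\<Sum>a\<in>A. w a) = (\<Sum>a\<in>A \<union> A'. w a)" "(\<Sum>a\<in>A'. w' a) = (\<Sum>a\<in>A \<union> A'. w' a)"
    "(\<Sum>a\<in>A. D (w a) - fscale a (w a)) = (\<Sum>a\<in>A \<union> A'. D (w a) - fscale a (w a))"
    "(\<Sum>a\<in>A'. D (w' a) - fscale a (w' a)) = (\<Sum>a\<in>A \<union> A'. D (w' a) - fscale a (w' a))"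
    using A(1,3) A'(1,3) by (auto intro!: sum.mono_neutral_left simp: Lie_zero[OF D])
  show ?case
  proof (intro exI conjI allI impI)
    show "finite (A \<union> A')" using A A' by simp
    show "w a + w' a \<in> E D a" for a
      using A A' by (intro F.subspace_add[OF F.subspace_gen_eigenspace[OF Lie_lin[OF D]]])
    show "w a + w' a = 0" if "a \<notin> A \<union> A'" for a using A A' that by simp
    show "r + r' = (\<Sum>a\<in>A \<union> A'. w a + w' a)"
      unfolding A(4) A'(4) ext by (simp add: sum.distrib)
    show "s + s' = (\<Sum>a\<in>A \<union> A'. D (w a + w' a) - fscale a (w a + w' a))"
      unfolding A(5) A'(5) ext sum.distrib[symmetric]
      by (intro sum.cong refl) (simp add: LieD(3)[OF D E_R[OF A(2)] E_R[OF A'(2)]] F.scale_right_distrib)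
  qed
qed

text \<open>The difference of two representations represents the zero function, and its components
  vanish by independence of generalized eigenspaces.\<close>

lemma nil_graph_unique:
  assumes D: "D \<in> Lie" and "nil_graph D r s" "nil_graph D r s'"
  shows "s = s'"
proof -
  have "nil_graph D (r + fscale (-1) r) (s + fscale (-1) s')"
    using assms by (intro nil_graph.add nil_graph_scale)
  moreover have "r + fscale (-1) r = 0" "s + fscale (-1) s' = s - s'" by (auto simp: fun_eq_iff fun_simps)
  ultimately have "nil_graph D 0 (s - s')" by simp
  from nil_graph_sum_form[OF D this] obtain A w where A: "finite A" "\<And>a. w a \<in> E D a"
    "(\<Sum>a\<in>A. w a) = 0" "s - s' = (\<Sum>a\<in>A. D (w a) - fscale a (w a))"
    by (elim exE conjE) (rule that, simp_all)
  have "\<forall>a\<in>A. w a = 0" by (rule F.gen_eigenspace_independent[OF Lie_lin[OF D] A(1) A(2) A(3)])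
  then have "s - s' = 0" unfolding A(4) by (intro sum.neutral) (simp add: Lie_zero[OF D])
  then show ?thesis by simp
qed

lemma nil_graph_total:
  assumes D: "D \<in> Lie" and "r \<in> R"
  shows "\<exists>s. nil_graph D r s"
proof -
  obtain A w where A: "finite A" "\<forall>a\<in>A. w a \<in> E D a" "r = (\<Sum>a\<in>A. w a)"
    using F_decomposition[OF D Lie_lin[OF D] _ assms(2)] by blast
  have "\<exists>s. nil_graph D (\<Sum>a\<in>A. w a) s"
    using A(1,2)
  proof (induction A)
    case empty
    have "nil_graph D 0 (D 0 - fscale 0 0)"
      by (intro nil_graph.base F.subspace_0[OF F.subspace_gen_eigenspace[OF Lie_lin[OF D]]])
    then show ?case by auto
  next
    case (insert x A)
    then obtain s where s: "nil_graph D (\<Sum>a\<in>A. w a) s" by auto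
    have "nil_graph D (w x) (D (w x) - fscale x (w x))" using insert by (intro nil_graph.base) auto
    from nil_graph.add[OF this s] show ?case using insert by auto
  qed
  then show ?thesis unfolding A(3) .
qed

text \<open>The Leibniz rule survives the shift: on a product, \<open>D - (a + b)\<close> acts as
  \<open>D - a\<close> on the first factor plus \<open>D - b\<close> on the second.\<close>

lemma E_mult:
  assumes D: "D \<in> Lie" and u: "u \<in> E D a" and v: "v \<in> E D b"
  shows "u * v \<in> E D (a + b)"
proof -
  obtain m k where mk: "(F.shifted D a ^^ m) u = 0" "(F.shifted D b ^^ k) v = 0"
    using u v unfolding F.gen_eigenspace_def by blast
  have shifted_R: "F.shifted D c w \<in> R" if "w \<in> R" for c w
    by (rule F.lin_onD(2)[OF F.lin_on_shifted[OF Lie_lin[OF D]] that])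
  have "(F.shifted D (a + b) ^^ (m + k)) (u * v) = 0"
  proof (rule leibniz_nilpotent[where U=R and V=R and W=R and T\<^sub>1="F.shifted D a" and T\<^sub>2="F.shifted D b"
          and z\<^sub>1=0 and z\<^sub>2=0 and B="(*)", OF _ shifted_R shifted_R shifted_R R_mult _ _ _ _ E_R[OF u] E_R[OF v] mk])
    show "F.shifted D (a + b) (r * s) = F.shifted D a r * s + r * F.shifted D b s" if "r \<in> R" "s \<in> R" for r s
      using that by (simp add: LieD(4)[OF D] fun_eq_iff fun_simps algebra_simps)
    show "F.shifted D (a + b) (r + s) = F.shifted D (a + b) r + F.shifted D (a + b) s" if "r \<in> R" "s \<in> R" for r s
      by (rule F.lin_onD(3)[OF F.lin_on_shifted[OF Lie_lin[OF D]] that])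
    show "F.shifted D (a + b) 0 = 0" by (simp add: Lie_zero[OF D])
  qed auto
  then show ?thesis unfolding F.gen_eigenspace_def using R_mult[OF E_R[OF u] E_R[OF v]] by blast
qed

text \<open>Because eigenvalues add under multiplication, the semisimple part, which multiplies by
  the eigenvalue, is a derivation; so is its difference from \<open>D\<close>.\<close>

lemma nil_graph_mult:
  assumes D: "D \<in> Lie" and "nil_graph D r s" "nil_graph D r' s'"
  shows "nil_graph D (r * r') (s * r' + r * s')"
  using assms(2)
proof induction
  case (base u a)
  show ?case using assms(3)
  proof induction
    case (base v b)
    have "nil_graph D (u * v) (D (u * v) - fscale (a + b) (u * v))"
      by (rule nil_graph.base[OF E_mult[OF D \<open>u \<in> E D a\<close> \<open>v \<in> E D b\<close>]])
    also have "D (u * v) - fscale (a + b) (u * v) = (D u - fscale a u) * v + u * (D v - fscale b v)"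
      using base.hyps \<open>u \<in> E D a\<close> by (auto simp: LieD(4)[OF D] E_R fun_eq_iff fun_simps algebra_simps)
    finally show ?case .
  next
    case (add r s r' s')
    from nil_graph.add[OF add.IH] show ?case by (simp add: algebra_simps)
  qed
next
  case (add r s r'' s'')
  from nil_graph.add[OF add.IH] show ?case by (simp add: algebra_simps)
qed

lemma E_rho:
  assumes D: "D \<in> Lie" and h: "h \<in> carrier G" and u: "u \<in> E D a"
  shows "rho h u \<in> E D a"
proof -
  have 1: "(F.shifted D a ^^ m) (rho h r) = rho h ((F.shifted D a ^^ m) r) \<and> (F.shifted D a ^^ m) r \<in> R"
    if "r \<in> R" for m r
    using that by (induction m) (auto simp: rho_simps LieD[OF D] h R_diff R_scale)
  obtain m where "(F.shifted D a ^^ m) u = 0" using u unfolding F.gen_eigenspace_def by blast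
  then show ?thesis using 1[OF E_R[OF u]] rho_R[OF E_R[OF u] h]
    unfolding F.gen_eigenspace_def by (auto simp: rho_simps intro!: exI[of _ m])
qed

lemma nil_graph_rho:
  assumes D: "D \<in> Lie" and h: "h \<in> carrier G" and "nil_graph D r s"
  shows "nil_graph D (rho h r) (rho h s)"
  using assms(3)
proof induction
  case (base u a)
  from nil_graph.base[OF E_rho[OF D h base]] show ?case
    by (simp add: rho_simps LieD(6)[OF D h E_R[OF base]])
qed (auto simp: rho_simps intro: nil_graph.add)

definition nil_part :: "(('a \<Rightarrow> 'k) \<Rightarrow> 'a \<Rightarrow> 'k) \<Rightarrow> ('a \<Rightarrow> 'k) \<Rightarrow> 'a \<Rightarrow> 'k" where
  "nil_part D r = (if r \<in> R then THE s. nil_graph D r s else 0)"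

lemma nil_part_eq:
  assumes "D \<in> Lie" "nil_graph D r s"
  shows "nil_part D r = s"
proof -
  have "(THE s. nil_graph D r s) = s"
    using assms(2) nil_graph_unique[OF assms(1) _ assms(2)] by (rule the_equality)
  then show ?thesis using nil_graph_R[OF assms] by (simp add: nil_part_def)
qed

lemma nil_part_graph: "D \<in> Lie \<Longrightarrow> r \<in> R \<Longrightarrow> nil_graph D r (nil_part D r)"
  using nil_graph_total nil_part_eq by metis

lemma nil_part_E: "D \<in> Lie \<Longrightarrow> w \<in> E D a \<Longrightarrow> nil_part D w = D w - fscale a w"
  by (rule nil_part_eq) (auto intro: nil_graph.base)

lemma nil_part_Lie:
  assumes D: "D \<in> Lie"
  shows "nil_part D \<in> Lie"
  unfolding Lie_def
proof (intro CollectI conjI allI ballI impI)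
  show "nil_part D r = 0" if "r \<notin> R" for r using that by (simp add: nil_part_def)
  show "nil_part D r \<in> R" if "r \<in> R" for r using nil_graph_R[OF D nil_part_graph[OF D that]] by blast
  show "nil_part D (r + s) = nil_part D r + nil_part D s" if "r \<in> R" "s \<in> R" for r s
    using that by (intro nil_part_eq[OF D] nil_graph.add nil_part_graph[OF D])
  show "nil_part D (r * s) = nil_part D r * s + r * nil_part D s" if "r \<in> R" "s \<in> R" for r s
    using that by (intro nil_part_eq[OF D] nil_graph_mult[OF D] nil_part_graph[OF D])
  show "nil_part D (rho h r) = rho h (nil_part D r)" if "h \<in> carrier G" "r \<in> R" for h r
    using that by (intro nil_part_eq[OF D] nil_graph_rho[OF D] nil_part_graph[OF D])
  have "cst c \<in> E D 0" for c
    unfolding F.gen_eigenspace_def by (auto simp: LieD[OF D] intro!: exI[of _ 1])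
  then show "nil_part D (cst c) = 0" for c
    using nil_part_E[OF D, of "cst c" 0] by (simp add: LieD[OF D])
qed

lemma nil_part_locally_nilpotent:
  assumes D: "D \<in> Lie"
  shows "locally_nilpotent (nil_part D)"
proof (rule locally_nilpotentI[OF nil_part_Lie[OF D] D])
  fix a w assume w: "w \<in> E D a"
  have "(nil_part D ^^ m) w = (F.shifted D a ^^ m) w" for m
  proof (induction m)
    case (Suc m)
    then show ?case
      using nil_part_E[OF D F.gen_eigenspace_funpow[OF Lie_lin[OF D] w, where b=a and k=m]] by simp
  qed simp
  then show "\<exists>N. (nil_part D ^^ N) w = 0" using w unfolding F.gen_eigenspace_def by simp
qed

end

section \<open>Functions killed by all locally nilpotent derivations\<close>

context affine_group_algebra
begin

definition nil_invariants :: "('a \<Rightarrow> 'k) set" where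
  "nil_invariants = {r \<in> R. \<forall>D\<in>Lie. locally_nilpotent D \<longrightarrow> D r = 0}"

lemma nil_invariants_R: "r \<in> nil_invariants \<Longrightarrow> r \<in> R" unfolding nil_invariants_def by blast

lemma V0D: "r \<in> nil_invariants \<Longrightarrow> D \<in> Lie \<Longrightarrow> locally_nilpotent D \<Longrightarrow> D r = 0" unfolding nil_invariants_def by blast

lemma nil_invariants_subspace: "F.subspace nil_invariants"
  by (rule F.subspaceI) (auto simp: nil_invariants_def R_zero R_add R_scale LieD(3,7) Lie_zero)

text \<open>Conjugation by a left translation preserves \<open>Lie\<close>, since left and right
  translations commute, and it preserves local nilpotency.\<close>

lemma nil_invariants_lam:
  assumes v: "v \<in> nil_invariants" and h: "h \<in> carrier G"
  shows "lam h v \<in> nil_invariants"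
  unfolding nil_invariants_def
proof (intro CollectI conjI ballI impI)
  show "lam h v \<in> R" using lam_R[OF nil_invariants_R[OF v] h] .
  fix D assume D: "D \<in> Lie" and nil: "locally_nilpotent D"
  define D' where "D' r = (if r \<in> R then lam (inv h) (D (lam h r)) else 0)" for r
  have hi: "inv h \<in> carrier G" using h by simp
  have cancel: "lam h (lam (inv h) r) = r" "lam (inv h) (lam h r) = r" if "r \<in> R" for r
    using that h by (simp_all add: lam_simps)
  have "D' \<in> Lie"
    unfolding Lie_def D'_def
    using h hi LieD[OF D]
    by (auto simp: lam_R lam_simps rho_R R_add R_mult R_zero cancel)
  moreover have pow: "(D' ^^ N) r = lam (inv h) ((D ^^ N) (lam h r))" if "r \<in> R" for r N
  proof (induction N)
    case (Suc N)
    have "lam (inv h) ((D ^^ N) (lam h r)) \<in> R"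
      by (intro lam_R Lie_funpow(1)[OF D] that h hi)
    then show ?case
      using Suc that h Lie_funpow(1)[OF D, of "lam h r" N] by (simp add: D'_def cancel lam_R)
  qed (use that in \<open>simp add: cancel\<close>)
  have "locally_nilpotent D'"
    unfolding locally_nilpotent_def
  proof
    fix r assume r: "r \<in> R"
    obtain N where "(D ^^ N) (lam h r) = 0"
      using nil lam_R[OF r h] unfolding locally_nilpotent_def by blast
    then show "\<exists>N. (D' ^^ N) r = 0" using pow[OF r, of N] by (auto simp: lam_simps)
  qed
  ultimately have "D' v = 0" using V0D[OF v] by blast
  then have "lam h (lam (inv h) (D (lam h v))) = lam h 0" using nil_invariants_R[OF v] by (simp add: D'_def)
  then show "D (lam h v) = 0"
    using LieD(2)[OF D lam_R[OF nil_invariants_R[OF v] h]] by (simp add: cancel lam_simps)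
qed

text \<open>\<open>D v\<close> is the derivative of the translates \<open>lam h v\<close> in
  \<open>h\<close> at the identity, in the direction of \<open>D\<close>. A locally nilpotent
  \<open>T\<close> kills all these translates, hence also their derivative.\<close>

lemma nil_invariants_Lie:
  assumes v: "v \<in> nil_invariants" and D: "D \<in> Lie"
  shows "D v \<in> nil_invariants"
  unfolding nil_invariants_def
proof (intro CollectI conjI ballI impI)
  show "D v \<in> R" using LieD(2)[OF D nil_invariants_R[OF v]] .
  fix T assume T: "T \<in> Lie" and nil: "locally_nilpotent T"
  obtain m :: nat and a b where ab: "\<And>i. i < m \<Longrightarrow> a i \<in> R" "\<And>i. i < m \<Longrightarrow> b i \<in> R"
    "\<And>g. g \<in> carrier G \<Longrightarrow> rho g v = (\<Sum>i<m. fscale (b i g) (a i))"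
    "\<And>g. g \<in> carrier G \<Longrightarrow> lam g v = (\<Sum>i<m. fscale (a i g) (b i))"
    by (rule comult_expansion[OF nil_invariants_R[OF v]]) (rule that)
  have Dv: "D v = (\<Sum>i<m. fscale (D (a i) \<one>) (b i))"
  proof (rule R_eqI)
    fix g assume g: "g \<in> carrier G"
    have "D v g = D (\<Sum>i<m. fscale (b i g) (a i)) \<one>"
      using Lie_at_one'[OF D nil_invariants_R[OF v] g] ab(3)[OF g] by simp
    also have "D (\<Sum>i<m. fscale (b i g) (a i)) = (\<Sum>i<m. fscale (b i g) (D (a i)))"
      using ab(1) by (subst Lie_sum[OF D]) (auto simp: R_scale LieD(7)[OF D] intro!: sum.cong)
    finally show "D v g = (\<Sum>i<m. fscale (D (a i) \<one>) (b i)) g"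
      by (simp add: sum_fun_apply fun_simps mult.commute)
  qed (use ab LieD(2)[OF D nil_invariants_R[OF v]] in \<open>auto intro!: R_sum R_scale\<close>)
  have TDv: "T (D v) = (\<Sum>i<m. fscale (D (a i) \<one>) (T (b i)))"
    unfolding Dv using ab(2) by (subst Lie_sum[OF T]) (auto simp: R_scale LieD(7)[OF T] intro!: sum.cong)
  show "T (D v) = 0"
  proof (rule R_eqI)
    show "T (D v) \<in> R" using LieD(2)[OF T LieD(2)[OF D nil_invariants_R[OF v]]] .
    fix g assume g: "g \<in> carrier G"
    \<comment> \<open>As a function of \<open>h\<close> this is \<open>T (lam h v) g\<close>;
      applying \<open>D\<close> to it and evaluating at the identity yields
      \<open>T (D v) g\<close>.\<close>
    have "(\<Sum>i<m. fscale (T (b i) g) (a i)) = 0"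
    proof (rule R_eqI)
      fix h assume h: "h \<in> carrier G"
      have "0 = T (lam h v) g" using V0D[OF nil_invariants_lam[OF v h] T nil] by (simp add: fun_simps)
      also have "T (lam h v) = (\<Sum>i<m. fscale (a i h) (T (b i)))"
        unfolding ab(4)[OF h] using ab(2)
        by (subst Lie_sum[OF T]) (auto simp: R_scale LieD(7)[OF T] intro!: sum.cong)
      finally show "(\<Sum>i<m. fscale (T (b i) g) (a i)) h = 0 h"
        by (simp add: sum_fun_apply fun_simps mult.commute)
    qed (use ab in \<open>auto intro!: R_sum R_scale R_zero\<close>)
    then have "0 = D (\<Sum>i<m. fscale (T (b i) g) (a i)) \<one>" by (simp add: Lie_zero[OF D] fun_simps)
    also have "D (\<Sum>i<m. fscale (T (b i) g) (a i)) = (\<Sum>i<m. fscale (T (b i) g) (D (a i)))"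
      using ab(1) by (subst Lie_sum[OF D]) (auto simp: R_scale LieD(7)[OF D] intro!: sum.cong)
    finally show "T (D v) g = 0 g"
      unfolding TDv by (simp add: sum_fun_apply fun_simps mult.commute)
  qed (rule R_zero)
qed

lemma nil_invariants_lin: "D \<in> Lie \<Longrightarrow> F.lin_on nil_invariants D"
  unfolding F.lin_on_def using nil_invariants_subspace nil_invariants_Lie LieD(3,7) nil_invariants_R by blast

lemma gen_eigenspace_mono: "S \<subseteq> S' \<Longrightarrow> F.gen_eigenspace S D a \<subseteq> F.gen_eigenspace S' D a"
  unfolding F.gen_eigenspace_def by blast

text \<open>Since the nilpotent part kills \<open>nil_invariants\<close>, every element of the Lie algebra acts semisimply there.\<close>

lemma nil_invariants_eigenvector:
  assumes "D \<in> Lie" "v \<in> nil_invariants" "v \<in> E D a"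
  shows "D v = fscale a v"
  using V0D[OF assms(2) nil_part_Lie[OF assms(1)] nil_part_locally_nilpotent[OF assms(1)]]
    nil_part_E[OF assms(1,3)] by simp

section \<open>The adjoint action and root vectors\<close>

definition bracket :: "(('a \<Rightarrow> 'k) \<Rightarrow> 'a \<Rightarrow> 'k) \<Rightarrow> (('a \<Rightarrow> 'k) \<Rightarrow> 'a \<Rightarrow> 'k) \<Rightarrow> ('a \<Rightarrow> 'k) \<Rightarrow> 'a \<Rightarrow> 'k" where
  "bracket D T = (\<lambda>r. D (T r) - T (D r))"

lemma bracket_Lie:
  assumes D: "D \<in> Lie" and T: "T \<in> Lie"
  shows "bracket D T \<in> Lie"
  unfolding Lie_def bracket_def
  using LieD(1-6)[OF D] LieD(1-6)[OF T] Lie_zero[OF D] Lie_zero[OF T]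
  by (auto simp: R_diff R_add R_mult rho_R rho_simps algebra_simps)

lemma bracket_lin:
  assumes D: "D \<in> Lie"
  shows "O.lin_on Lie (bracket D)"
  unfolding O.lin_on_def
proof (intro conjI ballI allI)
  show "O.subspace Lie" by (rule Lie_subspace)
  show "bracket D T \<in> Lie" if "T \<in> Lie" for T by (rule bracket_Lie[OF D that])
  show "bracket D (S + T) = bracket D S + bracket D T" if S: "S \<in> Lie" and T: "T \<in> Lie" for S T
  proof
    fix r show "bracket D (S + T) r = (bracket D S + bracket D T) r"
    proof (cases "r \<in> R")
      case True
      then show ?thesis by (simp add: bracket_def op_simps LieD(3)[OF D] LieD(2)[OF S] LieD(2)[OF T] LieD(2)[OF D])
    next
      case False
      then show ?thesis by (simp add: bracket_def op_simps LieD(1)[OF S] LieD(1)[OF T] LieD(1)[OF D] Lie_zero[OF S] Lie_zero[OF T] Lie_zero[OF D])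
    qed
  qed
  show "bracket D (oscale c T) = oscale c (bracket D T)" if T: "T \<in> Lie" for c T
  proof
    fix r show "bracket D (oscale c T) r = oscale c (bracket D T) r"
    proof (cases "r \<in> R")
      case True
      then show ?thesis
        by (simp add: bracket_def oscale_fscale LieD(7)[OF D] LieD(2)[OF T] LieD(2)[OF D] F.scale_right_diff_distrib)
    next
      case False
      then show ?thesis
        by (simp add: bracket_def oscale_fscale LieD(1)[OF T] LieD(1)[OF D] Lie_zero[OF T] Lie_zero[OF D])
    qed
  qed
qed

text \<open>Up to constants every function is a combination of the \<open>gen i\<close>, which
  vanish at the identity; by the Leibniz rule only the values \<open>D (gen i) \<one>\<close> enter
  there, and right translations carry this to all other points. Thus \<open>Lie\<close> has
  dimension at most \<open>n\<close>.\<close>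

lemma Lie_eq_0I:
  assumes D: "D \<in> Lie" and gen0: "\<And>i. i < n \<Longrightarrow> D (gen i) \<one> = 0"
  shows "D = 0"
proof
  fix r
  show "D r = 0 r"
  proof (cases "r \<in> R")
    case True
    have "D r g = 0" if g: "g \<in> carrier G" for g
    proof -
      have rg: "rho g r \<in> R" using True g by (rule rho_R)
      obtain q where q: "\<And>i. i < n \<Longrightarrow> q i \<in> R"
        "\<And>h. h \<in> carrier G \<Longrightarrow> rho g r h = rho g r \<one> + (\<Sum>i<n. q i h * gen i h)"
        using R_gen[OF rg] by blast
      have qR: "(\<Sum>i<n. q i * gen i) \<in> R" using q(1) gen_R(1) by (intro R_sum R_mult) auto
      have e1: "rho g r = cst (rho g r \<one>) + (\<Sum>i<n. q i * gen i)"
      proof (rule R_eqI[OF rg R_add[OF cst_R qR]])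
        fix h assume "h \<in> carrier G"
        from q(2)[OF this] this show "rho g r h = (cst (rho g r \<one>) + (\<Sum>i<n. q i * gen i)) h"
          by (simp only: sum_fun_apply fun_simps cst_apply)
      qed
      have e2: "D (cst (rho g r \<one>) + (\<Sum>i<n. q i * gen i)) = (\<Sum>i<n. D (q i) * gen i + q i * D (gen i))"
      proof -
        have "D (cst (rho g r \<one>) + (\<Sum>i<n. q i * gen i)) = D (\<Sum>i<n. q i * gen i)"
          unfolding LieD(3)[OF D cst_R qR] LieD(5)[OF D] by simp
        also have "\<dots> = (\<Sum>i<n. D (q i * gen i))"
          using q(1) gen_R(1) by (intro Lie_sum[OF D] R_mult) auto
        also have "\<dots> = (\<Sum>i<n. D (q i) * gen i + q i * D (gen i))"
          using q(1) gen_R(1) by (intro sum.cong refl LieD(4)[OF D]) auto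
        finally show ?thesis .
      qed
      have "D (rho g r) = (\<Sum>i<n. D (q i) * gen i + q i * D (gen i))"
        by (rule trans[OF arg_cong[where f=D, OF e1] e2])
      then have "D (rho g r) \<one> = 0" using gen_R(2) gen0 by (simp add: sum_fun_apply fun_simps)
      then show ?thesis using Lie_at_one'[OF D True g] by simp
    qed
    then show ?thesis using R_outside[OF LieD(2)[OF D True]] by (auto simp: fun_simps fun_eq_iff)
  qed (simp add: LieD(1)[OF D] fun_simps)
qed

text \<open>Elements of \<open>Lie\<close> are determined by \<open>n\<close> numbers, so the first
  \<open>n + 1\<close> iterates of \<open>bracket D\<close> on \<open>T\<close> are
  dependent.\<close>

lemma bracket_decomposition:
  assumes D: "D \<in> Lie" and T: "T \<in> Lie"
  shows "\<exists>A w. finite A \<and> (\<forall>a\<in>A. w a \<in> O.gen_eigenspace Lie (bracket D) a) \<and> T = (\<Sum>a\<in>A. w a)"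
proof -
  note pow = O.lin_onD[OF O.lin_on_funpow[OF bracket_lin[OF D]]]
  obtain c where c: "\<exists>i\<le>n. c i \<noteq> 0" "\<forall>j<n. (\<Sum>i\<le>n. c i * ((bracket D ^^ i) T) (gen j) \<one>) = 0"
    using linear_relation_exists[of n "\<lambda>i j. ((bracket D ^^ i) T) (gen j) \<one>"] by blast
  have "(\<Sum>i\<le>n. oscale (c i) ((bracket D ^^ i) T)) = 0"
  proof (rule Lie_eq_0I)
    show "(\<Sum>i\<le>n. oscale (c i) ((bracket D ^^ i) T)) \<in> Lie"
      using pow(2)[OF T] by (intro O.subspace_sum[OF Lie_subspace] O.subspace_scale[OF Lie_subspace])
    show "(\<Sum>i\<le>n. oscale (c i) ((bracket D ^^ i) T)) (gen j) \<one> = 0" if "j < n" for j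
      using c(2) that by (simp add: sum_fun_apply oscale_apply)
  qed
  from O.relation_imp_poly_op[OF c(1) this] obtain p where "p \<noteq> 0" "O.poly_op (bracket D) p T = 0" by blast
  from O.gen_eigenspace_decomposition[OF alg_closed_imp_poly_has_root bracket_lin[OF D] T this]
  show ?thesis .
qed

text \<open>The identity \<open>D (S s) = bracket D S s + S (D s)\<close> is a Leibniz rule for the
  application of operators to functions.\<close>

lemma gen_eigenspace_action:
  assumes D: "D \<in> Lie" and T: "T \<in> O.gen_eigenspace Lie (bracket D) a" and r: "r \<in> E D b"
  shows "T r \<in> E D (a + b)"
proof -
  obtain m k where mk: "T \<in> Lie" "(O.shifted (bracket D) a ^^ m) T = 0" "(F.shifted D b ^^ k) r = 0"
    using T r unfolding F.gen_eigenspace_def O.gen_eigenspace_def by blast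
  have shifted_R: "F.shifted D c w \<in> R" if "w \<in> R" for c w
    by (rule F.lin_onD(2)[OF F.lin_on_shifted[OF Lie_lin[OF D]] that])
  have shifted_L: "O.shifted (bracket D) c S \<in> Lie" if "S \<in> Lie" for c S
    by (rule O.lin_onD(2)[OF O.lin_on_shifted[OF bracket_lin[OF D]] that])
  have "(F.shifted D (a + b) ^^ (m + k)) (T r) = 0"
  proof (rule leibniz_nilpotent[where U=Lie and V=R and W=R and T\<^sub>1="O.shifted (bracket D) a" and T\<^sub>2="F.shifted D b"
          and z\<^sub>1=0 and z\<^sub>2=0 and B="\<lambda>T r. T r" and T\<^sub>3="F.shifted D (a + b)" and u=T and v=r and m=m and n=k, OF _ _ _ _ _ _ _ _ _ mk(1) E_R[OF r] mk(2,3)])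
    show "O.shifted (bracket D) a S \<in> Lie" if "S \<in> Lie" for S by (rule shifted_L[OF that])
    show "F.shifted D b s \<in> R" "F.shifted D (a + b) s \<in> R" if "s \<in> R" for s by (rule shifted_R[OF that])+
    show "S s \<in> R" if "S \<in> Lie" "s \<in> R" for S s by (rule LieD(2)[OF that])
    show "F.shifted D (a + b) (S s) = O.shifted (bracket D) a S s + S (F.shifted D b s)" if "S \<in> Lie" "s \<in> R" for S s
      using that F.lin_onD(6)[OF Lie_lin[OF that(1)], of "D s" "fscale b s"]
      by (simp add: bracket_def op_simps oscale_fscale LieD(2)[OF D] LieD(7) R_scale F.scale_left_distrib)
    show "F.shifted D (a + b) (r + s) = F.shifted D (a + b) r + F.shifted D (a + b) s" if "r \<in> R" "s \<in> R" for r s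
      by (rule F.lin_onD(3)[OF F.lin_on_shifted[OF Lie_lin[OF D]] that])
    show "F.shifted D (a + b) 0 = 0" by (simp add: Lie_zero[OF D])
    show "(0 :: ('a \<Rightarrow> 'k) \<Rightarrow> 'a \<Rightarrow> 'k) s = 0" for s by (simp add: op_simps)
    show "S 0 = 0" if "S \<in> Lie" for S by (rule Lie_zero[OF that])
  qed
  then show ?thesis unfolding F.gen_eigenspace_def using LieD(2)[OF mk(1) E_R[OF r]] by blast
qed

text \<open>A root vector shifts the finitely many weights that occur in a finite-dimensional stable
  subspace, hence is nilpotent there.\<close>

lemma root_vector_locally_nilpotent:
  assumes D: "D \<in> Lie" and T: "T \<in> O.gen_eigenspace Lie (bracket D) a" and "a \<noteq> 0"
  shows "locally_nilpotent T"
proof -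
  have TL: "T \<in> Lie" using T unfolding O.gen_eigenspace_def by blast
  show ?thesis
  proof (rule locally_nilpotentI[OF TL D])
    fix b w assume w: "w \<in> E D b"
    have pow: "(T ^^ j) w \<in> E D (of_nat j * a + b)" for j
    proof (induction j)
      case (Suc j)
      from gen_eigenspace_action[OF D T Suc] show ?case by (simp add: algebra_simps)
    qed (use w in simp)
    obtain d c where c: "\<exists>i\<le>d. c i \<noteq> 0" "(\<Sum>i\<le>d. fscale (c i) ((T ^^ i) w)) = 0"
      using Lie_locally_finite[OF TL E_R[OF w]] by blast
    \<comment> \<open>In characteristic 0 these weights are distinct, so each term of the relation
      vanishes on its own.\<close>
    have inj: "inj_on (\<lambda>j. of_nat j * a + b) {..d}" using \<open>a \<noteq> 0\<close> by (auto simp: inj_on_def)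
    have "fscale (c i) ((T ^^ i) w) = 0" if "i \<le> d" for i
      by (rule F.gen_eigenspace_independent_family[OF Lie_lin[OF D] _ inj _ c(2)])
        (use that pow in \<open>auto intro!: F.subspace_scale[OF F.subspace_gen_eigenspace[OF Lie_lin[OF D]]]\<close>)
    moreover obtain i where "i \<le> d" "c i \<noteq> 0" using c(1) by blast
    ultimately have "(T ^^ i) w = 0" by (metis F.scale_eq_0_iff)
    then show "\<exists>N. (T ^^ N) w = 0" ..
  qed
qed

text \<open>Split \<open>T\<close> into generalized eigenvectors of \<open>bracket D\<close>. Those
  of nonzero weight are locally nilpotent and kill all functions involved; the one of weight zero
  preserves the generalized eigenspaces of \<open>D\<close>, and on these \<open>D\<close> acts as a
  scalar within \<open>nil_invariants\<close>.\<close>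

lemma Lie_commute_on_nil_invariants:
  assumes D: "D \<in> Lie" and T: "T \<in> Lie" and v: "v \<in> nil_invariants"
  shows "D (T v) = T (D v)"
proof -
  obtain A w where A: "finite A" "\<forall>a\<in>A. w a \<in> O.gen_eigenspace Lie (bracket D) a" "T = (\<Sum>a\<in>A. w a)"
    using bracket_decomposition[OF D T] by blast
  have wL: "w a \<in> Lie" if "a \<in> A" for a using A(2) that unfolding O.gen_eigenspace_def by blast
  have comm: "D (w a v) = w a (D v)" if a: "a \<in> A" for a
  proof (cases "a = 0")
    case False
    then have nil: "locally_nilpotent (w a)" using root_vector_locally_nilpotent[OF D] A(2) a by blast
    then show ?thesis using V0D[OF _ wL[OF a] nil] v nil_invariants_Lie[OF v D] by (simp add: Lie_zero[OF D])
  next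
    case True
    obtain B u where B: "finite B" "\<forall>b\<in>B. u b \<in> F.gen_eigenspace nil_invariants D b" "v = (\<Sum>b\<in>B. u b)"
      using F_decomposition[OF D nil_invariants_lin[OF D] _ v] nil_invariants_R by blast
    have uV: "u b \<in> nil_invariants" "u b \<in> E D b" if "b \<in> B" for b
      using B(2) that gen_eigenspace_mono[of nil_invariants R D b] nil_invariants_R unfolding F.gen_eigenspace_def by blast+
    have eq: "D (w a (u b)) = w a (D (u b))" if b: "b \<in> B" for b
    proof -
      have "w a (u b) \<in> E D (0 + b)"
        using gen_eigenspace_action[OF D _ uV(2)[OF b], of "w a" 0] A(2) a True by blast
      then have "D (w a (u b)) = fscale b (w a (u b))"
        using nil_invariants_eigenvector[OF D nil_invariants_Lie[OF uV(1)[OF b] wL[OF a]]] by simp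
      also have "\<dots> = w a (D (u b))"
        unfolding nil_invariants_eigenvector[OF D uV[OF b]] using LieD(7)[OF wL[OF a] nil_invariants_R[OF uV(1)[OF b]]] by simp
      finally show ?thesis .
    qed
    have uR: "u b \<in> R" "D (u b) \<in> R" "w a (u b) \<in> R" if "b \<in> B" for b
      using nil_invariants_R[OF uV(1)[OF that]] LieD(2)[OF D] LieD(2)[OF wL[OF a]] by auto
    show ?thesis unfolding B(3) using uR eq by (simp add: Lie_sum[OF D] Lie_sum[OF wL[OF a]])
  qed
  have "D (T v) = (\<Sum>a\<in>A. D (w a v))"
    unfolding A(3) sum_fun_apply[where x=v] using LieD(2)[OF wL nil_invariants_R[OF v]] by (rule Lie_sum[OF D])
  also have "\<dots> = T (D v)" unfolding A(3) sum_fun_apply[where x="D v"] using comm by (rule sum.cong[OF refl])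
  finally show ?thesis .
qed

end

section \<open>Powers of the maximal ideal at the identity\<close>

context affine_group_algebra
begin

abbreviation M :: "nat \<Rightarrow> ('a \<Rightarrow> 'k) \<Rightarrow> bool" where
  "M \<equiv> mpow R \<one>"

lemma M_R: "M j r \<Longrightarrow> r \<in> R"
  by (induction rule: mpow.induct) (auto intro: R_mult R_add)

lemma M_scale:
  assumes "M j r" and s: "s \<in> R"
  shows "M j (s * r)"
  using assms(1)
proof (induction rule: mpow.induct)
  case (base r)
  show ?case by (rule mpow.base[OF R_mult[OF s base]])
next
  case (step a j r)
  show ?case using mpow.step[OF step.hyps(1,2) step.IH] by (simp only: mult.left_commute)
next
  case (add j r r')
  show ?case using mpow.add[OF add.IH] by (simp only: distrib_left)
qed

lemma M_subspace: "F.subspace {r. M j r}"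
proof (rule F.subspaceI)
  have "\<exists>r. M j r"
  proof (induction j)
    case (Suc j)
    then obtain r where "M j r" ..
    then have "M (Suc j) (0 * r)" by (intro mpow.step R_zero) (simp_all add: fun_simps)
    then show ?case by (rule exI[of _ "0 * r"])
  next
    case 0
    show ?case by (rule exI[of _ 0]) (rule mpow.base[OF R_zero])
  qed
  then obtain r where "M j r" by blast
  then have "M j (0 * r)" by (rule M_scale[OF _ R_zero])
  then show "0 \<in> {r. M j r}" by simp
  show "x + y \<in> {r. M j r}" if "x \<in> {r. M j r}" "y \<in> {r. M j r}" for x y
    using that by (auto intro: mpow.add)
  show "fscale c x \<in> {r. M j r}" if "x \<in> {r. M j r}" for c x
    using that M_scale[of j x "cst c"] by (simp add: fscale_eq_cst[OF M_R])
qed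

lemma M_sum: "(\<And>i. i \<in> I \<Longrightarrow> M j (f i)) \<Longrightarrow> M j (\<Sum>i\<in>I. f i)"
  using F.subspace_sum[OF M_subspace, of I f j] by simp

lemma M_diff: "M j r \<Longrightarrow> M j s \<Longrightarrow> M j (r - s)"
  using F.subspace_diff[OF M_subspace, of r j s] by simp

lemma M_fscale: "M j r \<Longrightarrow> M j (fscale c r)"
  using F.subspace_scale[OF M_subspace, of r j c] by simp

lemma M_1: "r \<in> R \<Longrightarrow> r \<one> = 0 \<Longrightarrow> M 1 r"
  using mpow.step[of r R \<one> 0 "cst 1"] mpow.base[of "cst 1" R \<one>] by (simp add: cst_mult_1)

lemma M_Suc_at_one: "M (Suc j) r \<Longrightarrow> r \<one> = 0"
  by (induction "Suc j" r arbitrary: j rule: mpow.induct) (auto simp: fun_simps)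

lemma M_1_iff: "M 1 r \<longleftrightarrow> r \<in> R \<and> r \<one> = 0"
  using M_1 M_R M_Suc_at_one[of 0] by auto

lemma M_2_mult: "r \<in> R \<Longrightarrow> r \<one> = 0 \<Longrightarrow> s \<in> R \<Longrightarrow> s \<one> = 0 \<Longrightarrow> M 2 (r * s)"
  using mpow.step[of r R \<one> 1 s] M_1[of s] by (simp add: numeral_2_eq_2)

lemma M_2_induct [consumes 1, case_names mult add]:
  assumes "M 2 r" and "\<And>r s. r \<in> R \<Longrightarrow> r \<one> = 0 \<Longrightarrow> s \<in> R \<Longrightarrow> s \<one> = 0 \<Longrightarrow> P (r * s)"
    and "\<And>r s. M 2 r \<Longrightarrow> P r \<Longrightarrow> M 2 s \<Longrightarrow> P s \<Longrightarrow> P (r + s)"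
  shows "P r"
  using assms(1)
proof (induction "2::nat" r rule: mpow.induct)
  case (step a j r)
  then have "M 1 r" by (simp add: numeral_2_eq_2)
  then show ?case using step assms(2) M_1_iff by blast
qed (use assms(3) in auto)

section \<open>A basis of the cotangent space at the identity\<close>

definition cotangent_spanning :: "nat set \<Rightarrow> bool" where
  "cotangent_spanning B \<longleftrightarrow> (\<forall>r\<in>R. r \<one> = 0 \<longrightarrow> (\<exists>c. M 2 (r - (\<Sum>b\<in>B. fscale (c b) (gen b)))))"

text \<open>Replacing each coefficient \<open>q i\<close> by its value at the identity changes the
  combination by products of two functions that vanish there.\<close>

lemma cotangent_spanning_all: "cotangent_spanning {..<n}"
  unfolding cotangent_spanning_def
proof (intro ballI impI)
  fix r assume r: "r \<in> R" "r \<one> = 0"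
  obtain q where q: "\<And>i. i < n \<Longrightarrow> q i \<in> R"
    "\<And>h. h \<in> carrier G \<Longrightarrow> r h = r \<one> + (\<Sum>i<n. q i h * gen i h)"
    using R_gen[OF r(1)] by blast
  have qc: "q i - cst (q i \<one>) \<in> R" "(q i - cst (q i \<one>)) \<one> = 0" if "i < n" for i
    using q(1)[OF that] by (auto intro!: R_diff simp: fun_simps cst_apply)
  have "M 2 (\<Sum>i<n. (q i - cst (q i \<one>)) * gen i)"
    using qc gen_R by (intro M_sum M_2_mult) auto
  moreover have "r - (\<Sum>i<n. fscale (q i \<one>) (gen i)) = (\<Sum>i<n. (q i - cst (q i \<one>)) * gen i)"
  proof (rule R_eqI)
    fix h assume h: "h \<in> carrier G"
    have "r h = (\<Sum>i<n. q i h * gen i h)" using q(2)[OF h] r(2) by simp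
    then show "(r - (\<Sum>i<n. fscale (q i \<one>) (gen i))) h = (\<Sum>i<n. (q i - cst (q i \<one>)) * gen i) h"
      by (simp add: sum_fun_apply fun_simps cst_apply[OF h] sum_subtractf left_diff_distrib)
  qed (use r q(1) qc gen_R in \<open>auto intro!: R_diff R_sum R_scale R_mult\<close>)
  ultimately show "\<exists>c. M 2 (r - (\<Sum>b\<in>{..<n}. fscale (c b) (gen b)))"
    by (intro exI[of _ "\<lambda>i. q i \<one>"]) simp
qed

text \<open>A spanning set of least cardinality is a basis of the cotangent space; working with
  indices avoids forming the quotient.\<close>

definition basis :: "nat set" where
  "basis = (SOME B. B \<subseteq> {..<n} \<and> cotangent_spanning B \<and>
     (\<forall>B'. B' \<subseteq> {..<n} \<and> cotangent_spanning B' \<longrightarrow> card B \<le> card B'))"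

lemma basis:
  shows basis_sub: "basis \<subseteq> {..<n}" and basis_spanning: "cotangent_spanning basis"
    and basis_minimal: "\<And>B'. B' \<subseteq> {..<n} \<Longrightarrow> cotangent_spanning B' \<Longrightarrow> card basis \<le> card B'"
proof -
  have "\<exists>B. (B \<subseteq> {..<n} \<and> cotangent_spanning B) \<and>
     (\<forall>B'. (B' \<subseteq> {..<n} \<and> cotangent_spanning B') \<longrightarrow> card B \<le> card B')"
    by (rule ex_has_least_nat[where k="{..<n}"]) (use cotangent_spanning_all in auto)
  then have "\<exists>B. B \<subseteq> {..<n} \<and> cotangent_spanning B \<and>
     (\<forall>B'. B' \<subseteq> {..<n} \<and> cotangent_spanning B' \<longrightarrow> card B \<le> card B')" by blast
  from someI_ex[OF this]
  show "basis \<subseteq> {..<n}" "cotangent_spanning basis"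
    "\<And>B'. B' \<subseteq> {..<n} \<Longrightarrow> cotangent_spanning B' \<Longrightarrow> card basis \<le> card B'"
    unfolding basis_def by blast+
qed

lemma finite_basis: "finite basis" using basis_sub finite_subset by blast

lemma basis_gen: "b \<in> basis \<Longrightarrow> gen b \<in> R" "b \<in> basis \<Longrightarrow> gen b \<one> = 0"
  using basis_sub gen_R by auto

text \<open>A nontrivial relation would express \<open>gen b\<close> by the other generators modulo
  the square of the maximal ideal, against minimal cardinality.\<close>

lemma basis_independent:
  assumes c: "M 2 (\<Sum>b\<in>basis. fscale (c b) (gen b))" and b: "b \<in> basis"
  shows "c b = 0"
proof (rule ccontr)
  assume cb: "c b \<noteq> 0"
  have "cotangent_spanning (basis - {b})"
    unfolding cotangent_spanning_def
  proof (intro ballI impI)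
    fix r assume "r \<in> R" "r \<one> = 0"
    then obtain e where e: "M 2 (r - (\<Sum>b\<in>basis. fscale (e b) (gen b)))"
      using basis_spanning unfolding cotangent_spanning_def by blast
    \<comment> \<open>The multiple of the relation is chosen so that the coefficient at
      \<open>b\<close> cancels.\<close>
    let ?e = "\<lambda>x. e x - e b / c b * c x"
    have "M 2 (r - (\<Sum>x\<in>basis. fscale (e x) (gen x)) + fscale (e b / c b) (\<Sum>x\<in>basis. fscale (c x) (gen x)))"
      by (intro mpow.add e M_fscale c)
    moreover have "r - (\<Sum>x\<in>basis. fscale (e x) (gen x)) + fscale (e b / c b) (\<Sum>x\<in>basis. fscale (c x) (gen x))
      = r - (\<Sum>x\<in>basis. fscale (?e x) (gen x))"
      by (simp add: F.scale_left_diff_distrib sum_subtractf F.scale_sum_right)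
    moreover have "(\<Sum>x\<in>basis. fscale (?e x) (gen x)) = (\<Sum>x\<in>basis - {b}. fscale (?e x) (gen x))"
      using finite_basis b cb by (simp add: sum.remove[of basis b])
    ultimately have "M 2 (r - (\<Sum>x\<in>basis - {b}. fscale (?e x) (gen x)))" by simp
    then show "\<exists>c. M 2 (r - (\<Sum>b\<in>basis - {b}. fscale (c b) (gen b)))" by (intro exI[of _ ?e])
  qed
  then have "card basis \<le> card (basis - {b})" using basis_sub by (intro basis_minimal) auto
  then show False using finite_basis b by (metis card_Diff1_less not_less)
qed

text \<open>The coordinates of the differential of \<open>r\<close> at the identity.\<close>

definition diff :: "('a \<Rightarrow> 'k) \<Rightarrow> nat \<Rightarrow> 'k" where
  "diff r = (SOME c. M 2 (r - cst (r \<one>) - (\<Sum>b\<in>basis. fscale (c b) (gen b))))"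

lemma diff:
  assumes "r \<in> R"
  shows "M 2 (r - cst (r \<one>) - (\<Sum>b\<in>basis. fscale (diff r b) (gen b)))"
proof -
  have "(r - cst (r \<one>)) \<one> = 0" by (simp add: fun_simps cst_apply)
  with R_diff[OF assms cst_R]
  have "\<exists>c. M 2 (r - cst (r \<one>) - (\<Sum>b\<in>basis. fscale (c b) (gen b)))"
    using basis_spanning unfolding cotangent_spanning_def by blast
  from someI_ex[OF this] show ?thesis unfolding diff_def .
qed

lemma diff_unique:
  assumes "r \<in> R" "M 2 (r - cst (r \<one>) - (\<Sum>b\<in>basis. fscale (c b) (gen b)))" "b \<in> basis"
  shows "diff r b = c b"
proof -
  have "M 2 ((r - cst (r \<one>) - (\<Sum>b\<in>basis. fscale (c b) (gen b))) - (r - cst (r \<one>) - (\<Sum>b\<in>basis. fscale (diff r b) (gen b))))"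
    by (rule M_diff[OF assms(2) diff[OF assms(1)]])
  also have "(r - cst (r \<one>) - (\<Sum>b\<in>basis. fscale (c b) (gen b))) - (r - cst (r \<one>) - (\<Sum>b\<in>basis. fscale (diff r b) (gen b)))
    = (\<Sum>b\<in>basis. fscale (diff r b - c b) (gen b))"
    by (simp add: F.scale_left_diff_distrib sum_subtractf)
  finally show ?thesis using basis_independent[of "\<lambda>b. diff r b - c b" b] assms(3) by simp
qed

lemma diff_add:
  assumes r: "r \<in> R" and s: "s \<in> R" and b: "b \<in> basis"
  shows "diff (r + s) b = diff r b + diff s b"
proof (rule diff_unique[OF R_add[OF r s] _ b])
  have "M 2 ((r - cst (r \<one>) - (\<Sum>b\<in>basis. fscale (diff r b) (gen b))) + (s - cst (s \<one>) - (\<Sum>b\<in>basis. fscale (diff s b) (gen b))))"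
    by (rule mpow.add[OF diff[OF r] diff[OF s]])
  also have "(r - cst (r \<one>) - (\<Sum>b\<in>basis. fscale (diff r b) (gen b))) + (s - cst (s \<one>) - (\<Sum>b\<in>basis. fscale (diff s b) (gen b)))
    = r + s - cst ((r + s) \<one>) - (\<Sum>b\<in>basis. fscale (diff r b + diff s b) (gen b))"
    by (simp add: F.scale_left_distrib sum.distrib plus_fun_apply cst_add[symmetric])
  finally show "M 2 (r + s - cst ((r + s) \<one>) - (\<Sum>b\<in>basis. fscale (diff r b + diff s b) (gen b)))" .
qed

text \<open>After subtracting the values at the identity from both factors, their product lies in
  the square of the maximal ideal and does not contribute.\<close>

lemma diff_mult:
  assumes r: "r \<in> R" and s: "s \<in> R" and b: "b \<in> basis"
  shows "diff (r * s) b = r \<one> * diff s b + s \<one> * diff r b"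
proof (rule diff_unique[OF R_mult[OF r s] _ b])
  define dr where "dr = (\<Sum>b\<in>basis. fscale (diff r b) (gen b))"
  define ds where "ds = (\<Sum>b\<in>basis. fscale (diff s b) (gen b))"
  have rs: "r - cst (r \<one>) \<in> R" "s - cst (s \<one>) \<in> R" using r s by (auto intro: R_diff)
  have "M 2 ((r - cst (r \<one>)) * (s - cst (s \<one>)) + (fscale (s \<one>) (r - cst (r \<one>) - dr) + fscale (r \<one>) (s - cst (s \<one>) - ds)))"
    unfolding dr_def ds_def using diff[OF r] diff[OF s] rs
    by (intro mpow.add M_2_mult M_fscale) (auto simp: fun_simps cst_apply)
  also have "(r - cst (r \<one>)) * (s - cst (s \<one>)) + (fscale (s \<one>) (r - cst (r \<one>) - dr) + fscale (r \<one>) (s - cst (s \<one>) - ds))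
    = r * s - cst ((r * s) \<one>) - (fscale (r \<one>) ds + fscale (s \<one>) dr)"
  proof
    fix g
    show "((r - cst (r \<one>)) * (s - cst (s \<one>)) + (fscale (s \<one>) (r - cst (r \<one>) - dr) + fscale (r \<one>) (s - cst (s \<one>) - ds))) g
    = (r * s - cst ((r * s) \<one>) - (fscale (r \<one>) ds + fscale (s \<one>) dr)) g"
      using R_outside[OF r, of g] R_outside[OF s, of g]
      by (cases "g \<in> carrier G") (simp_all add: fun_simps cst_def algebra_simps)
  qed
  also have "fscale (r \<one>) ds + fscale (s \<one>) dr = (\<Sum>b\<in>basis. fscale (r \<one> * diff s b + s \<one> * diff r b) (gen b))"
    by (simp add: dr_def ds_def F.scale_left_distrib sum.distrib F.scale_sum_right)
  finally show "M 2 (r * s - cst ((r * s) \<one>) - (\<Sum>b\<in>basis. fscale (r \<one> * diff s b + s \<one> * diff r b) (gen b)))" .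
qed

lemma diff_cst:
  assumes "b \<in> basis"
  shows "diff (cst c) b = 0"
  by (rule diff_unique[OF cst_R _ assms, of c "\<lambda>_. 0", simplified])
    (use F.subspace_0[OF M_subspace] in \<open>simp add: cst_apply\<close>)

lemma diff_fscale: "r \<in> R \<Longrightarrow> b \<in> basis \<Longrightarrow> diff (fscale c r) b = c * diff r b"
  by (simp add: fscale_eq_cst diff_mult diff_cst cst_apply)

lemma diff_zero: "b \<in> basis \<Longrightarrow> diff 0 b = 0"
  using diff_cst[of b 0] by simp

lemma diff_sum:
  assumes "\<And>i. i \<in> I \<Longrightarrow> f i \<in> R" "b \<in> basis"
  shows "diff (\<Sum>i\<in>I. f i) b = (\<Sum>i\<in>I. diff (f i) b)"
  using assms(1)
  by (induction I rule: infinite_finite_induct) (auto simp: diff_zero diff_add R_sum assms(2))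

lemma diff_gen:
  assumes "b \<in> basis" "b' \<in> basis"
  shows "diff (gen b') b = of_bool (b = b')"
proof (rule diff_unique[OF basis_gen(1)[OF assms(2)] _ assms(1)])
  have "(\<Sum>b\<in>basis. fscale (of_bool (b = b')) (gen b)) = (\<Sum>b\<in>basis. if b = b' then gen b' else 0)"
    by (rule sum.cong) auto
  also have "\<dots> = gen b'" using assms(2) finite_basis by simp
  finally show "M 2 (gen b' - cst (gen b' \<one>) - (\<Sum>b\<in>basis. fscale (of_bool (b = b')) (gen b)))"
    using F.subspace_0[OF M_subspace, of 2] basis_gen(2)[OF assms(2)] by simp
qed

text \<open>The right-invariant vector field that extends the tangent vector at the identity dual to
  \<open>gen b\<close>.\<close>

definition Dop :: "nat \<Rightarrow> ('a \<Rightarrow> 'k) \<Rightarrow> 'a \<Rightarrow> 'k" where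
  "Dop b r = (\<lambda>g. if r \<in> R \<and> g \<in> carrier G then diff (rho g r) b else 0)"

lemma Dop_Lie:
  assumes b: "b \<in> basis"
  shows "Dop b \<in> Lie"
  unfolding Lie_def
proof (intro CollectI conjI allI ballI impI)
  show "Dop b r = 0" if "r \<notin> R" for r using that by (simp add: Dop_def zero_fun_def)
  show "Dop b r \<in> R" if r: "r \<in> R" for r
  proof -
    obtain m :: nat and a c where ac: "\<And>i. i < m \<Longrightarrow> a i \<in> R" "\<And>i. i < m \<Longrightarrow> c i \<in> R"
      "\<And>g. g \<in> carrier G \<Longrightarrow> rho g r = (\<Sum>i<m. fscale (c i g) (a i))"
      by (rule comult_expansion[OF r]) (rule that)
    have "Dop b r = (\<Sum>i<m. fscale (diff (a i) b) (c i))"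
    proof
      fix g
      have "diff (\<Sum>i<m. fscale (c i g) (a i)) b = (\<Sum>i<m. c i g * diff (a i) b)"
        using ac(1) b by (subst diff_sum) (auto intro!: R_scale sum.cong simp: diff_fscale)
      then show "Dop b r g = (\<Sum>i<m. fscale (diff (a i) b) (c i)) g"
        using r ac R_outside[OF ac(2), of _ g]
        by (cases "g \<in> carrier G") (auto simp: Dop_def sum_fun_apply fun_simps mult.commute)
    qed
    then show ?thesis using ac by (auto intro!: R_sum R_scale)
  qed
  show "Dop b (r + s) = Dop b r + Dop b s" if "r \<in> R" "s \<in> R" for r s
    using that b by (auto simp: Dop_def fun_eq_iff fun_simps R_add rho_simps diff_add rho_R)
  show "Dop b (r * s) = Dop b r * s + r * Dop b s" if "r \<in> R" "s \<in> R" for r s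
    using that b
    by (auto simp: Dop_def fun_eq_iff fun_simps R_mult rho_simps diff_mult rho_R rho_apply R_outside)
  show "Dop b (cst c) = 0" for c
    using b by (auto simp: Dop_def fun_eq_iff fun_simps rho_simps diff_cst)
  show "Dop b (rho h r) = rho h (Dop b r)" if "h \<in> carrier G" "r \<in> R" for h r
    using that by (auto simp: Dop_def fun_eq_iff rho_R rho_simps rho_apply) (simp add: rho_def)
qed

lemma Dop_at_one: "r \<in> R \<Longrightarrow> Dop b r \<one> = diff r b"
  by (simp add: Dop_def rho_simps)

text \<open>The Euler field with the \<open>gen b\<close> as coordinates. The \<open>Dop b\<close>
  are dual to these only at the identity, so Euler's identity will hold only up to higher powers of
  the maximal ideal.\<close>

definition euler :: "('a \<Rightarrow> 'k) \<Rightarrow> 'a \<Rightarrow> 'k" where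
  "euler r = (\<Sum>b\<in>basis. gen b * Dop b r)"

lemma euler_R: "r \<in> R \<Longrightarrow> euler r \<in> R"
  unfolding euler_def using basis_gen LieD(2)[OF Dop_Lie] by (auto intro!: R_sum R_mult)

lemma euler_at_one: "euler r \<one> = 0"
  unfolding euler_def using basis_gen by (simp add: sum_fun_apply fun_simps)

lemma euler_add: "r \<in> R \<Longrightarrow> s \<in> R \<Longrightarrow> euler (r + s) = euler r + euler s"
  unfolding euler_def sum.distrib[symmetric]
  by (rule sum.cong) (auto simp: LieD(3)[OF Dop_Lie] distrib_left)

lemma euler_mult: "r \<in> R \<Longrightarrow> s \<in> R \<Longrightarrow> euler (r * s) = euler r * s + r * euler s"
  unfolding euler_def sum_distrib_left sum_distrib_right sum.distrib[symmetric]
  by (rule sum.cong) (auto simp: LieD(4)[OF Dop_Lie] algebra_simps)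

lemma euler_fscale:
  assumes "r \<in> R"
  shows "euler (fscale c r) = fscale c (euler r)"
  unfolding euler_def F.scale_sum_right
  by (rule sum.cong) (use assms in \<open>auto simp: LieD(7)[OF Dop_Lie] fun_eq_iff fun_simps\<close>)

lemma euler_sum: "(\<And>i. i \<in> I \<Longrightarrow> f i \<in> R) \<Longrightarrow> euler (\<Sum>i\<in>I. f i) = (\<Sum>i\<in>I. euler (f i))"
proof (induction I rule: infinite_finite_induct)
  case empty
  show ?case unfolding euler_def by (auto intro!: sum.neutral simp: Lie_zero[OF Dop_Lie])
next
  case (infinite A)
  then show ?case unfolding euler_def by (auto intro!: sum.neutral simp: Lie_zero[OF Dop_Lie])
qed (auto simp: euler_add R_sum)

lemma euler_M_2: "M 2 r \<Longrightarrow> M 2 (euler r)"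
proof (induction rule: M_2_induct)
  case (mult r s)
  have "M 2 (euler r * s + r * euler s)"
    using mult euler_R euler_at_one by (intro mpow.add M_2_mult) auto
  then show ?case using mult by (simp add: euler_mult)
next
  case (add r s)
  then show ?case using mpow.add euler_add[OF M_R M_R] by metis
qed

text \<open>Modulo the square of the maximal ideal \<open>a\<close> equals its linear part, and on a
  generator the claim holds because \<open>Dop b' (gen b)\<close> takes the value
  \<open>of_bool (b' = b)\<close> at the identity.\<close>

lemma euler_max:
  assumes a: "a \<in> R" "a \<one> = 0"
  shows "M 2 (euler a - a)"
proof -
  define da where "da = (\<Sum>b\<in>basis. fscale (diff a b) (gen b))"
  have da: "da \<in> R" unfolding da_def using basis_gen by (auto intro!: R_sum R_scale)
  have z: "M 2 (a - da)" using diff[OF a(1)] a(2) by (simp add: da_def)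
  have gen: "M 2 (euler (gen b) - gen b)" if b: "b \<in> basis" for b
  proof -
    have "M 2 (\<Sum>b'\<in>basis. gen b' * (Dop b' (gen b) - cst (of_bool (b' = b))))"
    proof (intro M_sum M_2_mult)
      fix b' assume b': "b' \<in> basis"
      show "gen b' \<in> R" "gen b' \<one> = 0" using basis_gen b' by auto
      show "Dop b' (gen b) - cst (of_bool (b' = b)) \<in> R"
        using LieD(2)[OF Dop_Lie[OF b'] basis_gen(1)[OF b]] by (intro R_diff cst_R)
      show "(Dop b' (gen b) - cst (of_bool (b' = b))) \<one> = 0"
        using basis_gen(1)[OF b] by (simp add: fun_simps Dop_at_one diff_gen[OF b' b] cst_apply)
    qed
    moreover have "(\<Sum>b'\<in>basis. gen b' * (Dop b' (gen b) - cst (of_bool (b' = b)))) = euler (gen b) - gen b"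
    proof -
      have "(\<Sum>b'\<in>basis. gen b' * cst (of_bool (b' = b))) = (\<Sum>b'\<in>basis. if b' = b then gen b else 0)"
        by (rule sum.cong) (auto simp: cst_mult_1 basis_gen)
      also have "\<dots> = gen b" using b finite_basis by simp
      finally show ?thesis unfolding euler_def by (simp add: right_diff_distrib sum_subtractf)
    qed
    ultimately show ?thesis by simp
  qed
  have "euler da - da = (\<Sum>b\<in>basis. fscale (diff a b) (euler (gen b) - gen b))"
    unfolding da_def using basis_gen(1)
    by (subst euler_sum) (auto simp: R_scale euler_fscale F.scale_right_diff_distrib sum_subtractf intro!: sum.cong)
  then have "M 2 (euler da - da)" using gen by (auto intro!: M_sum M_fscale)
  then have "M 2 ((euler (a - da) - (a - da)) + (euler da - da))"
    by (rule mpow.add[OF M_diff[OF euler_M_2[OF z] z]])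
  moreover have "euler (a - da) + euler da = euler a"
    using euler_add[of "a - da" da] a da by (simp add: R_diff)
  then have "(euler (a - da) - (a - da)) + (euler da - da) = euler a - a"
    by (auto simp: fun_eq_iff fun_simps)
  ultimately show ?thesis by simp
qed

text \<open>Euler's identity on the associated graded ring of the maximal ideal at the identity.\<close>

lemma euler_graded: "M j r \<Longrightarrow> M (Suc j) (euler r - fscale (of_nat j) r)"
proof (induction rule: mpow.induct)
  case (base r)
  then show ?case using M_1[OF euler_R euler_at_one] by simp
next
  case (step a j r)
  have rR: "r \<in> R" using M_R[OF step.hyps(3)] .
  have mult2: "M (Suc (Suc j)) (s * r)" if "M 2 s" for s
    using that
  proof (induction rule: M_2_induct)
    case (mult u v)
    then have "M (Suc (Suc j)) (u * (v * r))" using step.hyps(3) by (intro mpow.step) auto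
    then show ?case by (simp add: mult.assoc)
  next
    case (add u v)
    then show ?case using mpow.add by (metis distrib_right)
  qed
  have "M (Suc (Suc j)) ((euler a - a) * r + a * (euler r - fscale (of_nat j) r))"
    using step euler_max by (intro mpow.add mult2 mpow.step) auto
  also have "(euler a - a) * r + a * (euler r - fscale (of_nat j) r) = euler (a * r) - fscale (of_nat (Suc j)) (a * r)"
    using step.hyps(1) rR by (simp add: euler_mult fun_eq_iff fun_simps algebra_simps)
  finally show ?case .
next
  case (add j r s)
  then have "M (Suc j) ((euler r - fscale (of_nat j) r) + (euler s - fscale (of_nat j) s))"
    by (intro mpow.add)
  then show ?case
    using euler_add[OF M_R[OF add.hyps(1)] M_R[OF add.hyps(2)]] by (simp add: F.scale_right_distrib algebra_simps)
qed

section \<open>Joint eigenvectors of the Lie algebra\<close>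

definition joint_eigenvector :: "('a \<Rightarrow> 'k) \<Rightarrow> bool" where
  "joint_eigenvector \<eta> \<longleftrightarrow> \<eta> \<in> R \<and> (\<exists>l. \<forall>b\<in>basis. Dop b \<eta> = fscale (l b) \<eta>)"

text \<open>For an eigenvector, \<open>euler \<eta>\<close> is a combination of the
  \<open>gen b * \<eta>\<close> and lies one power deeper than \<open>\<eta>\<close>; modulo that
  power it is also \<open>j\<close> times \<open>\<eta>\<close>. Division by \<open>j\<close> is
  possible from \<open>j = 1\<close> on, and vanishing at the identity starts the induction
  there.\<close>

lemma joint_eigenvector_M:
  assumes "joint_eigenvector \<eta>" "\<eta> \<one> = 0"
  shows "M j \<eta>"
proof -
  obtain l where l: "\<eta> \<in> R" "\<And>b. b \<in> basis \<Longrightarrow> Dop b \<eta> = fscale (l b) \<eta>"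
    using assms(1) unfolding joint_eigenvector_def by blast
  have eu: "euler \<eta> = (\<Sum>b\<in>basis. fscale (l b) (gen b * \<eta>))"
    unfolding euler_def using l(2) by (intro sum.cong refl) (simp add: fun_eq_iff fun_simps)
  have "M (Suc j) \<eta>" for j
  proof (induction j)
    case 0
    show ?case using M_1[OF l(1) assms(2)] by simp
  next
    case (Suc j)
    have "M (Suc (Suc j)) (euler \<eta>)"
      unfolding eu using basis_gen Suc by (intro M_sum M_fscale mpow.step) auto
    then have "M (Suc (Suc j)) (fscale (inverse (of_nat (Suc j))) (euler \<eta> - (euler \<eta> - fscale (of_nat (Suc j)) \<eta>)))"
      by (rule M_fscale[OF M_diff[OF _ euler_graded[OF Suc]]])
    moreover have "euler \<eta> - (euler \<eta> - fscale (of_nat (Suc j)) \<eta>) = fscale (of_nat (Suc j)) \<eta>" by simp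
    moreover have "inverse (of_nat (Suc j)) * of_nat (Suc j) = (1 :: 'k)"
      by (rule left_inverse) (rule of_nat_neq_0)
    ultimately show ?case by (simp only: F.scale_scale F.scale_one)
  qed
  then show ?thesis using mpow.base[OF l(1)] by (cases j) auto
qed

lemma joint_eigenvector_rho:
  assumes "joint_eigenvector \<eta>" "g \<in> carrier G"
  shows "joint_eigenvector (rho g \<eta>)"
proof -
  obtain l where l: "\<eta> \<in> R" "\<And>b. b \<in> basis \<Longrightarrow> Dop b \<eta> = fscale (l b) \<eta>"
    using assms(1) unfolding joint_eigenvector_def by blast
  have "Dop b (rho g \<eta>) = fscale (l b) (rho g \<eta>)" if "b \<in> basis" for b
    using l that assms(2) by (simp add: LieD(6)[OF Dop_Lie] rho_simps)
  then show ?thesis unfolding joint_eigenvector_def using l(1) assms(2) rho_R by blast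
qed

lemma joint_eigenvector_zero:
  assumes \<eta>: "joint_eigenvector \<eta>" and g: "g \<in> carrier G" "\<eta> g = 0"
  shows "\<eta> = 0"
proof -
  have \<eta>R: "\<eta> \<in> R" using \<eta> unfolding joint_eigenvector_def by blast
  define Z where "Z = {h \<in> carrier G. \<eta> h = 0}"
  have "Z = {} \<or> Z = carrier G"
  proof (rule R_connected)
    show "Z \<subseteq> carrier G" unfolding Z_def by blast
    fix h assume "h \<in> carrier G - Z"
    then show "\<exists>c\<in>R. c h \<noteq> 0 \<and> (\<forall>h\<in>carrier G. c h \<noteq> 0 \<longrightarrow> h \<notin> Z)"
      unfolding Z_def using \<eta>R by blast
  next
    fix h assume "h \<in> Z"
    then have h: "h \<in> carrier G" "\<eta> h = 0" unfolding Z_def by auto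
    \<comment> \<open>Translation by \<open>h\<close> moves the zero to the identity, where Krull's
      theorem is available; translation by \<open>inv h\<close> moves the resulting neighbourhood
      back.\<close>
    have "M j (rho h \<eta>)" for j
      using h by (intro joint_eigenvector_M joint_eigenvector_rho \<eta>) (simp_all add: rho_apply)
    from R_krull[OF this] obtain c where c: "c \<in> R" "c \<one> \<noteq> 0"
      "\<And>g. g \<in> carrier G \<Longrightarrow> c g \<noteq> 0 \<Longrightarrow> rho h \<eta> g = 0" by blast
    have hi: "inv h \<in> carrier G" using h by simp
    show "\<exists>c\<in>R. c h \<noteq> 0 \<and> (\<forall>h\<in>carrier G. c h \<noteq> 0 \<longrightarrow> h \<in> Z)"
    proof (intro bexI[of _ "rho (inv h) c"] conjI ballI impI)
      show "rho (inv h) c \<in> R" using c hi by (intro rho_R)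
      show "rho (inv h) c h \<noteq> 0" using c h by (simp add: rho_apply)
      fix k assume k: "k \<in> carrier G" "rho (inv h) c k \<noteq> 0"
      then have "rho h \<eta> (k \<otimes> inv h) = 0" using c(3)[of "k \<otimes> inv h"] hi by (simp add: rho_apply)
      then have "\<eta> k = 0" using k h hi by (simp add: rho_apply m_assoc)
      then show "k \<in> Z" unfolding Z_def using k by blast
    qed
  qed
  then have "Z = carrier G" using g unfolding Z_def by blast
  then show ?thesis by (intro R_eqI[OF \<eta>R R_zero]) (auto simp: Z_def fun_simps)
qed

text \<open>The combination of \<open>\<psi>\<close> and a translate of it that vanishes at the
  identity is an eigenvector for the same eigenvalues, hence zero. After normalization at the
  identity this says that \<open>\<psi>\<close> is multiplicative.\<close>

lemma joint_eigenvector_const: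
  assumes \<psi>: "joint_eigenvector \<psi>"
  shows "\<exists>c. \<psi> = cst c"
proof (cases "\<psi> = 0")
  case True
  then show ?thesis using cst_eq_0 by metis
next
  case False
  then have nz: "\<psi> g \<noteq> 0" if "g \<in> carrier G" for g
    using joint_eigenvector_zero[OF \<psi> that] by blast
  obtain l where l: "\<psi> \<in> R" "\<And>b. b \<in> basis \<Longrightarrow> Dop b \<psi> = fscale (l b) \<psi>"
    using \<psi> unfolding joint_eigenvector_def by blast
  have mult: "\<psi> (h \<otimes> g) * \<psi> \<one> = \<psi> h * \<psi> g" if h: "h \<in> carrier G" and g: "g \<in> carrier G" for g h
  proof -
    define \<eta> where "\<eta> = fscale (\<psi> \<one>) (rho g \<psi>) - fscale (\<psi> g) \<psi>"
    have \<eta>R: "\<eta> \<in> R" unfolding \<eta>_def using l(1) g by (intro R_diff R_scale rho_R)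
    have "Dop b \<eta> = fscale (l b) \<eta>" if b: "b \<in> basis" for b
    proof -
      have "Dop b \<eta> = Dop b (fscale (\<psi> \<one>) (rho g \<psi>)) - Dop b (fscale (\<psi> g) \<psi>)"
        unfolding \<eta>_def using l(1) g
        by (intro F.lin_onD(6)[OF Lie_lin[OF Dop_Lie[OF b]]] R_scale rho_R)
      also have "\<dots> = fscale (l b) \<eta>"
        unfolding \<eta>_def using l g b
        by (simp add: LieD(7)[OF Dop_Lie] LieD(6)[OF Dop_Lie] rho_R rho_simps F.scale_right_diff_distrib mult.commute)
      finally show ?thesis .
    qed
    then have "joint_eigenvector \<eta>" unfolding joint_eigenvector_def using \<eta>R by blast
    moreover have "\<eta> \<one> = 0" unfolding \<eta>_def using g by (simp add: fun_simps rho_apply)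
    ultimately have "\<eta> = 0" using joint_eigenvector_zero[of \<eta> \<one>] by simp
    then have "\<eta> h = 0" by (simp add: fun_simps)
    then show ?thesis unfolding \<eta>_def using h by (simp add: fun_simps rho_apply mult.commute)
  qed
  have "fscale (1 / \<psi> \<one>) \<psi> g = 1" if "g \<in> carrier G" for g
  proof (rule R_characters[OF R_scale[OF l(1)] _ _ that])
    show "fscale (1 / \<psi> \<one>) \<psi> \<one> = 1" using nz by (simp add: fun_simps)
    show "fscale (1 / \<psi> \<one>) \<psi> (g \<otimes> h) = fscale (1 / \<psi> \<one>) \<psi> g * fscale (1 / \<psi> \<one>) \<psi> h"
      if "g \<in> carrier G" "h \<in> carrier G" for g h
      using mult[OF that] nz[of \<one>] by (simp add: fun_simps field_simps)
  qed
  note chi = this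
  have const: "\<psi> g = \<psi> \<one>" if g: "g \<in> carrier G" for g
  proof -
    have "1 / \<psi> \<one> * \<psi> g = 1" using chi[OF g] by (simp only: fscale_apply)
    then show ?thesis using nz[of \<one>] by simp
  qed
  have "\<psi> = cst (\<psi> \<one>)"
  proof (rule R_eqI[OF l(1) cst_R])
    fix g assume g: "g \<in> carrier G"
    from const[OF g] show "\<psi> g = cst (\<psi> \<one>) g" by (simp only: cst_apply[OF g])
  qed
  then show ?thesis ..
qed

text \<open>Simultaneous diagonalization: the \<open>Dop b\<close> commute and act semisimply on
  these functions, so one after another can be diagonalized on the joint eigenspaces of the previous
  ones.\<close>

theorem nil_invariants_const:
  assumes \<phi>: "\<phi> \<in> nil_invariants"
  shows "\<exists>c. \<phi> = cst c"
proof -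
  define J where "J B = {v \<in> nil_invariants. \<forall>b\<in>B. \<exists>a. Dop b v = fscale a v}" for B
  have "nil_invariants \<subseteq> F.span (J B)" if "finite B" "B \<subseteq> basis" for B
    using that
  proof (induction B)
    case empty
    show ?case unfolding J_def using F.span_superset by auto
  next
    case (insert b B)
    have b: "b \<in> basis" and B: "B \<subseteq> basis" using insert.prems by auto
    note D = Dop_Lie[OF b]
    have "J B \<subseteq> F.span (J (insert b B))"
    proof
      fix v assume v: "v \<in> J B"
      then have "\<forall>b'. \<exists>a. b' \<in> B \<longrightarrow> Dop b' v = fscale a v" unfolding J_def by blast
      from choice[OF this] obtain l where l: "\<And>b'. b' \<in> B \<Longrightarrow> Dop b' v = fscale (l b') v" by blast
      \<comment> \<open>The joint eigenspace of \<open>v\<close> for the derivations already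
        treated; commutativity makes it stable under \<open>Dop b\<close>.\<close>
      define S where "S = {u \<in> nil_invariants. \<forall>b'\<in>B. Dop b' u = fscale (l b') u}"
      have SV: "S \<subseteq> nil_invariants" unfolding S_def by blast
      have lie: "Dop b' \<in> Lie" if "b' \<in> B" for b' using Dop_Lie B that by blast
      have "F.subspace S"
        unfolding S_def
        by (rule F.subspaceI)
          (auto simp: F.subspace_0[OF nil_invariants_subspace] F.subspace_add[OF nil_invariants_subspace] F.subspace_scale[OF nil_invariants_subspace]
            Lie_zero[OF lie] LieD(3)[OF lie nil_invariants_R nil_invariants_R] LieD(7)[OF lie nil_invariants_R] F.scale_right_distrib mult.commute)
      moreover have "Dop b u \<in> S" if u: "u \<in> S" for u
        unfolding S_def
      proof (intro CollectI conjI ballI)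
        have uV: "u \<in> nil_invariants" using u SV by blast
        show "Dop b u \<in> nil_invariants" by (rule nil_invariants_Lie[OF uV D])
        fix b' assume b': "b' \<in> B"
        have "Dop b' (Dop b u) = Dop b (Dop b' u)" by (rule Lie_commute_on_nil_invariants[OF lie[OF b'] D uV])
        also have "Dop b' u = fscale (l b') u" using u b' unfolding S_def by blast
        also have "Dop b (fscale (l b') u) = fscale (l b') (Dop b u)" by (rule LieD(7)[OF D nil_invariants_R[OF uV]])
        finally show "Dop b' (Dop b u) = fscale (l b') (Dop b u)" .
      qed
      ultimately have lin: "F.lin_on S (Dop b)"
        unfolding F.lin_on_def using LieD(3,7)[OF D] nil_invariants_R SV by blast
      have "v \<in> S" using v l unfolding S_def J_def by blast
      moreover have SR: "S \<subseteq> R" using SV nil_invariants_R by blast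
      ultimately obtain A w where A: "\<forall>a\<in>A. w a \<in> F.gen_eigenspace S (Dop b) a" "v = (\<Sum>a\<in>A. w a)"
        using F_decomposition[OF D lin] by blast
      have "w a \<in> F.span (J (insert b B))" if a: "a \<in> A" for a
      proof -
        have wS: "w a \<in> S" "w a \<in> E (Dop b) a"
          using A(1) a gen_eigenspace_mono[OF SR, of "Dop b" a] unfolding F.gen_eigenspace_def by blast+
        then have "Dop b (w a) = fscale a (w a)" using nil_invariants_eigenvector[OF D] SV by blast
        then have "w a \<in> J (insert b B)" using wS(1) unfolding J_def S_def by blast
        then show ?thesis by (rule F.span_base)
      qed
      then show "v \<in> F.span (J (insert b B))" unfolding A(2) by (rule F.span_sum)
    qed
    then have "F.span (J B) \<subseteq> F.span (J (insert b B))" by (simp add: F.span_minimal)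
    then show ?case using insert by blast
  qed
  from this[OF finite_basis order_refl] have "\<phi> \<in> F.span (J basis)" using \<phi> by blast
  moreover have "J basis \<subseteq> {cst c | c. True}"
  proof
    fix v assume v: "v \<in> J basis"
    then have "\<forall>b. \<exists>a. b \<in> basis \<longrightarrow> Dop b v = fscale a v" unfolding J_def by blast
    from choice[OF this] obtain l where "\<And>b. b \<in> basis \<Longrightarrow> Dop b v = fscale (l b) v" by blast
    then have "joint_eigenvector v" unfolding joint_eigenvector_def using v nil_invariants_R unfolding J_def by blast
    then show "v \<in> {cst c | c. True}" using joint_eigenvector_const by blast
  qed
  moreover have "F.subspace {cst c | c. True}"
    by (rule F.subspaceI) (auto simp: cst_add fscale_cst intro: exI[of "\<lambda>c. cst c = 0" 0])
  ultimately show ?thesis using F.span_minimal by blast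
qed

end

section \<open>One-parameter subgroups\<close>

text \<open>A formal uniqueness theorem for a linear system of differential equations indexed by
  \<open>R\<close>: in characteristic 0 each coefficient for \<open>r\<close> is determined by the
  preceding coefficient for \<open>D r\<close>.\<close>

lemma poly_ode_unique:
  fixes p q :: "'r \<Rightarrow> 'k::field_char_0 poly"
  assumes "\<And>r. r \<in> R \<Longrightarrow> D r \<in> R" "\<And>r. r \<in> R \<Longrightarrow> pderiv (p r) = p (D r)"
    "\<And>r. r \<in> R \<Longrightarrow> pderiv (q r) = q (D r)" "\<And>r. r \<in> R \<Longrightarrow> coeff (p r) 0 = coeff (q r) 0" "r \<in> R"
  shows "p r = q r"
proof (rule poly_eqI)
  fix i show "coeff (p r) i = coeff (q r) i"
    using assms(5)
  proof (induction i arbitrary: r)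
    case (Suc i)
    have "of_nat (Suc i) * coeff (p r) (Suc i) = of_nat (Suc i) * coeff (q r) (Suc i)"
      unfolding coeff_pderiv[symmetric] assms(2)[OF Suc.prems] assms(3)[OF Suc.prems]
      by (rule Suc.IH[OF assms(1)[OF Suc.prems]])
    then show ?case by (simp del: of_nat_Suc)
  qed (rule assms(4))
qed

context affine_group_algebra
begin

text \<open>The value of \<open>exp (t D) r\<close> at the identity as a polynomial in
  \<open>t\<close>; local nilpotency makes the sequence of coefficients finite.\<close>

definition exp_poly :: "(('a \<Rightarrow> 'k) \<Rightarrow> 'a \<Rightarrow> 'k) \<Rightarrow> ('a \<Rightarrow> 'k) \<Rightarrow> 'k poly" where
  "exp_poly D r = Abs_poly (\<lambda>i. (D ^^ i) r \<one> / fact i)"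

context
  fixes D assumes D: "D \<in> Lie" and nil: "locally_nilpotent D"
begin

lemma coeff_exp_poly: "r \<in> R \<Longrightarrow> coeff (exp_poly D r) i = (D ^^ i) r \<one> / fact i"
proof -
  assume "r \<in> R"
  then obtain N where N: "(D ^^ N) r = 0" using nil unfolding locally_nilpotent_def by blast
  have zero: "(D ^^ k) 0 = 0" for k by (induction k) (simp_all add: Lie_zero[OF D])
  have "(D ^^ i) r = 0" if "N < i" for i
  proof -
    have "D ^^ i = D ^^ (i - N) \<circ> D ^^ N" using that funpow_add[of "i - N" N D] by simp
    then show ?thesis by (simp only: comp_apply N zero)
  qed
  then have "(D ^^ i) r \<one> / fact i = 0" if "N < i" for i using that by (simp add: fun_simps)
  then have "coeff (Abs_poly (\<lambda>i. (D ^^ i) r \<one> / fact i)) = (\<lambda>i. (D ^^ i) r \<one> / fact i)"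
    by (rule coeff_Abs_poly)
  then show ?thesis unfolding exp_poly_def by simp
qed

lemma exp_poly_pderiv: "r \<in> R \<Longrightarrow> pderiv (exp_poly D r) = exp_poly D (D r)"
  by (rule poly_eqI) (simp add: coeff_pderiv coeff_exp_poly LieD(2)[OF D] funpow_Suc_right divide_simps del: funpow.simps of_nat_Suc)

lemma exp_poly_0: "r \<in> R \<Longrightarrow> coeff (exp_poly D r) 0 = r \<one>"
  by (simp add: coeff_exp_poly)

lemma exp_poly_add: "r \<in> R \<Longrightarrow> s \<in> R \<Longrightarrow> exp_poly D (r + s) = exp_poly D r + exp_poly D s"
  by (rule poly_eqI) (simp add: coeff_exp_poly R_add Lie_funpow(2)[OF D] plus_fun_apply add_divide_distrib)

lemma exp_poly_cst: "exp_poly D (cst c) = [:c:]"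
proof (rule poly_eqI)
  fix i
  have zero: "(D ^^ k) 0 = 0" for k by (induction k) (simp_all add: Lie_zero[OF D])
  have "(D ^^ Suc j) (cst c) = 0" for j
    unfolding funpow_Suc_right comp_apply LieD(5)[OF D] by (rule zero)
  then show "coeff (exp_poly D (cst c)) i = coeff [:c:] i"
    by (cases i) (simp_all add: coeff_exp_poly cst_apply zero_fun_apply del: funpow.simps)
qed

text \<open>Both sides have the same constant term and their derivatives obey the same Leibniz rule,
  so the coefficients agree by induction.\<close>

lemma exp_poly_mult:
  assumes "r \<in> R" "s \<in> R"
  shows "exp_poly D (r * s) = exp_poly D r * exp_poly D s"
proof (rule poly_eqI)
  fix i show "coeff (exp_poly D (r * s)) i = coeff (exp_poly D r * exp_poly D s) i"
    using assms
  proof (induction i arbitrary: r s)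
    case 0
    have "(r * s) \<one> = r \<one> * s \<one>" by (rule times_fun_apply)
    then show ?case using 0 by (simp add: exp_poly_0 R_mult coeff_mult)
  next
    case (Suc i)
    note Dr = LieD(2)[OF D Suc.prems(1)] and Ds = LieD(2)[OF D Suc.prems(2)]
    have "pderiv (exp_poly D (r * s)) = exp_poly D (D r * s) + exp_poly D (r * D s)"
      using Suc.prems Dr Ds by (simp add: exp_poly_pderiv R_mult LieD(4)[OF D] exp_poly_add)
    then have "coeff (pderiv (exp_poly D (r * s))) i =
        coeff (exp_poly D (D r) * exp_poly D s) i + coeff (exp_poly D r * exp_poly D (D s)) i"
      using Suc.IH[OF Dr Suc.prems(2)] Suc.IH[OF Suc.prems(1) Ds] by simp
    also have "\<dots> = coeff (pderiv (exp_poly D r * exp_poly D s)) i"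
      using Suc.prems by (simp add: pderiv_mult exp_poly_pderiv mult.commute)
    finally have "of_nat (Suc i) * coeff (exp_poly D (r * s)) (Suc i) =
        of_nat (Suc i) * coeff (exp_poly D r * exp_poly D s) (Suc i)"
      unfolding coeff_pderiv .
    then show ?case by (simp del: of_nat_Suc)
  qed
qed

text \<open>For fixed \<open>t\<close>, evaluating \<open>exp_poly D r\<close> at \<open>t\<close>
  is an algebra homomorphism in \<open>r\<close>, hence evaluation at a point. Additivity in
  \<open>t\<close> comes from uniqueness for the differential equation: translation by
  \<open>u t\<close> and a shift of the variable by \<open>t\<close> give solutions with the same
  initial values.\<close>

lemma one_parameter_subgroup:
  obtains u where "\<And>t. u t \<in> carrier G" "\<And>r t. r \<in> R \<Longrightarrow> r (u t) = poly (exp_poly D r) t"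
    "\<And>s t. u (s + t) = u s \<otimes> u t"
proof -
  have "\<exists>g\<in>carrier G. \<forall>r\<in>R. r g = poly (exp_poly D r) t" for t
    by (rule R_points) (simp_all add: exp_poly_add exp_poly_mult exp_poly_cst[unfolded cst_def])
  then have "\<forall>t. \<exists>g. g \<in> carrier G \<and> (\<forall>r\<in>R. r g = poly (exp_poly D r) t)" by blast
  from choice[OF this] obtain u where u: "\<And>t. u t \<in> carrier G"
    "\<And>r t. r \<in> R \<Longrightarrow> r (u t) = poly (exp_poly D r) t" by blast
  have "u (s + t) = u s \<otimes> u t" for s t
  proof (rule R_separates[OF u(1) m_closed[OF u(1) u(1)]])
    fix r assume r: "r \<in> R"
    have "exp_poly D (rho (u t) r) = pcompose (exp_poly D r) [:t, 1:]"
    proof (rule poly_ode_unique[where D=D and R=R, OF LieD(2)[OF D] _ _ _ r])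
      fix r assume r: "r \<in> R"
      show "pderiv (exp_poly D (rho (u t) r)) = exp_poly D (rho (u t) (D r))"
        using r u(1) by (simp add: exp_poly_pderiv rho_R LieD(6)[OF D])
      show "pderiv (pcompose (exp_poly D r) [:t, 1:]) = pcompose (exp_poly D (D r)) [:t, 1:]"
        using r by (simp add: pderiv_pcompose exp_poly_pderiv pderiv_pCons)
      have "coeff (pcompose (exp_poly D r) [:t, 1:]) 0 = poly (exp_poly D r) t"
        by (simp add: poly_0_coeff_0[symmetric] poly_pcompose)
      then show "coeff (exp_poly D (rho (u t) r)) 0 = coeff (pcompose (exp_poly D r) [:t, 1:]) 0"
        using r u by (simp add: exp_poly_0 rho_R rho_apply)
    qed
    moreover have "r (u s \<otimes> u t) = poly (exp_poly D (rho (u t) r)) s"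
      using u(2)[OF rho_R[OF r u(1)], of t s] u(1) by (simp add: rho_apply)
    ultimately show "r (u (s + t)) = r (u s \<otimes> u t)"
      using u(2)[OF r] by (simp add: poly_pcompose add.commute)
  qed
  with u show thesis by (rule that)
qed

text \<open>The derivative of \<open>r (u t \<otimes> g)\<close> at \<open>t = 0\<close> is
  \<open>D r g\<close>, read off as the linear coefficient of
  \<open>exp_poly D (rho g r)\<close>.\<close>

lemma invariant_imp_killed:
  assumes u: "\<And>t. u t \<in> carrier G" "\<And>r t. r \<in> R \<Longrightarrow> r (u t) = poly (exp_poly D r) t"
    and r: "r \<in> R" and inv: "\<And>t g. g \<in> carrier G \<Longrightarrow> r (u t \<otimes> g) = r g"
  shows "D r = 0"
proof (rule R_eqI[OF LieD(2)[OF D r] R_zero])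
  fix g assume g: "g \<in> carrier G"
  have "poly (exp_poly D (rho g r)) t = poly [:r g:] t" for t
    using u(2)[OF rho_R[OF r g], of t] inv[OF g, of t] u(1) by (simp add: rho_apply)
  then have "exp_poly D (rho g r) = [:r g:]" using poly_eq_poly_eq_iff by blast
  then have "coeff (exp_poly D (rho g r)) 1 = 0" by simp
  then have "D (rho g r) \<one> = 0" using coeff_exp_poly[OF rho_R[OF r g], of 1] by simp
  then show "D r g = 0 g" using Lie_at_one'[OF D r g] by (simp add: zero_fun_apply)
qed

end

theorem one_parameter_invariant_const:
  assumes \<phi>: "\<phi> \<in> R"
    and inv: "\<And>u t g. (\<And>t. u t \<in> carrier G) \<Longrightarrow> (\<And>s t. u (s + t) = u s \<otimes> u t) \<Longrightarrow>
      (\<And>r. r \<in> R \<Longrightarrow> \<exists>p. \<forall>t. r (u t) = poly p t) \<Longrightarrow> g \<in> carrier G \<Longrightarrow> \<phi> (u t \<otimes> g) = \<phi> g"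
  shows "\<exists>c. \<forall>g\<in>carrier G. \<phi> g = c"
proof -
  have "\<phi> \<in> nil_invariants"
    unfolding nil_invariants_def
  proof (intro CollectI conjI ballI impI \<phi>)
    fix D assume D: "D \<in> Lie" "locally_nilpotent D"
    obtain u where u: "\<And>t. u t \<in> carrier G" "\<And>r t. r \<in> R \<Longrightarrow> r (u t) = poly (exp_poly D r) t"
      "\<And>s t. u (s + t) = u s \<otimes> u t"
      by (rule one_parameter_subgroup[OF D]) (rule that)
    have "\<phi> (u t \<otimes> g) = \<phi> g" if "g \<in> carrier G" for t g
      using u by (intro inv that) blast+
    then show "D \<phi> = 0" by (intro invariant_imp_killed[OF D u(1,2) \<phi>])
  qed
  then obtain c where "\<phi> = cst c" using nil_invariants_const by blast
  then show ?thesis by (intro exI[of _ c]) (simp add: cst_apply)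
qed

end

section \<open>Morphisms of spaces with functions\<close>

lemma morphism_comp:
  assumes \<phi>: "morphism X Y \<phi>" and \<psi>: "morphism Y Z \<psi>"
  shows "morphism X Z (\<psi> \<circ> \<phi>)"
  unfolding morphism_def
proof (intro conjI allI impI)
  have c: "continuous_map (Top X) (Top Y) \<phi>" "continuous_map (Top Y) (Top Z) \<psi>"
    using assms unfolding morphism_def by auto
  then show "continuous_map (Top X) (Top Z) (\<psi> \<circ> \<phi>)" by (rule continuous_map_compose)
  fix V f assume Vf: "openin (Top Z) V \<and> f \<in> Reg Z V"
  define V1 where "V1 = {y \<in> pts Y. \<psi> y \<in> V}"
  have V1: "openin (Top Y) V1" unfolding V1_def using c(2) Vf by (intro openin_continuous_map_preimage) auto
  have "restrict (f \<circ> \<psi>) V1 \<in> Reg Y V1" unfolding V1_def using \<psi> Vf unfolding morphism_def by blast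
  with V1 have *: "restrict (restrict (f \<circ> \<psi>) V1 \<circ> \<phi>) {x \<in> pts X. \<phi> x \<in> V1} \<in> Reg X {x \<in> pts X. \<phi> x \<in> V1}"
    using \<phi> unfolding morphism_def by blast
  have "\<phi> x \<in> pts Y" if "x \<in> pts X" for x using c(1) that continuous_map_funspace by fastforce
  then have "{x \<in> pts X. \<phi> x \<in> V1} = {x \<in> pts X. (\<psi> \<circ> \<phi>) x \<in> V}" unfolding V1_def by auto
  moreover from this have "restrict (restrict (f \<circ> \<psi>) V1 \<circ> \<phi>) {x \<in> pts X. \<phi> x \<in> V1} =
      restrict (f \<circ> (\<psi> \<circ> \<phi>)) {x \<in> pts X. (\<psi> \<circ> \<phi>) x \<in> V}"
    by (auto simp: restrict_def fun_eq_iff)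
  ultimately show "restrict (f \<circ> (\<psi> \<circ> \<phi>)) {x \<in> pts X. (\<psi> \<circ> \<phi>) x \<in> V} \<in> Reg X {x \<in> pts X. (\<psi> \<circ> \<phi>) x \<in> V}"
    using * by simp
qed

lemma morphism_cong:
  assumes "morphism X Y \<phi>" "\<And>x. x \<in> pts X \<Longrightarrow> \<phi> x = \<psi> x"
  shows "morphism X Y \<psi>"
proof -
  have "{x \<in> pts X. \<psi> x \<in> V} = {x \<in> pts X. \<phi> x \<in> V}" for V using assms(2) by auto
  moreover have "restrict (f \<circ> \<psi>) {x \<in> pts X. \<phi> x \<in> V} = restrict (f \<circ> \<phi>) {x \<in> pts X. \<phi> x \<in> V}" for f :: "'c \<Rightarrow> 'b" and V
    using assms(2) by (auto simp: restrict_def fun_eq_iff)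
  moreover have "continuous_map (Top X) (Top Y) \<psi>"
    using assms continuous_map_eq unfolding morphism_def by blast
  ultimately show ?thesis using assms(1) unfolding morphism_def by simp
qed

lemma morphism_pts: "morphism X Y \<phi> \<Longrightarrow> x \<in> pts X \<Longrightarrow> \<phi> x \<in> pts Y"
  unfolding morphism_def using continuous_map_funspace by fastforce

section \<open>Zariski spaces of rings of functions\<close>

lemma Top_zariski: "Top (zariski_space V P) = topology_generated_by {{x \<in> V. p x \<noteq> 0} | p. p \<in> P}"
  by (simp add: zariski_space_def Let_def)

lemma Reg_zariski: "Reg (zariski_space V P) U = {f \<in> extensional U. \<forall>x\<in>U. \<exists>W p q.
    openin (Top (zariski_space V P)) W \<and> x \<in> W \<and> W \<subseteq> U \<and> p \<in> P \<and> q \<in> P \<and> (\<forall>y\<in>W. q y \<noteq> 0 \<and> f y = p y / q y)}"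
  by (simp add: zariski_space_def Let_def)

lemma zariski_open_basic: "p \<in> P \<Longrightarrow> openin (Top (zariski_space V P)) {x \<in> V. p x \<noteq> 0}"
  unfolding Top_zariski by (rule topology_generated_by_Basis) (rule CollectI, rule exI[of _ p], simp)

lemma pts_zariski:
  assumes "(\<lambda>x. 1) \<in> P"
  shows "pts (zariski_space V P) = V"
proof
  show "pts (zariski_space V P) \<subseteq> V"
    unfolding Top_zariski topology_generated_by_topspace by auto
  show "V \<subseteq> pts (zariski_space V P)"
    using openin_subset[OF zariski_open_basic[OF assms, of V]] by simp
qed

text \<open>Closure of \<open>P\<close> under products turns the generating family of principal open
  sets into a basis.\<close>

lemma zariski_open_contains_basic:
  assumes P: "\<And>p q. p \<in> P \<Longrightarrow> q \<in> P \<Longrightarrow> (\<lambda>x. p x * q x :: 'k::field) \<in> P"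
    and W: "openin (Top (zariski_space V P)) W" "x \<in> W"
  shows "\<exists>s\<in>P. s x \<noteq> 0 \<and> {y \<in> V. s y \<noteq> 0} \<subseteq> W"
proof -
  have "generate_topology_on {{x \<in> V. p x \<noteq> 0} | p. p \<in> P} W"
    using W(1) unfolding Top_zariski by (rule openin_topology_generated_by)
  then show ?thesis using W(2)
  proof (induction W rule: generate_topology_on.induct)
    case (Int U W)
    then obtain s t where "s \<in> P" "s x \<noteq> 0" "{y \<in> V. s y \<noteq> 0} \<subseteq> U" "t \<in> P" "t x \<noteq> 0" "{y \<in> V. t y \<noteq> 0} \<subseteq> W"
      by blast
    then show ?case using P by (intro bexI[of _ "\<lambda>x. s x * t x"]) auto
  qed blast+
qed

lemma zariski_morphism:
  fixes P :: "('x \<Rightarrow> 'k::field) set" and Q :: "('y \<Rightarrow> 'k) set"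
  assumes one: "(\<lambda>x. 1) \<in> P" "(\<lambda>x. 1) \<in> Q" and V: "\<And>x. x \<in> V \<Longrightarrow> \<phi> x \<in> W"
    and pull: "\<And>q. q \<in> Q \<Longrightarrow> \<exists>p\<in>P. \<forall>x\<in>V. q (\<phi> x) = p x"
  shows "morphism (zariski_space V P) (zariski_space W Q) \<phi>"
proof -
  let ?X = "zariski_space V P" and ?Y = "zariski_space W Q"
  have pts: "pts ?X = V" "pts ?Y = W" by (rule pts_zariski[OF one(1)], rule pts_zariski[OF one(2)])
  have cont: "continuous_map (Top ?X) (Top ?Y) \<phi>"
    unfolding Top_zariski[of W Q]
  proof (rule continuous_on_generated_topo)
    fix U assume "U \<in> {{x \<in> W. p x \<noteq> 0} | p. p \<in> Q}"
    then obtain q where q: "q \<in> Q" "U = {x \<in> W. q x \<noteq> 0}" by blast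
    obtain p where p: "p \<in> P" "\<And>x. x \<in> V \<Longrightarrow> q (\<phi> x) = p x" using pull[OF q(1)] by blast
    have "\<phi> -` U \<inter> pts ?X = {x \<in> V. p x \<noteq> 0}" unfolding pts(1) using q(2) p(2) V by auto
    then show "openin (Top ?X) (\<phi> -` U \<inter> pts ?X)" using zariski_open_basic[OF p(1)] by simp
  next
    show "\<phi> ` pts ?X \<subseteq> \<Union>{{x \<in> W. p x \<noteq> 0} | p. p \<in> Q}"
      using V unfolding pts(1) topology_generated_by_topspace[symmetric] Top_zariski[symmetric] pts(2) by blast
  qed
  show ?thesis
    unfolding morphism_def
  proof (intro conjI allI impI cont)
    fix U f assume Uf: "openin (Top ?Y) U \<and> f \<in> Reg ?Y U"
    show "restrict (f \<circ> \<phi>) {x \<in> pts ?X. \<phi> x \<in> U} \<in> Reg ?X {x \<in> pts ?X. \<phi> x \<in> U}"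
      unfolding Reg_zariski[of V P]
    proof (intro CollectI conjI ballI)
      fix x assume x: "x \<in> {x \<in> pts ?X. \<phi> x \<in> U}"
      then obtain W' p q where W': "openin (Top ?Y) W'" "\<phi> x \<in> W'" "W' \<subseteq> U" "p \<in> Q" "q \<in> Q"
        "\<And>y. y \<in> W' \<Longrightarrow> q y \<noteq> 0 \<and> f y = p y / q y"
        using Uf unfolding Reg_zariski[of W Q] by blast
      obtain p' where p': "p' \<in> P" "\<And>x. x \<in> V \<Longrightarrow> p (\<phi> x) = p' x" using pull[OF W'(4)] by blast
      obtain q' where q': "q' \<in> P" "\<And>x. x \<in> V \<Longrightarrow> q (\<phi> x) = q' x" using pull[OF W'(5)] by blast
      have "openin (Top ?X) {x \<in> pts ?X. \<phi> x \<in> W'}" by (rule openin_continuous_map_preimage[OF cont W'(1)])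
      moreover have "x \<in> {x \<in> pts ?X. \<phi> x \<in> W'}" using x W'(2) by blast
      moreover have "{x \<in> pts ?X. \<phi> x \<in> W'} \<subseteq> {x \<in> pts ?X. \<phi> x \<in> U}" using W'(3) by blast
      moreover have "q' y \<noteq> 0 \<and> restrict (f \<circ> \<phi>) {x \<in> pts ?X. \<phi> x \<in> U} y = p' y / q' y"
        if y: "y \<in> {x \<in> pts ?X. \<phi> x \<in> W'}" for y
        using W'(6)[of "\<phi> y"] W'(3) y p'(2)[of y] q'(2)[of y] pts(1) by auto
      ultimately show "\<exists>W p q. openin (Top ?X) W \<and> x \<in> W \<and> W \<subseteq> {x \<in> pts ?X. \<phi> x \<in> U} \<and> p \<in> P \<and> q \<in> P \<and>
          (\<forall>y\<in>W. q y \<noteq> 0 \<and> restrict (f \<circ> \<phi>) {x \<in> pts ?X. \<phi> x \<in> U} y = p y / q y)"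
        using p'(1) q'(1) by (intro exI[of _ "{x \<in> pts ?X. \<phi> x \<in> W'}"] exI[of _ p'] exI[of _ q']) simp
    qed auto
  qed
qed

text \<open>A fixed isomorphism with a zero locus: \<open>\<xi>\<close> gives the coordinates of a
  point and \<open>\<zeta>\<close> the point with given coordinates.\<close>

locale affine_coords =
  fixes X :: "('x, 'k::field) fun_space" and n :: nat and S :: "((nat \<Rightarrow> 'k) \<Rightarrow> 'k) set"
    and \<xi> :: "'x \<Rightarrow> nat \<Rightarrow> 'k" and \<zeta> :: "(nat \<Rightarrow> 'k) \<Rightarrow> 'x"
  assumes S: "S \<subseteq> poly_funs n"
    and \<xi>: "morphism X (zariski_space (zero_locus n S) (poly_funs n)) \<xi>"
    and \<zeta>: "morphism (zariski_space (zero_locus n S) (poly_funs n)) X \<zeta>"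
    and \<zeta>\<xi>: "\<And>x. x \<in> pts X \<Longrightarrow> \<zeta> (\<xi> x) = x"
    and \<xi>\<zeta>: "\<And>y. y \<in> zero_locus n S \<Longrightarrow> \<xi> (\<zeta> y) = y"
begin

abbreviation Z where "Z \<equiv> zariski_space (zero_locus n S) (poly_funs n)"

lemma pts_Z: "pts Z = zero_locus n S" by (rule pts_zariski[OF poly_funs.const])

lemma \<xi>_in: "x \<in> pts X \<Longrightarrow> \<xi> x \<in> zero_locus n S" using morphism_pts[OF \<xi>] pts_Z by blast

lemma \<zeta>_in: "y \<in> zero_locus n S \<Longrightarrow> \<zeta> y \<in> pts X" using morphism_pts[OF \<zeta>] pts_Z by blast

text \<open>The denominator is multiplied by a function that cuts out a small principal open set, so
  that its nonvanishing also forces the point into \<open>U\<close>.\<close>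

lemma regular_fraction:
  assumes U: "openin (Top X) U" "x \<in> U" and f: "f \<in> Reg X U"
  shows "\<exists>s\<in>poly_funs n. \<exists>p\<in>poly_funs n. s (\<xi> x) \<noteq> 0 \<and>
    (\<forall>y\<in>pts X. s (\<xi> y) \<noteq> 0 \<longrightarrow> y \<in> U \<and> s (\<xi> y) * f y = p (\<xi> y))"
proof -
  have x: "x \<in> pts X" using openin_subset[OF U(1)] U(2) by blast
  let ?U = "{y \<in> pts Z. \<zeta> y \<in> U}"
  have "restrict (f \<circ> \<zeta>) ?U \<in> Reg Z ?U" using \<zeta> U(1) f unfolding morphism_def by blast
  moreover have "\<xi> x \<in> ?U" using U x \<xi>_in by (simp add: \<zeta>\<xi> pts_Z)
  ultimately obtain W p q where W: "openin (Top Z) W" "\<xi> x \<in> W" "W \<subseteq> ?U" "p \<in> poly_funs n" "q \<in> poly_funs n"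
    "\<And>y. y \<in> W \<Longrightarrow> q y \<noteq> 0 \<and> restrict (f \<circ> \<zeta>) ?U y = p y / q y"
    unfolding Reg_zariski by blast
  obtain s where s: "s \<in> poly_funs n" "s (\<xi> x) \<noteq> 0" "{y \<in> zero_locus n S. s y \<noteq> 0} \<subseteq> W"
    using zariski_open_contains_basic[OF poly_funs.mult W(1,2)] by blast
  have "y \<in> U \<and> s (\<xi> y) * q (\<xi> y) * f y = s (\<xi> y) * p (\<xi> y)"
    if y: "y \<in> pts X" "s (\<xi> y) * q (\<xi> y) \<noteq> 0" for y
  proof -
    have yW: "\<xi> y \<in> W" using s(3) \<xi>_in[OF y(1)] y(2) by auto
    then have "\<zeta> (\<xi> y) \<in> U" using W(3) by blast
    then have yU: "y \<in> U" using \<zeta>\<xi>[OF y(1)] by simp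
    have "f y = p (\<xi> y) / q (\<xi> y)" "q (\<xi> y) \<noteq> 0"
      using W(6)[OF yW] subsetD[OF W(3) yW] \<zeta>\<xi>[OF y(1)] by auto
    with yU show ?thesis by simp
  qed
  moreover have "s (\<xi> x) * q (\<xi> x) \<noteq> 0" using s(2) W(2,6) by simp
  ultimately show ?thesis
    using s(1) W(4,5)
    by (intro bexI[of _ "\<lambda>z. s z * q z"] bexI[of _ "\<lambda>z. s z * p z"]) (auto intro: poly_funs.mult)
qed

lemma basic_open: "p \<in> poly_funs n \<Longrightarrow> openin (Top X) {x \<in> pts X. p (\<xi> x) \<noteq> 0}"
proof -
  assume p: "p \<in> poly_funs n"
  have "continuous_map (Top X) (Top Z) \<xi>" using \<xi> unfolding morphism_def by blast
  from openin_continuous_map_preimage[OF this zariski_open_basic[OF p]]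
  have "openin (Top X) {x \<in> pts X. \<xi> x \<in> {y \<in> zero_locus n S. p y \<noteq> 0}}" .
  also have "{x \<in> pts X. \<xi> x \<in> {y \<in> zero_locus n S. p y \<noteq> 0}} = {x \<in> pts X. p (\<xi> x) \<noteq> 0}"
    using \<xi>_in by blast
  finally show ?thesis .
qed

lemma polynomial_regular: "p \<in> poly_funs n \<Longrightarrow> (\<lambda>x\<in>pts X. p (\<xi> x)) \<in> Reg X (pts X)"
proof -
  assume p: "p \<in> poly_funs n"
  have openZ: "openin (Top Z) (zero_locus n S)" using pts_Z openin_topspace by metis
  have "restrict p (zero_locus n S) \<in> Reg Z (zero_locus n S)"
    unfolding Reg_zariski
  proof (intro CollectI conjI ballI)
    fix x assume "x \<in> zero_locus n S"
    then show "\<exists>W q r. openin (Top Z) W \<and> x \<in> W \<and> W \<subseteq> zero_locus n S \<and> q \<in> poly_funs n \<and> r \<in> poly_funs n \<and>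
        (\<forall>y\<in>W. r y \<noteq> 0 \<and> restrict p (zero_locus n S) y = q y / r y)"
      using openZ p poly_funs.const[of 1 n]
      by (intro exI[of _ "zero_locus n S"] exI[of _ p] exI[of _ "\<lambda>_. 1"]) simp
  qed simp
  then have "restrict (restrict p (zero_locus n S) \<circ> \<xi>) {x \<in> pts X. \<xi> x \<in> zero_locus n S} \<in> Reg X {x \<in> pts X. \<xi> x \<in> zero_locus n S}"
    using \<xi> openZ unfolding morphism_def by blast
  moreover have "{x \<in> pts X. \<xi> x \<in> zero_locus n S} = pts X" using \<xi>_in by blast
  moreover have "restrict (restrict p (zero_locus n S) \<circ> \<xi>) (pts X) = (\<lambda>x\<in>pts X. p (\<xi> x))"
    using \<xi>_in by (auto simp: restrict_def fun_eq_iff)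
  ultimately show ?thesis by simp
qed

text \<open>Elements of \<open>poly_funs n\<close> see only the first \<open>n\<close> coordinates,
  so \<open>z\<close> is compared with points only there and is cut down to an extensional
  function.\<close>

lemma not_in_zero_locus:
  assumes "\<And>x. x \<in> pts X \<Longrightarrow> \<exists>i<n. z i \<noteq> \<xi> x i"
  shows "\<exists>s\<in>S. s z \<noteq> 0"
proof (rule ccontr)
  assume neg: "\<not> ?thesis"
  define y where "y = restrict z {..<n}"
  have eq: "s y = s z" if "s \<in> S" for s
    by (rule poly_funs_cong[of s n]) (use that S in \<open>auto simp: y_def\<close>)
  have "s y = 0" if "s \<in> S" for s using eq[OF that] neg that by auto
  moreover have "y \<in> {..<n} \<rightarrow>\<^sub>E UNIV" by (simp add: y_def)
  ultimately have "y \<in> zero_locus n S" unfolding zero_locus_def by blast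
  then show False using assms[OF \<zeta>_in] \<xi>\<zeta> by (metis lessThan_iff restrict_apply' y_def)
qed

lemma zero_on_pts: "s \<in> S \<Longrightarrow> x \<in> pts X \<Longrightarrow> s (\<xi> x) = 0"
  using \<xi>_in unfolding zero_locus_def by blast

lemma \<xi>_separates:
  assumes "x \<in> pts X" "y \<in> pts X" "\<And>i. i < n \<Longrightarrow> \<xi> x i = \<xi> y i"
  shows "x = y"
proof -
  have e: "\<xi> z \<in> {..<n} \<rightarrow>\<^sub>E UNIV" if "z \<in> pts X" for z
    using \<xi>_in[OF that] unfolding zero_locus_def by blast
  have "\<xi> x = \<xi> y"
    by (rule PiE_ext[OF e[OF assms(1)] e[OF assms(2)]]) (use assms(3) in blast)
  then have "\<zeta> (\<xi> x) = \<zeta> (\<xi> y)" by (rule arg_cong)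
  then show ?thesis unfolding \<zeta>\<xi>[OF assms(1)] \<zeta>\<xi>[OF assms(2)] .
qed

end

lemma affine_variety_coords:
  assumes "affine_variety X"
  obtains n S \<xi> \<zeta> where "affine_coords X n S \<xi> \<zeta>"
proof -
  obtain n S where S: "S \<subseteq> poly_funs n" "isomorphic X (zariski_space (zero_locus n S) (poly_funs n))"
    using assms unfolding affine_variety_def by (elim conjE exE)
  let ?Z = "zariski_space (zero_locus n S) (poly_funs n)"
  obtain \<xi> \<zeta> where iso: "morphism X ?Z \<xi>" "morphism ?Z X \<zeta>" "\<forall>x\<in>pts X. \<zeta> (\<xi> x) = x" "\<forall>y\<in>pts ?Z. \<xi> (\<zeta> y) = y"
    using S(2) unfolding isomorphic_def by (elim exE conjE)
  have "pts ?Z = zero_locus n S" by (rule pts_zariski[OF poly_funs.const])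
  then have "affine_coords X n S \<xi> \<zeta>"
    using S(1) iso unfolding affine_coords_def by simp
  then show thesis by (rule that)
qed

section \<open>Products of spaces with functions\<close>

lemma Top_prod: "Top (prod_space X Y) = topology_generated_by {{z \<in> U \<times> V. h z \<noteq> 0} | U V h.
    openin (Top X) U \<and> openin (Top Y) V \<and> h \<in> tensor_funs X Y U V}"
  by (simp add: prod_space_def Let_def)

lemma Reg_prod: "Reg (prod_space X Y) W = {f \<in> extensional W. \<forall>z\<in>W. \<exists>W' U V p q.
    openin (Top (prod_space X Y)) W' \<and> z \<in> W' \<and> W' \<subseteq> W \<and>
    openin (Top X) U \<and> openin (Top Y) V \<and> W' \<subseteq> U \<times> V \<and>
    p \<in> tensor_funs X Y U V \<and> q \<in> tensor_funs X Y U V \<and> (\<forall>w\<in>W'. q w \<noteq> 0 \<and> f w = p w / q w)}"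
  by (simp add: prod_space_def Let_def)

lemma Reg_prodE:
  assumes "f \<in> Reg (prod_space X Y) W" "z \<in> W"
  obtains W' U V p q where "openin (Top (prod_space X Y)) W'" "z \<in> W'" "W' \<subseteq> W"
    "openin (Top X) U" "openin (Top Y) V" "W' \<subseteq> U \<times> V" "p \<in> tensor_funs X Y U V" "q \<in> tensor_funs X Y U V"
    "\<And>w. w \<in> W' \<Longrightarrow> q w \<noteq> 0 \<and> f w = p w / q w"
  using bspec[OF conjunct2[OF CollectD[OF assms(1)[unfolded Reg_prod]]] assms(2)]
  by (elim exE conjE) (rule that, assumption+, rule bspec)

lemma prod_open_basic:
  "openin (Top X) U \<Longrightarrow> openin (Top Y) V \<Longrightarrow> h \<in> tensor_funs X Y U V \<Longrightarrow>
    openin (Top (prod_space X Y)) {z \<in> U \<times> V. h z \<noteq> 0}"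
  unfolding Top_prod
  by (rule topology_generated_by_Basis) (rule CollectI, rule exI[of _ U], rule exI[of _ V], rule exI[of _ h], simp)

lemma tensor_funs_one:
  assumes "(\<lambda>x\<in>U. 1) \<in> Reg X U" "(\<lambda>y\<in>V. 1) \<in> Reg Y V"
  shows "(\<lambda>(x, y). \<Sum>i<1::nat. (\<lambda>x\<in>U. 1) x * (\<lambda>y\<in>V. 1) y) \<in> tensor_funs X Y U V"
  unfolding tensor_funs_def
  by (rule CollectI, rule exI[of _ 1], rule exI[of _ "\<lambda>_. \<lambda>x\<in>U. 1"], rule exI[of _ "\<lambda>_. \<lambda>y\<in>V. 1"])
    (use assms in simp)

lemma pts_prod:
  assumes "(\<lambda>x\<in>pts X. 1 :: 'k::field) \<in> Reg X (pts X)" "(\<lambda>y\<in>pts Y. 1) \<in> Reg Y (pts Y)"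
  shows "pts (prod_space X Y) = pts X \<times> pts Y"
proof
  show "pts (prod_space X Y) \<subseteq> pts X \<times> pts Y"
    unfolding Top_prod topology_generated_by_topspace by (auto dest: openin_subset)
  have "pts X \<times> pts Y = {z \<in> pts X \<times> pts Y. (\<lambda>(x, y). \<Sum>i<1::nat. (\<lambda>x\<in>pts X. 1) x * (\<lambda>y\<in>pts Y. 1) y) z \<noteq> (0::'k)}"
    by auto
  then have "openin (Top (prod_space X Y)) (pts X \<times> pts Y)"
    using prod_open_basic[OF openin_topspace openin_topspace tensor_funs_one[OF assms]] by metis
  then show "pts X \<times> pts Y \<subseteq> pts (prod_space X Y)" by (rule openin_subset)
qed

lemma space_with_functionsD:
  assumes "space_with_functions X" "openin (Top X) U"
  shows "f \<in> Reg X U \<Longrightarrow> f \<in> extensional U" "(\<lambda>x\<in>U. c) \<in> Reg X U"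
    "openin (Top X) V \<Longrightarrow> V \<subseteq> U \<Longrightarrow> f \<in> Reg X U \<Longrightarrow> restrict f V \<in> Reg X V"
proof -
  note X = assms(1)[unfolded space_with_functions_def]
  note U = X[THEN conjunct1, THEN spec, THEN mp, OF assms(2)]
  show "f \<in> Reg X U \<Longrightarrow> f \<in> extensional U" using U by (elim conjE) (rule subsetD)
  show "(\<lambda>x\<in>U. c) \<in> Reg X U" using U by (elim conjE) (rule spec)
  show "openin (Top X) V \<Longrightarrow> V \<subseteq> U \<Longrightarrow> f \<in> Reg X U \<Longrightarrow> restrict f V \<in> Reg X V"
    using X[THEN conjunct2, THEN conjunct1] assms(2) by simp
qed

lemma tensor_funs_pullback:
  assumes \<phi>: "morphism X X' \<phi>" and U: "openin (Top X') U" and h: "h \<in> tensor_funs X' Y U V"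
  shows "\<exists>h'\<in>tensor_funs X Y {x \<in> pts X. \<phi> x \<in> U} V. \<forall>x\<in>{x \<in> pts X. \<phi> x \<in> U}. \<forall>y. h' (x, y) = h (\<phi> x, y)"
proof -
  obtain m :: nat and f g where h': "h = (\<lambda>(x, y). \<Sum>i<m. f i x * g i y)"
    "\<And>i. i < m \<Longrightarrow> f i \<in> Reg X' U" "\<And>i. i < m \<Longrightarrow> g i \<in> Reg Y V"
    using h unfolding tensor_funs_def by blast
  let ?U = "{x \<in> pts X. \<phi> x \<in> U}"
  have f': "restrict (f i \<circ> \<phi>) ?U \<in> Reg X ?U" if "i < m" for i
    using \<phi> U h'(2)[OF that] unfolding morphism_def by blast
  have "(\<lambda>(x, y). \<Sum>i<m. restrict (f i \<circ> \<phi>) ?U x * g i y) \<in> tensor_funs X Y ?U V"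
    unfolding tensor_funs_def
    by (intro CollectI exI[of _ m] exI[of _ "\<lambda>i. restrict (f i \<circ> \<phi>) ?U"] exI[of _ g]) (use f' h'(3) in blast)
  then show ?thesis
    by (rule bexI[rotated]) (auto simp: h'(1))
qed

text \<open>Tensor functions pull back to tensor functions, hence so do generating open sets and
  local quotients. This turns an action of the group into an action of a one-parameter
  subgroup.\<close>

lemma morphism_prod_left:
  fixes X :: "('x, 'k::field) fun_space" and X' :: "('z, 'k) fun_space" and Y :: "('y, 'k) fun_space"
  assumes \<phi>: "morphism X X' \<phi>"
    and const: "(\<lambda>x\<in>pts X. 1) \<in> Reg X (pts X)" "(\<lambda>x\<in>pts X'. 1) \<in> Reg X' (pts X')" "(\<lambda>y\<in>pts Y. 1) \<in> Reg Y (pts Y)"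
  shows "morphism (prod_space X Y) (prod_space X' Y) (\<lambda>(x, y). (\<phi> x, y))"
proof -
  let ?\<Phi> = "\<lambda>(x, y). (\<phi> x, y :: 'y)" and ?P = "prod_space X Y" and ?P' = "prod_space X' Y"
  note pts = pts_prod[OF const(1,3)] pts_prod[OF const(2,3)]
  have preopen: "openin (Top X) {x \<in> pts X. \<phi> x \<in> U}" if "openin (Top X') U" for U
    using \<phi> that unfolding morphism_def by (intro openin_continuous_map_preimage) auto
  have cont: "continuous_map (Top ?P) (Top ?P') ?\<Phi>"
    unfolding Top_prod[of X' Y]
  proof (rule continuous_on_generated_topo)
    fix B assume "B \<in> {{z \<in> U \<times> V. h z \<noteq> 0} | U V h.
      openin (Top X') U \<and> openin (Top Y) V \<and> h \<in> tensor_funs X' Y U V}"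
    then obtain U V h where B: "B = {z \<in> U \<times> V. h z \<noteq> 0}" "openin (Top X') U" "openin (Top Y) V"
      "h \<in> tensor_funs X' Y U V" by blast
    let ?U = "{x \<in> pts X. \<phi> x \<in> U}"
    obtain h' where h': "h' \<in> tensor_funs X Y ?U V" "\<And>x y. x \<in> ?U \<Longrightarrow> h' (x, y) = h (\<phi> x, y)"
      using tensor_funs_pullback[OF \<phi> B(2,4)] by blast
    have "?\<Phi> -` B \<inter> pts ?P = {z \<in> ?U \<times> V. h' z \<noteq> 0}"
      unfolding pts B(1) using h'(2) openin_subset[OF B(3)] by auto
    then show "openin (Top ?P) (?\<Phi> -` B \<inter> pts ?P)"
      using prod_open_basic[OF preopen[OF B(2)] B(3) h'(1)] by simp
  next
    have "?\<Phi> ` pts ?P \<subseteq> pts ?P'" unfolding pts using morphism_pts[OF \<phi>] by auto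
    then show "?\<Phi> ` pts ?P \<subseteq> \<Union>{{z \<in> U \<times> V. h z \<noteq> 0} | U V h.
      openin (Top X') U \<and> openin (Top Y) V \<and> h \<in> tensor_funs X' Y U V}"
      unfolding Top_prod[of X' Y] topology_generated_by_topspace .
  qed
  show ?thesis
    unfolding morphism_def
  proof (intro conjI allI impI cont)
    fix W f assume Wf: "openin (Top ?P') W \<and> f \<in> Reg ?P' W"
    let ?W = "{z \<in> pts ?P. ?\<Phi> z \<in> W}"
    show "restrict (f \<circ> ?\<Phi>) ?W \<in> Reg ?P ?W"
      unfolding Reg_prod[of X Y]
    proof (intro CollectI conjI ballI)
      fix z assume z: "z \<in> ?W"
      then have "?\<Phi> z \<in> W" by blast
      then obtain W' U V p q where W': "openin (Top ?P') W'" "?\<Phi> z \<in> W'" "W' \<subseteq> W"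
        "openin (Top X') U" "openin (Top Y) V" "W' \<subseteq> U \<times> V"
        "p \<in> tensor_funs X' Y U V" "q \<in> tensor_funs X' Y U V" "\<And>w. w \<in> W' \<Longrightarrow> q w \<noteq> 0 \<and> f w = p w / q w"
        by (rule Reg_prodE[OF conjunct2[OF Wf]]) (rule that)
      let ?U = "{x \<in> pts X. \<phi> x \<in> U}" and ?W' = "{z \<in> pts ?P. ?\<Phi> z \<in> W'}"
      obtain p' where p': "p' \<in> tensor_funs X Y ?U V" "\<And>x y. x \<in> ?U \<Longrightarrow> p' (x, y) = p (\<phi> x, y)"
        using tensor_funs_pullback[OF \<phi> W'(4,7)] by blast
      obtain q' where q': "q' \<in> tensor_funs X Y ?U V" "\<And>x y. x \<in> ?U \<Longrightarrow> q' (x, y) = q (\<phi> x, y)"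
        using tensor_funs_pullback[OF \<phi> W'(4,8)] by blast
      have 1: "openin (Top ?P) ?W'" by (rule openin_continuous_map_preimage[OF cont W'(1)])
      have 2: "z \<in> ?W'" "?W' \<subseteq> ?W" using z W'(2,3) by auto
      have 3: "?W' \<subseteq> ?U \<times> V" using W'(6) unfolding pts by auto
      have 4: "q' w \<noteq> 0 \<and> restrict (f \<circ> ?\<Phi>) ?W w = p' w / q' w" if w: "w \<in> ?W'" for w
      proof -
        have "fst w \<in> ?U" using w 3 by auto
        then have "p' w = p (?\<Phi> w)" "q' w = q (?\<Phi> w)" using p'(2) q'(2) by (cases w; auto)+
        moreover have "restrict (f \<circ> ?\<Phi>) ?W w = f (?\<Phi> w)" using w 2(2) by (auto simp: restrict_def)
        ultimately show ?thesis using W'(9)[of "?\<Phi> w"] w by auto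
      qed
      show "\<exists>W' U V p q. openin (Top ?P) W' \<and> z \<in> W' \<and> W' \<subseteq> ?W \<and> openin (Top X) U \<and> openin (Top Y) V \<and>
          W' \<subseteq> U \<times> V \<and> p \<in> tensor_funs X Y U V \<and> q \<in> tensor_funs X Y U V \<and>
          (\<forall>w\<in>W'. q w \<noteq> 0 \<and> restrict (f \<circ> ?\<Phi>) ?W w = p w / q w)"
        by (intro exI[of _ ?W'] exI[of _ ?U] exI[of _ V] exI[of _ p'] exI[of _ q'] conjI ballI 1 2 3 p'(1) q'(1)
            W'(5) preopen[OF W'(4)] 4[THEN conjunct1] 4[THEN conjunct2])
    qed auto
  qed
qed

section \<open>Local fractions on products\<close>

text \<open>One predicate carries a fraction and the neighbourhood on which it is valid:
  nonvanishing of the denominator forces membership in \<open>U\<close>. Sums, products, inverses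
  and intersections can then be treated together.\<close>

definition local_fraction ::
  "'y set \<Rightarrow> ('y \<Rightarrow> nat \<Rightarrow> 'k::field) \<Rightarrow> nat \<Rightarrow> ('y \<Rightarrow> 'k) \<Rightarrow> 'y \<Rightarrow> 'y set \<Rightarrow> bool" where
  "local_fraction Y e N f y U \<longleftrightarrow> (\<exists>s\<in>poly_funs N. \<exists>p\<in>poly_funs N. s (e y) \<noteq> 0 \<and>
     (\<forall>y'\<in>Y. s (e y') \<noteq> 0 \<longrightarrow> y' \<in> U \<and> s (e y') * f y' = p (e y')))"

lemma local_fractionE:
  assumes "local_fraction Y e N f y U"
  obtains s p where "s \<in> poly_funs N" "p \<in> poly_funs N" "s (e y) \<noteq> 0"
    "\<And>y'. y' \<in> Y \<Longrightarrow> s (e y') \<noteq> 0 \<Longrightarrow> y' \<in> U \<and> s (e y') * f y' = p (e y')"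
  using assms unfolding local_fraction_def by blast

lemma local_fractionI:
  assumes "s \<in> poly_funs N" "p \<in> poly_funs N" "s (e y) \<noteq> 0"
    "\<And>y'. y' \<in> Y \<Longrightarrow> s (e y') \<noteq> 0 \<Longrightarrow> y' \<in> U \<and> s (e y') * f y' = p (e y')"
  shows "local_fraction Y e N f y U"
  using assms unfolding local_fraction_def by blast

lemma local_fraction_const: "local_fraction Y e N (\<lambda>_. c) y UNIV"
  by (rule local_fractionI[of "\<lambda>_. 1" _ "\<lambda>_. c"]) (auto intro: poly_funs.const)

lemma local_fraction_mono:
  "local_fraction Y e N f y U \<Longrightarrow> (\<And>y. y \<in> Y \<Longrightarrow> y \<in> U \<Longrightarrow> y \<in> V \<and> f y = g y) \<Longrightarrow> local_fraction Y e N g y V"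
  unfolding local_fraction_def by (elim bexE) (intro bexI; force)

lemma local_fraction_add_mult:
  assumes "local_fraction Y e N f y U" "local_fraction Y e N g y V"
  shows "local_fraction Y e N (\<lambda>y. f y + g y) y (U \<inter> V)" "local_fraction Y e N (\<lambda>y. f y * g y) y (U \<inter> V)"
proof -
  obtain s p where s: "s \<in> poly_funs N" "p \<in> poly_funs N" "s (e y) \<noteq> 0"
    "\<And>y'. y' \<in> Y \<Longrightarrow> s (e y') \<noteq> 0 \<Longrightarrow> y' \<in> U \<and> s (e y') * f y' = p (e y')"
    by (rule local_fractionE[OF assms(1)]) (rule that)
  obtain t q where t: "t \<in> poly_funs N" "q \<in> poly_funs N" "t (e y) \<noteq> 0"
    "\<And>y'. y' \<in> Y \<Longrightarrow> t (e y') \<noteq> 0 \<Longrightarrow> y' \<in> V \<and> t (e y') * g y' = q (e y')"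
    by (rule local_fractionE[OF assms(2)]) (rule that)
  show "local_fraction Y e N (\<lambda>y. f y + g y) y (U \<inter> V)"
  proof (rule local_fractionI[of "\<lambda>z. s z * t z" _ "\<lambda>z. p z * t z + s z * q z"])
    fix y' assume y: "y' \<in> Y" "s (e y') * t (e y') \<noteq> 0"
    then have "s (e y') * f y' = p (e y')" "t (e y') * g y' = q (e y')" "y' \<in> U \<inter> V" using s(4) t(4) by auto
    then show "y' \<in> U \<inter> V \<and> s (e y') * t (e y') * (f y' + g y') = p (e y') * t (e y') + s (e y') * q (e y')"
      by (auto simp: algebra_simps)
  qed (use s t in \<open>auto intro: poly_funs.intros\<close>)
  show "local_fraction Y e N (\<lambda>y. f y * g y) y (U \<inter> V)"
  proof (rule local_fractionI[of "\<lambda>z. s z * t z" _ "\<lambda>z. p z * q z"])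
    fix y' assume y: "y' \<in> Y" "s (e y') * t (e y') \<noteq> 0"
    then have "s (e y') * f y' = p (e y')" "t (e y') * g y' = q (e y')" "y' \<in> U \<inter> V" using s(4) t(4) by auto
    then show "y' \<in> U \<inter> V \<and> s (e y') * t (e y') * (f y' * g y') = p (e y') * q (e y')"
      by (metis mult.assoc mult.left_commute)
  qed (use s t in \<open>auto intro: poly_funs.intros\<close>)
qed

lemma local_fraction_nonzero:
  assumes "local_fraction Y e N f y U" "f y \<noteq> 0" "y \<in> Y"
  shows "local_fraction Y e N (\<lambda>y. 1 / f y) y (U \<inter> {y. f y \<noteq> 0})"
proof -
  obtain s p where s: "s \<in> poly_funs N" "p \<in> poly_funs N" "s (e y) \<noteq> 0"
    "\<And>y'. y' \<in> Y \<Longrightarrow> s (e y') \<noteq> 0 \<Longrightarrow> y' \<in> U \<and> s (e y') * f y' = p (e y')"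
    by (rule local_fractionE[OF assms(1)]) (rule that)
  \<comment> \<open>From \<open>s * f = p\<close> follows \<open>1 / f = s / p\<close>; the extra
    factor \<open>s\<close> ensures that the relation is available wherever the new denominator does
    not vanish.\<close>
  show ?thesis
  proof (rule local_fractionI[of "\<lambda>z. s z * p z" _ "\<lambda>z. s z * s z"])
    show "s (e y) * p (e y) \<noteq> 0" using s(3) s(4)[OF assms(3) s(3)] assms(2) by (metis mult_eq_0_iff)
    fix y' assume y: "y' \<in> Y" "s (e y') * p (e y') \<noteq> 0"
    then have *: "s (e y') * f y' = p (e y')" "y' \<in> U" using s(4) by auto
    then have "f y' \<noteq> 0" using y(2) by auto
    then show "y' \<in> U \<inter> {y. f y \<noteq> 0} \<and> s (e y') * p (e y') * (1 / f y') = s (e y') * s (e y')"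
      using * by (simp add: *(1)[symmetric])
  qed (use s in \<open>auto intro: poly_funs.intros\<close>)
qed

text \<open>A subset \<open>Y\<close> of a product with coordinates in which functions from either
  factor are local fractions. Besides the square of an affine group this covers a slice over one
  point of a variety that need not be affine.\<close>

locale product_coords =
  fixes X :: "('x, 'k::field) fun_space" and X' :: "('z, 'k) fun_space"
    and Y :: "('x \<times> 'z) set" and e :: "'x \<times> 'z \<Rightarrow> nat \<Rightarrow> 'k" and N :: nat
  assumes X: "space_with_functions X" and X': "space_with_functions X'"
    and fst_fraction: "\<And>U f y. openin (Top X) U \<Longrightarrow> f \<in> Reg X U \<Longrightarrow> y \<in> Y \<Longrightarrow> fst y \<in> U \<Longrightarrow>
      local_fraction Y e N (\<lambda>y. f (fst y)) y (U \<times> UNIV)"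
    and snd_fraction: "\<And>U f y. openin (Top X') U \<Longrightarrow> f \<in> Reg X' U \<Longrightarrow> y \<in> Y \<Longrightarrow> snd y \<in> U \<Longrightarrow>
      local_fraction Y e N (\<lambda>y. f (snd y)) y (UNIV \<times> U)"
begin

lemma tensor_fraction:
  assumes U: "openin (Top X) U" and V: "openin (Top X') V" and h: "h \<in> tensor_funs X X' U V"
    and y: "y \<in> Y" "y \<in> U \<times> V"
  shows "local_fraction Y e N h y (U \<times> V)"
proof -
  obtain m :: nat and f g where h': "h = (\<lambda>(x, y). \<Sum>i<m. f i x * g i y)"
    "\<And>i. i < m \<Longrightarrow> f i \<in> Reg X U" "\<And>i. i < m \<Longrightarrow> g i \<in> Reg X' V"
    using h unfolding tensor_funs_def by blast
  have UV: "fst y \<in> U" "snd y \<in> V" using y by auto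
  have "local_fraction Y e N (\<lambda>y. \<Sum>i<k. f i (fst y) * g i (snd y)) y (U \<times> V)" if "k \<le> m" for k
    using that
  proof (induction k)
    case 0
    \<comment> \<open>Even the empty sum has to record the neighbourhood
      \<open>U \<times> V\<close>, hence zero functions on \<open>U\<close> and on \<open>V\<close>
      instead of a constant with neighbourhood \<open>UNIV\<close>.\<close>
    have 1: "local_fraction Y e N (\<lambda>y. (\<lambda>x\<in>U. 0) (fst y)) y (U \<times> UNIV)"
      by (rule fst_fraction[OF U space_with_functionsD(2)[OF X U] y(1) UV(1)])
    have 2: "local_fraction Y e N (\<lambda>y. (\<lambda>x\<in>V. 0) (snd y)) y (UNIV \<times> V)"
      by (rule snd_fraction[OF V space_with_functionsD(2)[OF X' V] y(1) UV(2)])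
    show ?case
      by (rule local_fraction_mono[OF local_fraction_add_mult(1)[OF 1 2]]) auto
  next
    case (Suc k)
    then have k: "k < m" by simp
    have 1: "local_fraction Y e N (\<lambda>y. f k (fst y)) y (U \<times> UNIV)"
      by (rule fst_fraction[OF U h'(2)[OF k] y(1) UV(1)])
    have 2: "local_fraction Y e N (\<lambda>y. g k (snd y)) y (UNIV \<times> V)"
      by (rule snd_fraction[OF V h'(3)[OF k] y(1) UV(2)])
    have 3: "local_fraction Y e N (\<lambda>y. \<Sum>i<k. f i (fst y) * g i (snd y)) y (U \<times> V)" using Suc by simp
    show ?case
      by (rule local_fraction_mono[OF local_fraction_add_mult(1)[OF 3 local_fraction_add_mult(2)[OF 1 2]]]) auto
  qed
  from this[OF order_refl] show ?thesis by (rule local_fraction_mono) (auto simp: h'(1))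
qed

text \<open>The constant 1 merely records the neighbourhood \<open>W\<close>; on a generating open
  set, given by \<open>h\<close>, it arises as the product of \<open>h\<close> and
  \<open>1 / h\<close>.\<close>

lemma open_fraction:
  assumes "openin (Top (prod_space X X')) W" "y \<in> Y" "y \<in> W"
  shows "local_fraction Y e N (\<lambda>_. 1) y W"
proof -
  have "generate_topology_on {{z \<in> U \<times> V. h z \<noteq> 0} | U V h.
    openin (Top X) U \<and> openin (Top X') V \<and> h \<in> tensor_funs X X' U V} W"
    using assms(1) unfolding Top_prod by (rule openin_topology_generated_by)
  then show ?thesis using assms(3)
  proof (induction W rule: generate_topology_on.induct)
    case (Int U W)
    then have 1: "local_fraction Y e N (\<lambda>_. 1) y U" and 2: "local_fraction Y e N (\<lambda>_. 1) y W" by auto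
    show ?case by (rule local_fraction_mono[OF local_fraction_add_mult(2)[OF 1 2]]) auto
  next
    case (UN K)
    then obtain k where k: "k \<in> K" "y \<in> k" by blast
    show ?case by (rule local_fraction_mono[OF UN.IH[OF k]]) (use k in auto)
  next
    case (Basis B)
    then obtain U V h where B: "B = {z \<in> U \<times> V. h z \<noteq> 0}" "openin (Top X) U" "openin (Top X') V"
      "h \<in> tensor_funs X X' U V" by blast
    have h: "local_fraction Y e N h y (U \<times> V)"
      by (rule tensor_fraction[OF B(2-4) assms(2)]) (use Basis B(1) in auto)
    show ?case
      by (rule local_fraction_mono[OF local_fraction_add_mult(2)[OF h local_fraction_nonzero[OF h _ assms(2)]]])
        (use Basis B(1) in auto)
  qed simp
qed

text \<open>\<open>f\<close> is the product of \<open>p\<close>, \<open>1 / q\<close> and the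
  constant 1, which contributes the neighbourhood \<open>W'\<close>.\<close>

lemma regular_fraction:
  assumes f: "f \<in> Reg (prod_space X X') W" and y: "y \<in> Y" "y \<in> W"
  shows "local_fraction Y e N f y W"
proof -
  obtain W' U V p q where W': "openin (Top (prod_space X X')) W'" "y \<in> W'" "W' \<subseteq> W"
    "openin (Top X) U" "openin (Top X') V" "W' \<subseteq> U \<times> V" "p \<in> tensor_funs X X' U V" "q \<in> tensor_funs X X' U V"
    "\<And>w. w \<in> W' \<Longrightarrow> q w \<noteq> 0 \<and> f w = p w / q w"
    by (rule Reg_prodE[OF f y(2)]) (rule that)
  have yUV: "y \<in> U \<times> V" using W' by blast
  have q: "local_fraction Y e N q y (U \<times> V)" and p: "local_fraction Y e N p y (U \<times> V)"
    by (rule tensor_fraction[OF W'(4,5) _ y(1) yUV]; fact)+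
  have "q y \<noteq> 0" using W'(2,9) by blast
  note inv = local_fraction_nonzero[OF q this y(1)]
  show ?thesis
    by (rule local_fraction_mono[OF local_fraction_add_mult(2)[OF open_fraction[OF W'(1) y(1) W'(2)] local_fraction_add_mult(2)[OF p inv]]])
      (use W'(3,9) in auto)
qed

end

section \<open>Polynomials in two groups of variables\<close>

lemma poly_funs_snd: "p \<in> poly_funs n \<Longrightarrow> (\<lambda>z. p (\<lambda>i. z (n + i))) \<in> poly_funs (n + n)"
  by (rule poly_funs_subst) (auto intro: poly_funs.coord)

lemma poly_funs_join_fst: "p \<in> poly_funs n \<Longrightarrow> p (join n x y) = p x"
  by (rule poly_funs_cong) (auto simp: join_def)

lemma poly_funs_join_snd: "p \<in> poly_funs n \<Longrightarrow> p (\<lambda>i. join n x y (n + i)) = p y"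
  by (rule poly_funs_cong) (auto simp: join_def)

text \<open>\<open>k[x, y] = k[x] \<otimes> k[y]\<close>\<close>

definition split_form :: "nat \<Rightarrow> ((nat \<Rightarrow> 'k::field) \<Rightarrow> (nat \<Rightarrow> 'k) \<Rightarrow> 'k) \<Rightarrow> bool" where
  "split_form n F \<longleftrightarrow> (\<exists>(m::nat) a b. (\<forall>i. a i \<in> poly_funs n \<and> b i \<in> poly_funs n) \<and>
     (\<forall>x y. F x y = (\<Sum>i<m. a i x * b i y)))"

lemma split_form_single: "a \<in> poly_funs n \<Longrightarrow> b \<in> poly_funs n \<Longrightarrow> split_form n (\<lambda>x y. a x * b y)"
  unfolding split_form_def by (rule exI[of _ 1], rule exI[of _ "\<lambda>_. a"], rule exI[of _ "\<lambda>_. b"]) simp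

lemma split_form_add:
  assumes "split_form n F" "split_form n H"
  shows "split_form n (\<lambda>x y. F x y + H x y)"
proof -
  obtain m a b where F: "\<And>i. a i \<in> poly_funs n" "\<And>i. b i \<in> poly_funs n" "\<And>x y. F x y = (\<Sum>i<(m::nat). a i x * b i y)"
    using assms(1) unfolding split_form_def by blast
  obtain m' a' b' where H: "\<And>i. a' i \<in> poly_funs n" "\<And>i. b' i \<in> poly_funs n" "\<And>x y. H x y = (\<Sum>i<(m'::nat). a' i x * b' i y)"
    using assms(2) unfolding split_form_def by blast
  let ?a = "\<lambda>i. if i < m then a i else a' (i - m)" and ?b = "\<lambda>i. if i < m then b i else b' (i - m)"
  have "F x y + H x y = (\<Sum>i<m + m'. ?a i x * ?b i y)" for x y
  proof -
    have "(\<Sum>i<m + m'. ?a i x * ?b i y) = (\<Sum>i\<in>{..<m}. ?a i x * ?b i y) + (\<Sum>i\<in>{m..<m + m'}. ?a i x * ?b i y)"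
      by (subst sum.union_disjoint[symmetric]) (auto intro: sum.cong)
    also have "(\<Sum>i\<in>{m..<m + m'}. ?a i x * ?b i y) = (\<Sum>i<m'. a' i x * b' i y)"
      by (rule sum.reindex_bij_witness[of _ "\<lambda>i. i + m" "\<lambda>i. i - m"]) auto
    finally show ?thesis by (simp add: F(3) H(3))
  qed
  then show ?thesis
    unfolding split_form_def using F(1,2) H(1,2)
    by (intro exI[of _ "m + m'"] exI[of _ ?a] exI[of _ ?b]) auto
qed

lemma split_form_sum: "finite I \<Longrightarrow> (\<And>i. i \<in> I \<Longrightarrow> split_form n (F i)) \<Longrightarrow> split_form n (\<lambda>x y. \<Sum>i\<in>I. F i x y)"
proof (induction I rule: finite_induct)
  case empty
  show ?case using split_form_single[OF poly_funs.const[of 0] poly_funs.const[of 0]] by simp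
qed (auto intro: split_form_add)

lemma split_form_mult:
  assumes "split_form n F" "split_form n H"
  shows "split_form n (\<lambda>x y. F x y * H x y)"
proof -
  obtain m a b where F: "\<And>i. a i \<in> poly_funs n" "\<And>i. b i \<in> poly_funs n" "\<And>x y. F x y = (\<Sum>i<(m::nat). a i x * b i y)"
    using assms(1) unfolding split_form_def by blast
  obtain m' a' b' where H: "\<And>i. a' i \<in> poly_funs n" "\<And>i. b' i \<in> poly_funs n" "\<And>x y. H x y = (\<Sum>i<(m'::nat). a' i x * b' i y)"
    using assms(2) unfolding split_form_def by blast
  have "split_form n (\<lambda>x y. \<Sum>i\<in>{..<m}. \<Sum>j\<in>{..<m'}. (a i x * a' j x) * (b i y * b' j y))"
    using F(1,2) H(1,2) by (intro split_form_sum split_form_single poly_funs.mult) auto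
  also have "(\<lambda>x y. \<Sum>i\<in>{..<m}. \<Sum>j\<in>{..<m'}. (a i x * a' j x) * (b i y * b' j y)) = (\<lambda>x y. F x y * H x y)"
    unfolding F(3) H(3) sum_product by (simp add: ac_simps)
  finally show ?thesis .
qed

lemma poly_funs_split:
  assumes "P \<in> poly_funs (n + n)"
  shows "split_form n (\<lambda>x y. P (join n x y))"
  using assms
proof (induction rule: poly_funs.induct)
  case (const c)
  show ?case using split_form_single[OF poly_funs.const[of c] poly_funs.const[of 1]] by simp
next
  case (coord i)
  show ?case
  proof (cases "i < n")
    case True
    then show ?thesis using split_form_single[OF poly_funs.coord[OF True] poly_funs.const[of 1]] by (simp add: join_def)
  next
    case False
    then have "i - n < n" using coord by simp
    from split_form_single[OF poly_funs.const[of 1] poly_funs.coord[OF this]] False show ?thesis by (simp add: join_def)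
  qed
qed (auto intro: split_form_add split_form_mult)

text \<open>For a product the quotients come from \<open>p x * q x - p a * q a = (p x - p a) * q x +
  p a * (q x - q a)\<close>.\<close>

lemma poly_funs_taylor:
  fixes p :: "(nat \<Rightarrow> 'k::field) \<Rightarrow> 'k"
  assumes "p \<in> poly_funs n"
  shows "\<exists>q. (\<forall>i. q i \<in> poly_funs n) \<and> (\<forall>x. p x = p a + (\<Sum>i<n. q i x * (x i - a i)))"
  using assms
proof (induction rule: poly_funs.induct)
  case (const c)
  show ?case by (rule exI[of _ "\<lambda>_ _. 0"]) (auto intro: poly_funs.const)
next
  case (coord i)
  have "(\<Sum>j<n. of_bool (j = i) * (x j - a j)) = x i - a i" for x :: "nat \<Rightarrow> 'k"
  proof -
    have "(\<Sum>j<n. of_bool (j = i) * (x j - a j)) = (\<Sum>j<n. if j = i then x i - a i else 0)"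
      by (rule sum.cong) auto
    then show ?thesis using coord by simp
  qed
  then show ?case by (intro exI[of _ "\<lambda>j _. of_bool (j = i)"]) (auto intro: poly_funs.const)
next
  case (add p q)
  from add.IH(1) obtain f where
    f': "(\<forall>i. f i \<in> poly_funs n) \<and> (\<forall>x. p x = p a + (\<Sum>i<n. f i x * (x i - a i)))" ..
  from add.IH(2) obtain g where
    g': "(\<forall>i. g i \<in> poly_funs n) \<and> (\<forall>x. q x = q a + (\<Sum>i<n. g i x * (x i - a i)))" ..
  note f = f'[THEN conjunct1, rule_format] f'[THEN conjunct2, rule_format]
  note g = g'[THEN conjunct1, rule_format] g'[THEN conjunct2, rule_format]
  have eq: "p x + q x = p a + q a + (\<Sum>i<n. (f i x + g i x) * (x i - a i))" for x
    using f(2)[of x] g(2)[of x] by (simp only: distrib_right sum.distrib) (simp only: ac_simps)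
  show ?case
    by (rule exI[of _ "\<lambda>i x. f i x + g i x"]) (intro conjI allI poly_funs.add f(1) g(1) eq)
next
  case (mult p q)
  from mult.IH(1) obtain f where
    f': "(\<forall>i. f i \<in> poly_funs n) \<and> (\<forall>x. p x = p a + (\<Sum>i<n. f i x * (x i - a i)))" ..
  from mult.IH(2) obtain g where
    g': "(\<forall>i. g i \<in> poly_funs n) \<and> (\<forall>x. q x = q a + (\<Sum>i<n. g i x * (x i - a i)))" ..
  note f = f'[THEN conjunct1, rule_format] f'[THEN conjunct2, rule_format]
  note g = g'[THEN conjunct1, rule_format] g'[THEN conjunct2, rule_format]
  have eq: "p x * q x = p a * q a + (\<Sum>i<n. (f i x * q x + p a * g i x) * (x i - a i))" for x
  proof -
    have "(\<Sum>i<n. (f i x * q x + p a * g i x) * (x i - a i)) =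
        (\<Sum>i<n. f i x * (x i - a i)) * q x + p a * (\<Sum>i<n. g i x * (x i - a i))"
      by (simp add: sum_distrib_left sum_distrib_right sum.distrib[symmetric] algebra_simps)
    also have "(\<Sum>i<n. f i x * (x i - a i)) = p x - p a" using f(2)[of x] by (simp add: algebra_simps)
    also have "(\<Sum>i<n. g i x * (x i - a i)) = q x - q a" using g(2)[of x] by (simp add: algebra_simps)
    finally show ?thesis by (simp add: algebra_simps)
  qed
  show ?case
    by (rule exI[of _ "\<lambda>i x. f i x * q x + p a * g i x"])
      (intro conjI allI poly_funs.add poly_funs.mult poly_funs.const f(1) g(1) mult.hyps eq)
qed

section \<open>Affine algebraic groups and their actions\<close>

lemma const_regular: "space_with_functions X \<Longrightarrow> (\<lambda>x\<in>pts X. 1) \<in> Reg X (pts X)"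
  by (rule space_with_functionsD(2)) auto

lemma morphism_prod_regular:
  assumes X: "space_with_functions X" "space_with_functions X'" "space_with_functions Y"
    and m: "morphism (prod_space X X') Y m" and f: "f \<in> Reg Y (pts Y)"
  shows "restrict (f \<circ> m) (pts X \<times> pts X') \<in> Reg (prod_space X X') (pts X \<times> pts X')"
    "x \<in> pts X \<Longrightarrow> x' \<in> pts X' \<Longrightarrow> m (x, x') \<in> pts Y"
proof -
  have pts: "pts (prod_space X X') = pts X \<times> pts X'"
    by (rule pts_prod[OF const_regular[OF X(1)] const_regular[OF X(2)]])
  show m_in: "m (x, x') \<in> pts Y" if "x \<in> pts X" "x' \<in> pts X'" for x x'
    using morphism_pts[OF m, of "(x, x')"] that pts by simp
  have "{z \<in> pts (prod_space X X'). m z \<in> pts Y} = pts X \<times> pts X'" using m_in pts by auto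
  moreover have "restrict (f \<circ> m) {z \<in> pts (prod_space X X'). m z \<in> pts Y}
      \<in> Reg (prod_space X X') {z \<in> pts (prod_space X X'). m z \<in> pts Y}"
    using m f openin_topspace unfolding morphism_def by blast
  ultimately show "restrict (f \<circ> m) (pts X \<times> pts X') \<in> Reg (prod_space X X') (pts X \<times> pts X')" by simp
qed

lemma one_in_range_poly: "(\<lambda>x. 1 :: 'k::field) \<in> range poly"
  by (rule image_eqI[of _ _ 1]) (simp_all add: fun_eq_iff)

lemma const_regular_zariski:
  assumes one: "(\<lambda>x. 1) \<in> P"
  shows "(\<lambda>x\<in>pts (zariski_space V P). 1) \<in> Reg (zariski_space V P) (pts (zariski_space V P))"
  unfolding Reg_zariski
proof (intro CollectI conjI ballI)
  let ?Y = "zariski_space V P"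
  fix x assume "x \<in> pts ?Y"
  then show "\<exists>W p q. openin (Top ?Y) W \<and> x \<in> W \<and> W \<subseteq> pts ?Y \<and> p \<in> P \<and> q \<in> P \<and>
      (\<forall>y\<in>W. q y \<noteq> 0 \<and> (\<lambda>x\<in>pts ?Y. 1) y = p y / q y)"
    using one by (intro exI[of _ "pts ?Y"] exI[of _ "\<lambda>x. 1"]) simp
qed simp

locale affine_algebraic_group = affine_coords "space A" n S \<xi> \<zeta>
  for A :: "('g, 'k::{alg_closed_field, field_char_0}) alg_group" and n S \<xi> \<zeta> +
  assumes alg: "algebraic_group A"
begin

lemma grp: "group A" using alg unfolding algebraic_group_def by blast

lemma pts_A: "pts (space A) = carrier A" using alg unfolding algebraic_group_def by blast

lemma swf: "space_with_functions (space A)"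
  using alg unfolding algebraic_group_def variety_def prevariety_def by blast

text \<open>\<open>\<pi>\<close> will be a projection of a product, and \<open>e\<close> any
  coordinates from which those of \<open>\<pi> y\<close> can be read off polynomially.\<close>

lemma fraction_coords:
  assumes U: "openin (Top (space A)) U" and f: "f \<in> Reg (space A) U" and y: "\<pi> y \<in> U"
    and \<pi>: "\<And>y. y \<in> Y \<Longrightarrow> \<pi> y \<in> carrier A"
    and sub: "\<And>p. p \<in> poly_funs n \<Longrightarrow> \<exists>P\<in>poly_funs N. \<forall>y. P (e y) = p (\<xi> (\<pi> y))"
  shows "local_fraction Y e N (\<lambda>y. f (\<pi> y)) y {y. \<pi> y \<in> U}"
proof -
  obtain s p where s: "s \<in> poly_funs n" "p \<in> poly_funs n" "s (\<xi> (\<pi> y)) \<noteq> 0"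
    "\<forall>x\<in>pts (space A). s (\<xi> x) \<noteq> 0 \<longrightarrow> x \<in> U \<and> s (\<xi> x) * f x = p (\<xi> x)"
    using regular_fraction[OF U y f] by (elim bexE conjE)
  obtain s' where s': "s' \<in> poly_funs N" "\<forall>y. s' (e y) = s (\<xi> (\<pi> y))" using sub[OF s(1)] by (elim bexE)
  obtain p' where p': "p' \<in> poly_funs N" "\<forall>y. p' (e y) = p (\<xi> (\<pi> y))" using sub[OF s(2)] by (elim bexE)
  show ?thesis
    by (rule local_fractionI[OF s'(1) p'(1)]) (use s(3,4) s'(2) p'(2) \<pi> pts_A in simp_all)
qed

lemma product_coords_mult:
  "product_coords (space A) (space A) (carrier A \<times> carrier A) (\<lambda>(g, h). join n (\<xi> g) (\<xi> h)) (n + n)"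
proof (rule product_coords.intro[OF swf swf])
  fix U f y assume U: "openin (Top (space A)) U" "f \<in> Reg (space A) U" "y \<in> carrier A \<times> carrier A"
  let ?e = "\<lambda>(g, h). join n (\<xi> g) (\<xi> h)"
  have sub1: "\<exists>P\<in>poly_funs (n + n). \<forall>y. P (?e y) = p (\<xi> (fst y))" if "p \<in> poly_funs n" for p
    using poly_funs_mono[OF that, of "n + n"] poly_funs_join_fst[OF that] by auto
  have sub2: "\<exists>P\<in>poly_funs (n + n). \<forall>y. P (?e y) = p (\<xi> (snd y))" if "p \<in> poly_funs n" for p
    using poly_funs_snd[OF that] poly_funs_join_snd[OF that] by (intro bexI[of _ "\<lambda>z. p (\<lambda>i. z (n + i))"]) auto
  show "local_fraction (carrier A \<times> carrier A) ?e (n + n) (\<lambda>y. f (fst y)) y (U \<times> UNIV)" if "fst y \<in> U"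
    by (rule local_fraction_mono[OF fraction_coords[where \<pi>=fst, OF U(1,2) that _ sub1]]) auto
  show "local_fraction (carrier A \<times> carrier A) ?e (n + n) (\<lambda>y. f (snd y)) y (UNIV \<times> U)" if "snd y \<in> U"
    by (rule local_fraction_mono[OF fraction_coords[where \<pi>=snd, OF U(1,2) that _ sub2]]) auto
qed

text \<open>On the slice over \<open>x0\<close> every function of the second component is the
  constant \<open>f x0\<close>, so the coordinates of the group suffice.\<close>

lemma product_coords_orbit:
  assumes X: "space_with_functions X" and x0: "x0 \<in> pts X"
  shows "product_coords (space A) X (carrier A \<times> {x0}) (\<lambda>y. \<xi> (fst y)) n"
proof
  show "space_with_functions (space A)" "space_with_functions X" using swf X by auto
  show "local_fraction (carrier A \<times> {x0}) (\<lambda>y. \<xi> (fst y)) n (\<lambda>y. f (fst y)) y (U \<times> UNIV)"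
    if "openin (Top (space A)) U" "f \<in> Reg (space A) U" "y \<in> carrier A \<times> {x0}" "fst y \<in> U" for U f y
    by (rule local_fraction_mono[OF fraction_coords[where \<pi>=fst, OF that(1,2,4)]]) (auto intro: bexI)
  show "local_fraction (carrier A \<times> {x0}) (\<lambda>y. \<xi> (fst y)) n (\<lambda>y. f (snd y)) y (UNIV \<times> U)"
    if "openin (Top X) U" "f \<in> Reg X U" "y \<in> carrier A \<times> {x0}" "snd y \<in> U" for U f y
    by (rule local_fraction_mono[OF local_fraction_const[of _ _ _ "f x0"]]) (use that in auto)
qed

text \<open>Regularity of the multiplication gives local fractions on the square of the group, and
  the Nullstellensatz unites them into one polynomial: the comultiplication of the coordinate
  ring.\<close>

lemma mult_polynomial:
  assumes p: "p \<in> poly_funs n"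
  shows "\<exists>P\<in>poly_funs (n + n). \<forall>g\<in>carrier A. \<forall>h\<in>carrier A. p (\<xi> (g \<otimes>\<^bsub>A\<^esub> h)) = P (join n (\<xi> g) (\<xi> h))"
proof -
  let ?m = "\<lambda>(g, h). g \<otimes>\<^bsub>A\<^esub> h" and ?e = "\<lambda>(g, h). join n (\<xi> g) (\<xi> h)" and ?C = "carrier A"
  let ?f = "\<lambda>y. p (\<xi> (?m y))"
  interpret product_coords "space A" "space A" "?C \<times> ?C" ?e "n + n" by (rule product_coords_mult)
  have m: "morphism (prod_space (space A) (space A)) (space A) ?m"
    using alg unfolding algebraic_group_def by blast
  note reg = morphism_prod_regular(1)[OF swf swf swf m polynomial_regular[OF p], unfolded pts_A]
  have frac: "local_fraction (?C \<times> ?C) ?e (n + n) ?f y (?C \<times> ?C)" if y: "y \<in> ?C \<times> ?C" for y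
    by (rule local_fraction_mono[OF regular_fraction[OF reg y y]])
      (use group.is_monoid[OF grp] in \<open>auto simp: restrict_def monoid.m_closed\<close>)
  have "\<exists>P\<in>poly_funs (n + n). \<forall>y\<in>?C \<times> ?C. ?f y = P (?e y)"
  proof (rule local_fraction_polynomial)
    show "\<exists>s\<in>poly_funs (n + n). \<exists>q\<in>poly_funs (n + n). s (?e y) \<noteq> 0 \<and>
        (\<forall>y'\<in>?C \<times> ?C. s (?e y') \<noteq> 0 \<longrightarrow> s (?e y') * ?f y' = q (?e y'))" if "y \<in> ?C \<times> ?C" for y
      by (rule local_fractionE[OF frac[OF that]]) blast
    fix z assume z: "\<And>y. y \<in> ?C \<times> ?C \<Longrightarrow> \<exists>i<n + n. z i \<noteq> ?e y i"
    \<comment> \<open>A point outside the square of the group violates an equation of the group in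
      its first or in its second half.\<close>
    show "\<exists>s\<in>poly_funs (n + n). s z \<noteq> 0 \<and> (\<forall>y\<in>?C \<times> ?C. s (?e y) = 0)"
    proof (cases "\<exists>g\<in>?C. \<forall>i<n. z i = \<xi> g i")
      case False
      then obtain s where s: "s \<in> S" "s z \<noteq> 0" using not_in_zero_locus[of z] pts_A by blast
      then have sP: "s \<in> poly_funs n" using S by blast
      show ?thesis
        using s poly_funs_mono[OF sP, of "n + n"] poly_funs_join_fst[OF sP] zero_on_pts pts_A
        by (intro bexI[of _ s]) auto
    next
      case True
      then obtain g where g: "g \<in> ?C" "\<And>i. i < n \<Longrightarrow> z i = \<xi> g i" by blast
      have "\<exists>i<n. z (n + i) \<noteq> \<xi> h i" if h: "h \<in> ?C" for h
      proof -
        obtain i where i: "i < n + n" "z i \<noteq> join n (\<xi> g) (\<xi> h) i" using z[of "(g, h)"] g(1) h by auto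
        then have "\<not> i < n" using g(2) by (auto simp: join_def)
        with i show ?thesis by (intro exI[of _ "i - n"]) (auto simp: join_def)
      qed
      then obtain s where s: "s \<in> S" "s (\<lambda>i. z (n + i)) \<noteq> 0" using not_in_zero_locus[of "\<lambda>i. z (n + i)"] pts_A by blast
      then have sP: "s \<in> poly_funs n" using S by blast
      show ?thesis
        using s poly_funs_snd[OF sP] poly_funs_join_snd[OF sP] zero_on_pts pts_A
        by (intro bexI[of _ "\<lambda>z. s (\<lambda>i. z (n + i))"]) auto
    qed
  qed
  then show ?thesis by auto
qed

text \<open>The argument for the multiplication is repeated on the slice over \<open>x0\<close>,
  where it turns functions on \<open>X\<close> into polynomial functions on the group.\<close>

lemma orbit_map_polynomial:
  assumes X: "space_with_functions X" and \<alpha>: "\<alpha> \<in> algebraic_homs A X"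
    and f: "f \<in> Reg X (pts X)" and x0: "x0 \<in> pts X"
  shows "\<exists>p\<in>poly_funs n. \<forall>g\<in>carrier A. f (\<alpha> g x0) = p (\<xi> g)"
proof -
  let ?m = "\<lambda>(g, x). \<alpha> g x" and ?C = "carrier A"
  let ?f = "\<lambda>y. f (?m y)"
  interpret P: product_coords "space A" X "?C \<times> {x0}" "\<lambda>y. \<xi> (fst y)" n by (rule product_coords_orbit[OF X x0])
  have m: "morphism (prod_space (space A) X) X ?m" using \<alpha> unfolding algebraic_homs_def by blast
  note reg = morphism_prod_regular(1)[OF swf X X m f, unfolded pts_A]
  have frac: "local_fraction (?C \<times> {x0}) (\<lambda>y. \<xi> (fst y)) n ?f y (?C \<times> pts X)" if y: "y \<in> ?C \<times> {x0}" for y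
    by (rule local_fraction_mono[OF P.regular_fraction[OF reg y]]) (use y x0 in \<open>auto simp: restrict_def\<close>)
  have "\<exists>p\<in>poly_funs n. \<forall>y\<in>?C \<times> {x0}. ?f y = p (\<xi> (fst y))"
  proof (rule local_fraction_polynomial)
    show "\<exists>s\<in>poly_funs n. \<exists>q\<in>poly_funs n. s (\<xi> (fst y)) \<noteq> 0 \<and>
        (\<forall>y'\<in>?C \<times> {x0}. s (\<xi> (fst y')) \<noteq> 0 \<longrightarrow> s (\<xi> (fst y')) * ?f y' = q (\<xi> (fst y')))" if "y \<in> ?C \<times> {x0}" for y
      by (rule local_fractionE[OF frac[OF that]]) blast
    fix z assume z: "\<And>y. y \<in> ?C \<times> {x0} \<Longrightarrow> \<exists>i<n. z i \<noteq> \<xi> (fst y) i"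
    have "\<exists>i<n. z i \<noteq> \<xi> g i" if "g \<in> pts (space A)" for g using z[of "(g, x0)"] that pts_A by auto
    then obtain s where s: "s \<in> S" "s z \<noteq> 0" using not_in_zero_locus by blast
    show "\<exists>s\<in>poly_funs n. s z \<noteq> 0 \<and> (\<forall>y\<in>?C \<times> {x0}. s (\<xi> (fst y)) = 0)"
      using s S zero_on_pts pts_A by (intro bexI[of _ s]) auto
  qed
  then show ?thesis by auto
qed

section \<open>The coordinate ring of the group\<close>

definition pull :: "((nat \<Rightarrow> 'k) \<Rightarrow> 'k) \<Rightarrow> 'g \<Rightarrow> 'k" where
  "pull p = (\<lambda>g. if g \<in> carrier A then p (\<xi> g) else 0)"

definition coordinate_ring :: "('g \<Rightarrow> 'k) set" where
  "coordinate_ring = pull ` poly_funs n"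

lemma pull_simps:
  "pull p + pull q = pull (\<lambda>x. p x + q x)" "pull p * pull q = pull (\<lambda>x. p x * q x)"
  by (auto simp: pull_def fun_eq_iff fun_simps)

text \<open>Prepares \<open>krull_intersection\<close>: a factor vanishing at the identity is, by
  expansion there, linear in the differences of coordinates, with coefficients in the first group of
  variables, so \<open>j\<close> such factors give degree \<open>j\<close>.\<close>

lemma mpow_form:
  assumes "mpow coordinate_ring \<one>\<^bsub>A\<^esub> j \<eta>"
  shows "\<exists>P\<in>poly_funs (n + n). (\<forall>x y t. P (join n x (\<lambda>i. t * y i)) = t ^ j * P (join n x y)) \<and>
      (\<forall>g\<in>carrier A. \<eta> g = P (join n (\<xi> g) (\<lambda>i. \<xi> g i - \<xi> \<one>\<^bsub>A\<^esub> i)))"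
  using assms
proof (induction rule: mpow.induct)
  case (base r)
  then obtain p where p: "p \<in> poly_funs n" "r = pull p" unfolding coordinate_ring_def by blast
  show ?case
    by (rule bexI[of _ p]) (auto simp: p(2) pull_def poly_funs_join_fst[OF p(1)] intro: poly_funs_mono[OF p(1)])
next
  case (step a j r)
  obtain p where p: "p \<in> poly_funs n" "a = pull p" using step.hyps(1) unfolding coordinate_ring_def by blast
  have "\<one>\<^bsub>A\<^esub> \<in> carrier A" using group.is_monoid[OF grp] by (rule monoid.one_closed)
  then have p1: "p (\<xi> \<one>\<^bsub>A\<^esub>) = 0" using step.hyps(2) by (simp add: p(2) pull_def)
  obtain q where q: "(\<forall>i. q i \<in> poly_funs n) \<and> (\<forall>x. p x = p (\<xi> \<one>\<^bsub>A\<^esub>) + (\<Sum>i<n. q i x * (x i - \<xi> \<one>\<^bsub>A\<^esub> i)))"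
    using poly_funs_taylor[OF p(1), of "\<xi> \<one>\<^bsub>A\<^esub>"] ..
  note q1 = q[THEN conjunct1, rule_format] and q2 = q[THEN conjunct2, rule_format]
  from step.IH obtain P where P: "P \<in> poly_funs (n + n)" "\<forall>x y t. P (join n x (\<lambda>i. t * y i)) = t ^ j * P (join n x y)"
    "\<forall>g\<in>carrier A. r g = P (join n (\<xi> g) (\<lambda>i. \<xi> g i - \<xi> \<one>\<^bsub>A\<^esub> i))" by (elim bexE conjE)
  define H where "H z = (\<Sum>i<n. q i z * z (n + i)) * P z" for z
  have H_join: "H (join n x y) = (\<Sum>i<n. q i x * y i) * P (join n x y)" for x y
    unfolding H_def by (simp add: poly_funs_join_fst[OF q1]) (simp add: join_def)
  have "H \<in> poly_funs (n + n)"
    unfolding H_def[abs_def]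
    by (intro poly_funs.mult poly_funs_sum P(1) poly_funs_mono[OF q1] poly_funs.coord) auto
  moreover have "H (join n x (\<lambda>i. t * y i)) = t ^ Suc j * H (join n x y)" for x y t
  proof -
    have "(\<Sum>i<n. q i x * (t * y i)) = t * (\<Sum>i<n. q i x * y i)"
      by (simp add: sum_distrib_left mult.left_commute)
    then show ?thesis unfolding H_join using P(2) by (simp add: mult_ac)
  qed
  moreover have "(a * r) g = H (join n (\<xi> g) (\<lambda>i. \<xi> g i - \<xi> \<one>\<^bsub>A\<^esub> i))" if g: "g \<in> carrier A" for g
  proof -
    have "(a * r) g = p (\<xi> g) * r g" using g by (simp add: p(2) pull_def fun_simps)
    also have "p (\<xi> g) = (\<Sum>i<n. q i (\<xi> g) * (\<xi> g i - \<xi> \<one>\<^bsub>A\<^esub> i))" using q2[of "\<xi> g"] p1 by simp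
    finally show ?thesis unfolding H_join using P(3) g by simp
  qed
  ultimately show ?case by (intro bexI[of _ H]) auto
next
  case (add j r s)
  from add.IH(1) obtain P where P: "P \<in> poly_funs (n + n)" "\<forall>x y t. P (join n x (\<lambda>i. t * y i)) = t ^ j * P (join n x y)"
    "\<forall>g\<in>carrier A. r g = P (join n (\<xi> g) (\<lambda>i. \<xi> g i - \<xi> \<one>\<^bsub>A\<^esub> i))" by (elim bexE conjE)
  from add.IH(2) obtain Q where Q: "Q \<in> poly_funs (n + n)" "\<forall>x y t. Q (join n x (\<lambda>i. t * y i)) = t ^ j * Q (join n x y)"
    "\<forall>g\<in>carrier A. s g = Q (join n (\<xi> g) (\<lambda>i. \<xi> g i - \<xi> \<one>\<^bsub>A\<^esub> i))" by (elim bexE conjE)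
  show ?case
    by (rule bexI[of _ "\<lambda>z. P z + Q z"]) (use P Q in \<open>auto simp: distrib_left fun_simps intro: poly_funs.add\<close>)
qed

lemma zariski_morphism_to_Gm:
  assumes p: "p \<in> poly_funs n" and nz: "\<And>g. g \<in> carrier A \<Longrightarrow> p (\<xi> g) \<noteq> 0"
  shows "morphism (space A) (space \<bbbG>\<^sub>m) (pull p)"
proof -
  have "morphism Z (zariski_space (UNIV - {0}) (range poly)) p"
  proof (rule zariski_morphism[OF poly_funs.const])
    show "(\<lambda>x. 1 :: 'k) \<in> range poly" by (rule one_in_range_poly)
    show "p x \<in> UNIV - {0}" if "x \<in> zero_locus n S" for x
      using nz[of "\<zeta> x"] \<zeta>_in[OF that] \<xi>\<zeta>[OF that] pts_A by auto
    fix q :: "'k \<Rightarrow> 'k" assume "q \<in> range poly"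
    then obtain r where "q = poly r" by blast
    then show "\<exists>P\<in>poly_funs n. \<forall>x\<in>zero_locus n S. q (p x) = P x"
      using p by (intro bexI[of _ "\<lambda>x. poly r (p x)"]) (auto simp: poly_altdef intro!: poly_funs_intros)
  qed
  from morphism_comp[OF \<xi> this] show ?thesis
    unfolding multiplicative_group_def by (simp, elim morphism_cong) (simp add: pull_def pts_A)
qed

theorem group_algebra:
  assumes conn: "connected_space (Top (space A))" and chars: "\<forall>\<chi>\<in>characters A. \<forall>g\<in>carrier A. \<chi> g = 1"
  shows "affine_group_algebra A coordinate_ring (\<lambda>i. pull (\<lambda>x. x i - \<xi> \<one>\<^bsub>A\<^esub> i)) n"
proof -
  interpret G: group A by (rule grp)
  let ?C = "carrier A"
  have pullI: "pull p \<in> coordinate_ring" if "p \<in> poly_funs n" for p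
    using that unfolding coordinate_ring_def by blast
  have ringE: "\<exists>p\<in>poly_funs n. r = pull p" if "r \<in> coordinate_ring" for r
    using that unfolding coordinate_ring_def by blast
  have pull_at: "pull p g = p (\<xi> g)" if "g \<in> ?C" for p g using that by (simp add: pull_def)
  have pull_const: "pull (\<lambda>x. c) = (\<lambda>g. if g \<in> ?C then c else 0)" for c by (auto simp: pull_def)
  show ?thesis
  proof
    show "r g = 0" if "r \<in> coordinate_ring" "g \<notin> ?C" for r g
      using ringE[OF that(1)] that(2) by (auto simp: pull_def)
    show "(\<lambda>g. if g \<in> ?C then c else 0) \<in> coordinate_ring" for c
      unfolding pull_const[symmetric] by (rule pullI[OF poly_funs.const])
    show "r + s \<in> coordinate_ring" "r * s \<in> coordinate_ring" if rs: "r \<in> coordinate_ring" "s \<in> coordinate_ring" for r s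
    proof -
      obtain p q where "p \<in> poly_funs n" "r = pull p" "q \<in> poly_funs n" "s = pull q"
        using ringE[OF rs(1)] ringE[OF rs(2)] by (elim bexE)
      then show "r + s \<in> coordinate_ring" "r * s \<in> coordinate_ring"
        by (simp_all only: pull_simps) (intro pullI poly_funs.intros; assumption)+
    qed
    show "\<exists>(m::nat) a b. (\<forall>i<m. a i \<in> coordinate_ring \<and> b i \<in> coordinate_ring) \<and>
      (\<forall>g\<in>?C. \<forall>h\<in>?C. r (g \<otimes>\<^bsub>A\<^esub> h) = (\<Sum>i<m. a i g * b i h))" if r: "r \<in> coordinate_ring" for r
    proof -
      obtain p where p: "p \<in> poly_funs n" "r = pull p" using ringE[OF r] by (elim bexE)
      obtain P where P: "P \<in> poly_funs (n + n)" "\<forall>g\<in>?C. \<forall>h\<in>?C. p (\<xi> (g \<otimes>\<^bsub>A\<^esub> h)) = P (join n (\<xi> g) (\<xi> h))"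
        using mult_polynomial[OF p(1)] by (elim bexE)
      obtain m a b where ab: "\<forall>i. a i \<in> poly_funs n \<and> b i \<in> poly_funs n"
        "\<forall>x y. P (join n x y) = (\<Sum>i<(m::nat). a i x * b i y)"
        using poly_funs_split[OF P(1)] unfolding split_form_def by (elim exE conjE)
      show ?thesis
        by (rule exI[of _ m], rule exI[of _ "\<lambda>i. pull (a i)"], rule exI[of _ "\<lambda>i. pull (b i)"])
          (use ab P(2) pullI in \<open>simp add: p(2) pull_at\<close>)
    qed
    show "pull (\<lambda>x. x i - \<xi> \<one>\<^bsub>A\<^esub> i) \<in> coordinate_ring" if "i < n" for i
      using that by (intro pullI poly_funs_intros)
    show "pull (\<lambda>x. x i - \<xi> \<one>\<^bsub>A\<^esub> i) \<one>\<^bsub>A\<^esub> = 0" for i by (simp add: pull_at)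
    show "\<exists>q. (\<forall>i<n. q i \<in> coordinate_ring) \<and>
      (\<forall>g\<in>?C. r g = r \<one>\<^bsub>A\<^esub> + (\<Sum>i<n. q i g * pull (\<lambda>x. x i - \<xi> \<one>\<^bsub>A\<^esub> i) g))" if r: "r \<in> coordinate_ring" for r
    proof -
      obtain p where p: "p \<in> poly_funs n" "r = pull p" using ringE[OF r] by (elim bexE)
      obtain q where q: "(\<forall>i. q i \<in> poly_funs n) \<and> (\<forall>x. p x = p (\<xi> \<one>\<^bsub>A\<^esub>) + (\<Sum>i<n. q i x * (x i - \<xi> \<one>\<^bsub>A\<^esub> i)))"
        using poly_funs_taylor[OF p(1), of "\<xi> \<one>\<^bsub>A\<^esub>"] ..
      show ?thesis
      proof (intro exI[of _ "\<lambda>i. pull (q i)"] conjI allI impI ballI)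
        show "pull (q i) \<in> coordinate_ring" for i using q by (intro pullI) blast
        fix g assume g: "g \<in> ?C"
        from q[THEN conjunct2, THEN spec, of "\<xi> g"] show "r g = r \<one>\<^bsub>A\<^esub> + (\<Sum>i<n. pull (q i) g * pull (\<lambda>x. x i - \<xi> \<one>\<^bsub>A\<^esub> i) g)"
          unfolding p(2) pull_at[OF g] pull_at[OF G.one_closed] .
      qed
    qed
    show "\<exists>g\<in>?C. \<forall>r\<in>coordinate_ring. r g = \<theta> r"
      if \<theta>c: "\<And>c. \<theta> (\<lambda>g. if g \<in> ?C then c else 0) = c"
        and \<theta>a: "\<And>r s. r \<in> coordinate_ring \<Longrightarrow> s \<in> coordinate_ring \<Longrightarrow> \<theta> (r + s) = \<theta> r + \<theta> s"
        and \<theta>m: "\<And>r s. r \<in> coordinate_ring \<Longrightarrow> s \<in> coordinate_ring \<Longrightarrow> \<theta> (r * s) = \<theta> r * \<theta> s" for \<theta>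
    proof -
      \<comment> \<open>The point is found from the values of \<open>\<theta>\<close> on the
        coordinate functions; elements of \<open>S\<close> pull back to zero, so it satisfies the
        equations.\<close>
      define x where "x = (\<lambda>i\<in>{..<n}. \<theta> (pull (\<lambda>x. x i)))"
      have \<theta>: "\<theta> (pull p) = p x" if "p \<in> poly_funs n" for p
        using that
      proof (induction rule: poly_funs.induct)
        case (const c)
        show ?case by (simp add: pull_const \<theta>c)
      next
        case (coord i)
        then show ?case by (simp add: x_def)
      next
        case (add p q)
        show ?case using \<theta>a[OF pullI[OF add.hyps(1)] pullI[OF add.hyps(2)]] add.IH by (simp add: pull_simps)
      next
        case (mult p q)
        show ?case using \<theta>m[OF pullI[OF mult.hyps(1)] pullI[OF mult.hyps(2)]] mult.IH by (simp add: pull_simps)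
      qed
      have "s x = 0" if s: "s \<in> S" for s
      proof -
        have "pull s = (\<lambda>g. if g \<in> ?C then 0 else 0)" using zero_on_pts[OF s] pts_A by (auto simp: pull_def)
        then have "\<theta> (pull s) = 0" using \<theta>c[of 0] by (simp only:)
        then show ?thesis using \<theta> s S by auto
      qed
      then have x: "x \<in> zero_locus n S" unfolding zero_locus_def by (simp add: x_def)
      show ?thesis
      proof (intro bexI[of _ "\<zeta> x"] ballI)
        show C: "\<zeta> x \<in> ?C" using \<zeta>_in[OF x] pts_A by simp
        fix r assume "r \<in> coordinate_ring"
        from ringE[OF this] obtain p where p: "p \<in> poly_funs n" "r = pull p" by (elim bexE)
        show "r (\<zeta> x) = \<theta> r" using \<theta>[OF p(1)] C by (simp add: p(2) pull_at \<xi>\<zeta>[OF x])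
      qed
    qed
    show "g = h" if gh: "g \<in> ?C" "h \<in> ?C" "\<And>r. r \<in> coordinate_ring \<Longrightarrow> r g = r h" for g h
    proof (rule \<xi>_separates)
      show "g \<in> pts (space A)" "h \<in> pts (space A)" using gh pts_A by auto
      show "\<xi> g i = \<xi> h i" if "i < n" for i
        using gh(3)[OF pullI[OF poly_funs.coord[OF that]]] gh(1,2) by (simp add: pull_at)
    qed
    show "\<exists>c\<in>coordinate_ring. c \<one>\<^bsub>A\<^esub> \<noteq> 0 \<and> (\<forall>g\<in>?C. c g \<noteq> 0 \<longrightarrow> \<eta> g = 0)"
      if \<eta>: "\<And>j. mpow coordinate_ring \<one>\<^bsub>A\<^esub> j \<eta>" for \<eta>
    proof -
      obtain c where c: "c \<in> poly_funs n" "c (\<xi> \<one>\<^bsub>A\<^esub>) \<noteq> 0" "\<forall>g\<in>?C. c (\<xi> g) \<noteq> 0 \<longrightarrow> \<eta> g = 0"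
        using krull_intersection[where e=\<xi> and Y="?C" and a="\<xi> \<one>\<^bsub>A\<^esub>", OF mpow_form[OF \<eta>]] by (elim bexE conjE)
      then show ?thesis by (intro bexI[OF _ pullI[OF c(1)]]) (simp add: pull_at)
    qed
    show "W = {} \<or> W = ?C" if W: "W \<subseteq> ?C"
      "\<And>g. g \<in> W \<Longrightarrow> \<exists>c\<in>coordinate_ring. c g \<noteq> 0 \<and> (\<forall>h\<in>?C. c h \<noteq> 0 \<longrightarrow> h \<in> W)"
      "\<And>g. g \<in> ?C - W \<Longrightarrow> \<exists>c\<in>coordinate_ring. c g \<noteq> 0 \<and> (\<forall>h\<in>?C. c h \<noteq> 0 \<longrightarrow> h \<notin> W)" for W
    proof -
      have op: "openin (Top (space A)) W" if W: "W \<subseteq> ?C"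
        "\<And>g. g \<in> W \<Longrightarrow> \<exists>c\<in>coordinate_ring. c g \<noteq> 0 \<and> (\<forall>h\<in>?C. c h \<noteq> 0 \<longrightarrow> h \<in> W)" for W
      proof (subst openin_subopen, rule ballI)
        fix g assume g: "g \<in> W"
        then obtain c where c: "c \<in> coordinate_ring" "c g \<noteq> 0" "\<And>h. h \<in> ?C \<Longrightarrow> c h \<noteq> 0 \<Longrightarrow> h \<in> W" using W(2) by blast
        obtain p where p: "p \<in> poly_funs n" "c = pull p" using ringE[OF c(1)] by (elim bexE)
        show "\<exists>T. openin (Top (space A)) T \<and> g \<in> T \<and> T \<subseteq> W"
          using basic_open[OF p(1)] c(2,3) g W(1)
          by (intro exI[of _ "{x \<in> pts (space A). p (\<xi> x) \<noteq> 0}"]) (auto simp: p(2) pts_A pull_def)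
      qed
      have "openin (Top (space A)) W" by (rule op[OF W(1,2)])
      moreover have "openin (Top (space A)) (?C - W)"
        by (rule op) (use W(3) in blast)+
      then have "closedin (Top (space A)) W" using W(1) pts_A by (simp add: closedin_def)
      ultimately show ?thesis using conn pts_A unfolding connected_space_clopen_in by blast
    qed
    show "\<psi> g = 1" if \<psi>: "\<psi> \<in> coordinate_ring" "\<psi> \<one>\<^bsub>A\<^esub> = 1"
      "\<And>g h. g \<in> ?C \<Longrightarrow> h \<in> ?C \<Longrightarrow> \<psi> (g \<otimes>\<^bsub>A\<^esub> h) = \<psi> g * \<psi> h" "g \<in> ?C" for \<psi> g
    proof -
      obtain p where p: "p \<in> poly_funs n" "\<psi> = pull p" using ringE[OF \<psi>(1)] by (elim bexE)
      \<comment> \<open>Multiplicativity and the value 1 at the identity make the values at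
        \<open>g\<close> and at its inverse reciprocal.\<close>
      have nz: "\<psi> g \<noteq> 0" if "g \<in> ?C" for g
        using \<psi>(2) \<psi>(3)[OF that G.inv_closed[OF that]] G.r_inv[OF that] by auto
      have "morphism (space A) (space \<bbbG>\<^sub>m) \<psi>"
        unfolding p(2) by (rule zariski_morphism_to_Gm[OF p(1)]) (use nz in \<open>auto simp: p(2) pull_at\<close>)
      moreover have "\<psi> \<in> hom A \<bbbG>\<^sub>m"
        unfolding hom_def multiplicative_group_def using nz \<psi>(3) by auto
      ultimately have "\<psi> \<in> characters A" unfolding characters_def by blast
      then show ?thesis using chars \<psi>(4) by blast
    qed
  qed
qed

lemma one_parameter_morphism:
  assumes u: "\<And>t. u t \<in> carrier A" "\<And>r. r \<in> coordinate_ring \<Longrightarrow> \<exists>p. \<forall>t. r (u t) = poly p t"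
  shows "morphism (space \<bbbG>\<^sub>a) (space A) u"
proof -
  note one = one_in_range_poly[where 'k='k]
  have "morphism (zariski_space UNIV (range poly)) Z (\<lambda>t. \<xi> (u t))"
  proof (rule zariski_morphism[OF one poly_funs.const])
    show "\<xi> (u t) \<in> zero_locus n S" for t using \<xi>_in u(1) pts_A by blast
    fix q :: "(nat \<Rightarrow> 'k) \<Rightarrow> 'k" assume q: "q \<in> poly_funs n"
    then have "pull q \<in> coordinate_ring" unfolding coordinate_ring_def by blast
    then obtain p where "\<forall>t. pull q (u t) = poly p t" using u(2) by blast
    then show "\<exists>p\<in>range poly. \<forall>t\<in>UNIV. q (\<xi> (u t)) = p t" using u(1) by (intro bexI[of _ "poly p"]) (auto simp: pull_def)
  qed
  from morphism_comp[OF this \<zeta>] have "morphism (zariski_space UNIV (range poly)) (space A) (\<zeta> \<circ> (\<lambda>t. \<xi> (u t)))" .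
  then show ?thesis
    unfolding additive_group_def by (simp, elim morphism_cong) (use u(1) \<zeta>\<xi> pts_A in simp)
qed

lemma const_regular_Ga: "(\<lambda>x\<in>pts (space \<bbbG>\<^sub>a). 1 :: 'k) \<in> Reg (space \<bbbG>\<^sub>a) (pts (space \<bbbG>\<^sub>a))"
  unfolding additive_group_def select_convs by (rule const_regular_zariski[OF one_in_range_poly])

lemma one_parameter_action:
  assumes u: "\<And>t. u t \<in> carrier A" "\<And>r. r \<in> coordinate_ring \<Longrightarrow> \<exists>p. \<forall>t. r (u t) = poly p t"
    "\<And>s t. u (s + t) = u s \<otimes>\<^bsub>A\<^esub> u t"
    and X: "space_with_functions X" and \<alpha>: "\<alpha> \<in> algebraic_homs A X"
  shows "\<alpha> \<circ> u \<in> algebraic_homs \<bbbG>\<^sub>a X"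
proof -
  have \<alpha>h: "\<alpha> \<in> hom A (Aut X)" and \<alpha>m: "morphism (prod_space (space A) X) X (\<lambda>(g, x). \<alpha> g x)"
    using \<alpha> unfolding algebraic_homs_def by auto
  have "\<alpha> \<circ> u \<in> hom \<bbbG>\<^sub>a (Aut X)"
    using \<alpha>h u(1,3) unfolding hom_def additive_group_def by auto
  moreover have "morphism (prod_space (space \<bbbG>\<^sub>a) X) X ((\<lambda>(g, x). \<alpha> g x) \<circ> (\<lambda>(t, x). (u t, x)))"
    by (rule morphism_comp[OF morphism_prod_left[OF one_parameter_morphism[of u, OF u(1,2)] const_regular_Ga
          const_regular[OF swf] const_regular[OF X]] \<alpha>m])
  then have "morphism (prod_space (space \<bbbG>\<^sub>a) X) X (\<lambda>(t, x). (\<alpha> \<circ> u) t x)"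
    by (rule morphism_cong) auto
  ultimately show ?thesis unfolding algebraic_homs_def by blast
qed

end

text \<open>The axioms of a space with functions do not make nonvanishing loci open, so this is
  checked in affine charts.\<close>

lemma regular_support_open:
  assumes X: "prevariety X" and f: "f \<in> Reg X (pts X)"
  shows "openin (Top X) {x \<in> pts X. f x \<noteq> c}"
proof (subst openin_subopen, rule ballI)
  fix x assume x: "x \<in> {x \<in> pts X. f x \<noteq> c}"
  have swf: "space_with_functions X" using X unfolding prevariety_def by blast
  obtain U where U: "openin (Top X) U" "affine_variety (open_subspace X U)" "x \<in> U"
    using X x unfolding prevariety_def by blast
  have pts: "pts (open_subspace X U) = U" "Reg (open_subspace X U) = Reg X"
    using openin_subset[OF U(1)] by (auto simp: open_subspace_def)
  obtain n S \<xi> \<zeta> where "affine_coords (open_subspace X U) n S \<xi> \<zeta>" by (rule affine_variety_coords[OF U(2)])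
  then interpret affine_coords "open_subspace X U" n S \<xi> \<zeta> .
  have "restrict f U \<in> Reg (open_subspace X U) U"
    unfolding pts(2) using space_with_functionsD(3)[OF swf openin_topspace U(1) openin_subset[OF U(1)] f] .
  note fU = this
  have "openin (Top (open_subspace X U)) U" using openin_topspace[of "Top (open_subspace X U)"] unfolding pts(1) .
  from regular_fraction[OF this U(3) fU, unfolded pts(1)] obtain s p where s: "s \<in> poly_funs n" "p \<in> poly_funs n" "s (\<xi> x) \<noteq> 0"
    "\<forall>y\<in>U. s (\<xi> y) \<noteq> 0 \<longrightarrow> y \<in> U \<and> s (\<xi> y) * restrict f U y = p (\<xi> y)"
    by (elim bexE conjE)
  \<comment> \<open>On the chart \<open>h\<close> equals \<open>s ^ 2 * (f - c)\<close>; the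
    additional factor \<open>s\<close> makes it vanish where the fraction does not represent
    \<open>f\<close>.\<close>
  define h where "h z = s z * (p z - c * s z)" for z
  have "h \<in> poly_funs n" unfolding h_def[abs_def] using s(1,2) by (intro poly_funs_intros)
  from basic_open[OF this] have "openin (Top X) {y \<in> U. h (\<xi> y) \<noteq> 0}"
    unfolding pts(1) using openin_trans_full[OF _ U(1)] by (simp add: open_subspace_def)
  moreover have "p (\<xi> y) - c * s (\<xi> y) = s (\<xi> y) * (f y - c)" if "y \<in> U" "s (\<xi> y) \<noteq> 0" for y
    using s(4) that by (auto simp: algebra_simps)
  then have "h (\<xi> y) = s (\<xi> y) * s (\<xi> y) * (f y - c)" if "y \<in> U" for y
    using that by (cases "s (\<xi> y) = 0") (auto simp: h_def)
  then have "x \<in> {y \<in> U. h (\<xi> y) \<noteq> 0}" "{y \<in> U. h (\<xi> y) \<noteq> 0} \<subseteq> {x \<in> pts X. f x \<noteq> c}"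
    using U(3) s(3) x openin_subset[OF U(1)] by auto
  ultimately show "\<exists>T. openin (Top X) T \<and> x \<in> T \<and> T \<subseteq> {x \<in> pts X. f x \<noteq> c}" by blast
qed

lemma constants_subset_makar_limanov:
  assumes "space_with_functions X"
  shows "constants X \<subseteq> makar_limanov X"
proof -
  have "(\<lambda>x\<in>pts X. c) \<in> invariants X (\<alpha> ` carrier \<bbbG>\<^sub>a)" if "\<alpha> \<in> algebraic_homs \<bbbG>\<^sub>a X" for \<alpha> c
  proof -
    have "\<alpha> t \<in> Bij (pts X)" if "t \<in> carrier \<bbbG>\<^sub>a" for t
      using \<open>\<alpha> \<in> algebraic_homs \<bbbG>\<^sub>a X\<close> that unfolding algebraic_homs_def hom_def Aut_def by auto
    then have "\<alpha> t x \<in> pts X" if "t \<in> carrier \<bbbG>\<^sub>a" "x \<in> pts X" for t x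
      using that Bij_imp_funcset by blast
    then show ?thesis
      unfolding invariants_def using space_with_functionsD(2)[OF assms openin_topspace] by auto
  qed
  then show ?thesis unfolding constants_def makar_limanov_def by blast
qed

theorem corollary1p5:
  fixes X :: "('x, 'k::{alg_closed_field, field_char_0}) fun_space"
    and A :: "('g, 'k) alg_group"
    and \<alpha> :: "'g \<Rightarrow> 'x \<Rightarrow> 'x"
    and G :: "('x \<Rightarrow> 'x) set"
  assumes "variety X"
    and "linear_algebraic_group A"
    and "\<alpha> \<in> algebraic_homs A X" and "inj_on \<alpha> (carrier A)" and "G = \<alpha> ` carrier A"
    and "connected_space (Top (space A))"
    and "\<forall>\<chi>\<in>characters A. \<forall>g\<in>carrier A. \<chi> g = 1"
    and "\<exists>x\<in>pts X. Top X closure_of ((\<lambda>\<sigma>. \<sigma> x) ` G) = pts X"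
  shows "makar_limanov X = constants X"
proof
  have pre: "prevariety X" using assms(1) unfolding variety_def by blast
  then have swf: "space_with_functions X" unfolding prevariety_def by blast
  then show "constants X \<subseteq> makar_limanov X" by (rule constants_subset_makar_limanov)
  have aff: "affine_variety (space A)" and alg: "algebraic_group A"
    using assms(2) unfolding linear_algebraic_group_def by auto
  obtain n S \<xi> \<zeta> where "affine_coords (space A) n S \<xi> \<zeta>" by (rule affine_variety_coords[OF aff])
  then interpret H: affine_algebraic_group A n S \<xi> \<zeta>
    using alg unfolding affine_algebraic_group_def affine_algebraic_group_axioms_def by blast
  interpret L: affine_group_algebra A H.coordinate_ring "\<lambda>i. H.pull (\<lambda>x. x i - \<xi> \<one>\<^bsub>A\<^esub> i)" n
    by (rule H.group_algebra[OF assms(6,7)])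
  obtain x0 where x0: "x0 \<in> pts X" "Top X closure_of ((\<lambda>\<sigma>. \<sigma> x0) ` G) = pts X" using assms(8) by blast
  have hom: "\<alpha> \<in> hom A (Aut X)" using assms(3) unfolding algebraic_homs_def by blast
  have \<alpha>Bij: "\<alpha> g \<in> Bij (pts X)" if "g \<in> carrier A" for g
    using hom that unfolding hom_def Aut_def by auto
  have \<alpha>_in: "\<alpha> g x \<in> pts X" if "g \<in> carrier A" "x \<in> pts X" for g x
    using Bij_imp_funcset[OF \<alpha>Bij[OF that(1)]] that(2) by blast
  have \<alpha>_mult: "\<alpha> (g \<otimes>\<^bsub>A\<^esub> h) x = \<alpha> g (\<alpha> h x)" if "g \<in> carrier A" "h \<in> carrier A" "x \<in> pts X" for g h x
    using hom that \<alpha>Bij unfolding hom_def Aut_def BijGroup_def by (auto simp: compose_def)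
  show "makar_limanov X \<subseteq> constants X"
  proof
    fix f assume f: "f \<in> makar_limanov X"
    have inv: "f \<in> Reg X (pts X)" "x \<in> pts X \<Longrightarrow> f (\<alpha> (u t) x) = f x"
      if u: "\<And>t. u t \<in> carrier A" "\<And>r. r \<in> H.coordinate_ring \<Longrightarrow> \<exists>p. \<forall>t. r (u t) = poly p t"
        "\<And>s t. u (s + t) = u s \<otimes>\<^bsub>A\<^esub> u t" for u t x
    proof -
      have "f \<in> invariants X ((\<alpha> \<circ> u) ` carrier \<bbbG>\<^sub>a)"
        using f H.one_parameter_action[OF u swf assms(3)] unfolding makar_limanov_def by blast
      then show "f \<in> Reg X (pts X)" "x \<in> pts X \<Longrightarrow> f (\<alpha> (u t) x) = f x"
        unfolding invariants_def by (auto simp: additive_group_def)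
    qed
    \<comment> \<open>Regularity of \<open>f\<close> is part of membership in the invariants of some
      action of \<open>\<bbbG>\<^sub>a\<close>; the constant one-parameter subgroup supplies such an
      action.\<close>
    have reg: "f \<in> Reg X (pts X)"
    proof (rule inv(1))
      show "\<one>\<^bsub>A\<^esub> \<in> carrier A" "\<one>\<^bsub>A\<^esub> = \<one>\<^bsub>A\<^esub> \<otimes>\<^bsub>A\<^esub> \<one>\<^bsub>A\<^esub>" by auto
      show "\<exists>p. \<forall>t. r \<one>\<^bsub>A\<^esub> = poly p t" for r :: "'g \<Rightarrow> 'k" by (rule exI[of _ "[:r \<one>\<^bsub>A\<^esub>:]"]) simp
    qed
    obtain p where p: "p \<in> poly_funs n" "\<forall>g\<in>carrier A. f (\<alpha> g x0) = p (\<xi> g)"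
      using H.orbit_map_polynomial[OF swf assms(3) reg x0(1)] by (elim bexE)
    have \<phi>: "H.pull p g = f (\<alpha> g x0)" if "g \<in> carrier A" for g using p(2) that by (simp add: H.pull_def)
    have "\<exists>c. \<forall>g\<in>carrier A. H.pull p g = c"
    proof (rule L.one_parameter_invariant_const)
      show "H.pull p \<in> H.coordinate_ring" unfolding H.coordinate_ring_def using p(1) by (rule imageI)
      fix u t g
      assume u: "\<And>t. u t \<in> carrier A" "\<And>s t. u (s + t) = u s \<otimes>\<^bsub>A\<^esub> u t"
        "\<And>r. r \<in> H.coordinate_ring \<Longrightarrow> \<exists>p. \<forall>t. r (u t) = poly p t" and g: "g \<in> carrier A"
      have "H.pull p (u t \<otimes>\<^bsub>A\<^esub> g) = f (\<alpha> (u t) (\<alpha> g x0))"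
        using \<phi>[OF L.m_closed[OF u(1) g]] \<alpha>_mult[OF u(1) g x0(1)] by simp
      also have "\<dots> = f (\<alpha> g x0)" by (rule inv(2)[OF u(1,3,2) \<alpha>_in[OF g x0(1)]])
      finally show "H.pull p (u t \<otimes>\<^bsub>A\<^esub> g) = H.pull p g" using \<phi>[OF g] by simp
    qed
    then obtain c where c: "\<And>g. g \<in> carrier A \<Longrightarrow> f (\<alpha> g x0) = c" using \<phi> by auto
    \<comment> \<open>Otherwise the open set where \<open>f\<close> differs from \<open>c\<close>
      would meet the dense orbit.\<close>
    have "f x = c" if x: "x \<in> pts X" for x
    proof (rule ccontr)
      assume "f x \<noteq> c"
      with x have xD: "x \<in> {x \<in> pts X. f x \<noteq> c}" by simp
      have "x \<in> Top X closure_of ((\<lambda>\<sigma>. \<sigma> x0) ` G)" unfolding x0(2) by (rule x)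
      from this[unfolded in_closure_of, THEN conjunct2, THEN spec, THEN mp, OF conjI[OF xD regular_support_open[OF pre reg]]]
      obtain y where "y \<in> (\<lambda>\<sigma>. \<sigma> x0) ` G" "y \<in> {x \<in> pts X. f x \<noteq> c}" by (elim exE conjE)
      then show False using c assms(5) by auto
    qed
    moreover have "f \<in> extensional (pts X)" by (rule space_with_functionsD(1)[OF swf openin_topspace reg])
    ultimately have "f = (\<lambda>x\<in>pts X. c)" by (intro extensionalityI[of _ "pts X"]) auto
    then show "f \<in> constants X" unfolding constants_def by blast
  qed
qed

end
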